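(* For every sufficiently small $\epsilon>0$ there is a fully dynamic algorithm for bin packing, for input sequences in which every item has size at least $\epsilon/14$, that runs in time polynomial in the current number of items $n(t)$ and in $1/\epsilon$ per step, has asymptotic approximation ratio $1+O(\epsilon)$ (i.e. it is an asymptotic fully polynomial-time approximation scheme), and has migration factor $O\!\left(\frac{1}{\epsilon^3}\log\frac{1}{\epsilon}\right)$.
   Context: Fully dynamic bin packing: the input is a sequence $(i_1,A_1),(i_2,A_2),\dots$ with $A_t\in\{\mathrm{Insert},\mathrm{Delete}\}$; at time $t$ item $i_t$ (with size $s(i_t)\in(0,1]$) is inserted into or removed from the current item set $I(t)$, and the algorithm must maintain a packing $B_t$ of $I(t)$ into unit-capacity bins, possibly repacking previously packed items. The migration factor is $\max_t \mathrm{repack}(t)/s(i_t)$, where $\mathrm{repack}(t)$ is the total size of items whose bin in $B_t$ differs from their bin in $B_{t-1}$. The algorithm has asymptotic approximation ratio at most $\alpha$ if there is $f\in o(\mathrm{OPT})$ such that the number of bins of $B_t$ is at most $\alpha\,\mathrm{OPT}(I(t))+f$ for all inputs and all $t$, where $\mathrm{OPT}(I(t))$ is the offline optimum for the current item set. *)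

theory Defs
  imports
    Complex_Main
    "HOL-Library.Landau_Symbols"
    "HOL-Computational_Algebra.Polynomial"
begin

subsection \<open>Fully dynamic bin packing\<close>

text \<open>
  Items are named by natural numbers and \<open>s i\<close> is the size of item \<open>i\<close>. Time is 1-based: request
  number \<open>t\<close> of a sequence \<open>xs\<close> is \<open>xs ! (t - 1)\<close>, and \<open>items xs t\<close> is the item set \<open>I(t)\<close> right
  after it.
\<close>

datatype action = Insert | Delete

type_synonym request = "nat \<times> action"

fun apply_request :: "nat set \<Rightarrow> request \<Rightarrow> nat set" where
  "apply_request I (i, Insert) = insert i I"
| "apply_request I (i, Delete) = I - {i}"

definition items :: "request list \<Rightarrow> nat \<Rightarrow> nat set" where
  "items xs t = foldl apply_request {} (take t xs)"

fun admissible :: "nat set \<Rightarrow> request \<Rightarrow> bool" where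
  "admissible I (i, Insert) \<longleftrightarrow> i \<notin> I"
| "admissible I (i, Delete) \<longleftrightarrow> i \<in> I"

type_synonym input = "(nat \<Rightarrow> real) \<times> request list"

definition valid_inputs :: "input set" where
  "valid_inputs = {(s, xs).
     (\<forall>i \<in> fst ` set xs. 0 < s i \<and> s i \<le> 1) \<and>
     (\<forall>t \<in> {1..length xs}. admissible (items xs (t - 1)) (xs ! (t - 1)))}"

definition inputs_min_size :: "real \<Rightarrow> input set" where
  "inputs_min_size \<delta> = {(s, xs) \<in> valid_inputs. \<forall>i \<in> fst ` set xs. \<delta> \<le> s i}"

text \<open>A packing maps items to bins; bins are named by natural numbers.\<close>

definition is_packing :: "(nat \<Rightarrow> real) \<Rightarrow> nat set \<Rightarrow> (nat \<Rightarrow> nat) \<Rightarrow> bool" where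
  "is_packing s I B \<longleftrightarrow> (\<forall>b. (\<Sum>i \<in> {i \<in> I. B i = b}. s i) \<le> 1)"

definition num_bins :: "nat set \<Rightarrow> (nat \<Rightarrow> nat) \<Rightarrow> nat" where
  "num_bins I B = card (B ` I)"

definition OPT :: "(nat \<Rightarrow> real) \<Rightarrow> nat set \<Rightarrow> nat" where
  "OPT s I = (LEAST k. \<exists>B. is_packing s I B \<and> num_bins I B = k)"

text \<open>
  The behaviour of an algorithm: \<open>A s xs t\<close> is the packing \<open>B\<^sub>t\<close> it holds at time \<open>t\<close> on the input
  \<open>(s, xs)\<close>. That \<open>B\<^sub>t\<close> depends on the first \<open>t\<close> requests only is not a property of this type; it is
  enforced by \<open>computes\<close> below.
\<close>

type_synonym behaviour = "(nat \<Rightarrow> real) \<Rightarrow> request list \<Rightarrow> nat \<Rightarrow> (nat \<Rightarrow> nat)"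

definition maintains_packing :: "input set \<Rightarrow> behaviour \<Rightarrow> bool" where
  "maintains_packing D A \<longleftrightarrow>
     (\<forall>(s, xs) \<in> D. \<forall>t \<le> length xs. is_packing s (items xs t) (A s xs t))"

definition asymptotic_ratio_at_most :: "input set \<Rightarrow> behaviour \<Rightarrow> real \<Rightarrow> bool" where
  "asymptotic_ratio_at_most D A \<alpha> \<longleftrightarrow>
     (\<exists>f :: nat \<Rightarrow> real. f \<in> o(\<lambda>k. real k) \<and>
        (\<forall>(s, xs) \<in> D. \<forall>t \<le> length xs.
           real (num_bins (items xs t) (A s xs t))
             \<le> \<alpha> * real (OPT s (items xs t)) + f (OPT s (items xs t))))"

text \<open>Only items present both before and after step \<open>t\<close> have a bin in both packings.\<close>

definition repack :: "behaviour \<Rightarrow> (nat \<Rightarrow> real) \<Rightarrow> request list \<Rightarrow> nat \<Rightarrow> real" where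
  "repack A s xs t =
     (\<Sum>i \<in> {i \<in> items xs (t - 1) \<inter> items xs t. A s xs t i \<noteq> A s xs (t - 1) i}. s i)"

definition migration_factor_at_most :: "input set \<Rightarrow> behaviour \<Rightarrow> real \<Rightarrow> bool" where
  "migration_factor_at_most D A \<beta> \<longleftrightarrow>
     (\<forall>(s, xs) \<in> D. \<forall>t \<in> {1..length xs}. repack A s xs t / s (fst (xs ! (t - 1))) \<le> \<beta>)"

subsection \<open>Machine model: unit-cost real RAM\<close>

text \<open>
  While programs over arrays of natural numbers and arrays of reals, with indirect addressing;
  cell 0 of an array serves as a scalar variable. The reals come with exact field operations and
  comparisons but no rounding and no conversion to or from naturals, the naturals with addition
  and truncated subtraction only, and the only constants are natural numbers and integers. In
  particular, unit-cost multiplication never meets rounding or array addresses, so large numbers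
  cannot be used to pack and unpack many values in one step.
\<close>

datatype nexp =
    NNum nat
  | NCell string nexp
  | NAdd nexp nexp
  | NSub nexp nexp

datatype rexp =
    RNum int
  | RCell string nexp
  | RAdd rexp rexp
  | RSub rexp rexp
  | RMul rexp rexp
  | RDiv rexp rexp

datatype bexp =
    NLess nexp nexp
  | RLess rexp rexp
  | BNot bexp
  | BAnd bexp bexp

datatype com =
    Skip
  | NAssign string nexp nexp
  | RAssign string nexp rexp
  | Seq com com
  | Cond bexp com com
  | While bexp com

record state =
  nats :: "string \<Rightarrow> nat \<Rightarrow> nat"
  reals :: "string \<Rightarrow> nat \<Rightarrow> real"

fun nval :: "nexp \<Rightarrow> state \<Rightarrow> nat" where
  "nval (NNum n) \<sigma> = n"
| "nval (NCell a e) \<sigma> = nats \<sigma> a (nval e \<sigma>)"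
| "nval (NAdd e1 e2) \<sigma> = nval e1 \<sigma> + nval e2 \<sigma>"
| "nval (NSub e1 e2) \<sigma> = nval e1 \<sigma> - nval e2 \<sigma>"

fun rval :: "rexp \<Rightarrow> state \<Rightarrow> real" where
  "rval (RNum k) \<sigma> = of_int k"
| "rval (RCell a e) \<sigma> = reals \<sigma> a (nval e \<sigma>)"
| "rval (RAdd e1 e2) \<sigma> = rval e1 \<sigma> + rval e2 \<sigma>"
| "rval (RSub e1 e2) \<sigma> = rval e1 \<sigma> - rval e2 \<sigma>"
| "rval (RMul e1 e2) \<sigma> = rval e1 \<sigma> * rval e2 \<sigma>"
| "rval (RDiv e1 e2) \<sigma> = rval e1 \<sigma> / rval e2 \<sigma>"

fun bval :: "bexp \<Rightarrow> state \<Rightarrow> bool" where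
  "bval (NLess e1 e2) \<sigma> \<longleftrightarrow> nval e1 \<sigma> < nval e2 \<sigma>"
| "bval (RLess e1 e2) \<sigma> \<longleftrightarrow> rval e1 \<sigma> < rval e2 \<sigma>"
| "bval (BNot b) \<sigma> \<longleftrightarrow> \<not> bval b \<sigma>"
| "bval (BAnd b1 b2) \<sigma> \<longleftrightarrow> bval b1 \<sigma> \<and> bval b2 \<sigma>"

definition upd_cell :: "(string \<Rightarrow> nat \<Rightarrow> 'v) \<Rightarrow> string \<Rightarrow> nat \<Rightarrow> 'v \<Rightarrow> (string \<Rightarrow> nat \<Rightarrow> 'v)" where
  "upd_cell m a k v = m(a := (m a)(k := v))"

text \<open>
  \<open>exec c \<sigma> n \<tau>\<close>: program \<open>c\<close> started in \<open>\<sigma>\<close> terminates in \<open>\<tau>\<close> after \<open>n\<close> time units. Every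
  executed skip, assignment and test costs one unit; since the expressions of a program have fixed size,
  this is the number of elementary operations up to a factor depending on the program only.
\<close>

inductive exec :: "com \<Rightarrow> state \<Rightarrow> nat \<Rightarrow> state \<Rightarrow> bool" where
  Skip: "exec Skip \<sigma> 1 \<sigma>"
| NAssign: "exec (NAssign a i e) \<sigma> 1
    (\<sigma>\<lparr>nats := upd_cell (nats \<sigma>) a (nval i \<sigma>) (nval e \<sigma>)\<rparr>)"
| RAssign: "exec (RAssign a i e) \<sigma> 1
    (\<sigma>\<lparr>reals := upd_cell (reals \<sigma>) a (nval i \<sigma>) (rval e \<sigma>)\<rparr>)"
| Seq: "exec c1 \<sigma> n1 \<sigma>' \<Longrightarrow> exec c2 \<sigma>' n2 \<tau> \<Longrightarrow> exec (Seq c1 c2) \<sigma> (n1 + n2) \<tau>"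
| CondTrue: "bval b \<sigma> \<Longrightarrow> exec c1 \<sigma> n \<tau> \<Longrightarrow> exec (Cond b c1 c2) \<sigma> (1 + n) \<tau>"
| CondFalse: "\<not> bval b \<sigma> \<Longrightarrow> exec c2 \<sigma> n \<tau> \<Longrightarrow> exec (Cond b c1 c2) \<sigma> (1 + n) \<tau>"
| WhileFalse: "\<not> bval b \<sigma> \<Longrightarrow> exec (While b c) \<sigma> 1 \<sigma>"
| WhileTrue: "bval b \<sigma> \<Longrightarrow> exec c \<sigma> n1 \<sigma>' \<Longrightarrow> exec (While b c) \<sigma>' n2 \<tau> \<Longrightarrow>
    exec (While b c) \<sigma> (1 + n1 + n2) \<tau>"

lemma exec_deterministic:
  "exec c \<sigma> n \<tau> \<Longrightarrow> exec c \<sigma> n' \<tau>' \<Longrightarrow> n' = n \<and> \<tau>' = \<tau>"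
proof (induction arbitrary: n' \<tau>' rule: exec.induct)
  case (Seq c1 \<sigma> n1 \<sigma>' c2 n2 \<tau>)
  from Seq.prems show ?case
    by (cases rule: exec.cases) (use Seq.IH in blast)+
next
  case (WhileTrue b \<sigma> c n1 \<sigma>' n2 \<tau>)
  from WhileTrue.prems show ?case
  proof (cases rule: exec.cases)
    case (WhileTrue m1 \<sigma>'' m2)
    with WhileTrue.IH show ?thesis by blast
  qed (use WhileTrue.hyps in blast)
qed (erule exec.cases; force)+

subsection \<open>Programs as dynamic algorithms\<close>

text \<open>
  The memory persists between requests. It starts out zero except for the parameter \<open>\<epsilon>\<close>; each
  request is written to fixed cells and the program is run once. Of the size function the program
  is only told the size of the requested item. The bin of item \<open>i\<close> is read from cell \<open>i\<close> of the
  array \<open>bin\<close>.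
\<close>

definition initial_state :: "real \<Rightarrow> state" where
  "initial_state \<epsilon> = \<lparr>nats = (\<lambda>_ _. 0), reals = upd_cell (\<lambda>_ _. 0) ''eps'' 0 \<epsilon>\<rparr>"

fun load_request :: "(nat \<Rightarrow> real) \<Rightarrow> request \<Rightarrow> state \<Rightarrow> state" where
  "load_request s (i, a) \<sigma> = \<sigma>\<lparr>
     nats := upd_cell (upd_cell (nats \<sigma>) ''item'' 0 i)
               ''insert'' 0 (case a of Insert \<Rightarrow> 1 | Delete \<Rightarrow> 0),
     reals := upd_cell (reals \<sigma>) ''size'' 0 (s i)\<rparr>"

definition computes ::
  "com \<Rightarrow> real \<Rightarrow> input set \<Rightarrow> behaviour \<Rightarrow>
   ((nat \<Rightarrow> real) \<Rightarrow> request list \<Rightarrow> nat \<Rightarrow> nat) \<Rightarrow> bool" where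
  "computes P \<epsilon> D A T \<longleftrightarrow>
     (\<forall>(s, xs) \<in> D. \<exists>\<sigma> :: nat \<Rightarrow> state.
        \<sigma> 0 = initial_state \<epsilon> \<and>
        (\<forall>t \<in> {1..length xs}.
           exec P (load_request s (xs ! (t - 1)) (\<sigma> (t - 1))) (T s xs t) (\<sigma> t)) \<and>
        (\<forall>t \<le> length xs. A s xs t = nats (\<sigma> t) ''bin''))"

text \<open>Bivariate polynomials over the reals are univariate polynomials over \<open>real poly\<close>.\<close>

definition poly2 :: "real poly poly \<Rightarrow> real \<Rightarrow> real \<Rightarrow> real" where
  "poly2 p x y = poly (poly p [:x:]) y"

definition step_time_at_most ::
  "input set \<Rightarrow> ((nat \<Rightarrow> real) \<Rightarrow> request list \<Rightarrow> nat \<Rightarrow> nat) \<Rightarrow> (nat \<Rightarrow> real) \<Rightarrow> bool" where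
  "step_time_at_most D T b \<longleftrightarrow>
     (\<forall>(s, xs) \<in> D. \<forall>t \<in> {1..length xs}. real (T s xs t) \<le> b (card (items xs t)))"

end

theory Submission
  imports Defs
begin

text \<open>
  The algorithm works in epochs, and it needs neither linear programs nor their sensitivity theory,
  because lower order terms may depend on \<open>\<epsilon>\<close> and on \<open>n\<close>. At the start of an epoch it sorts the
  \<open>n\<close> current items by size, cuts them into \<open>L\<close> groups of about \<open>m = n / L\<close> items, and finds by
  exhaustive search an optimal packing pattern for one slot per group, each slot as large as the
  largest item of its group. Here \<open>L\<close> grows so slowly that \<open>L ^ L \<le> n\<close>. Filling \<open>m\<close> copies of the
  pattern with the items uses \<open>OPT + o(n)\<close> bins.

  The old packing is turned into the new one in a rolling fashion, \<open>1 / \<epsilon>\<^sup>2\<close> items per request, old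
  bin by old bin. The old bins are taken in an order in which every prefix of \<open>x\<close> of the \<open>N\<close> bins
  contains, up to \<open>O(sqrt n)\<close>, the fraction \<open>x / N\<close> of each group: greedily, the next bin is the one
  with least inner product with the current vector of deviations, which makes the squared norm of
  that vector grow by a bounded amount only. Hence about \<open>x / N\<close> of the new bins are open when \<open>x\<close>
  old ones have been emptied, and the number of bins in between is at most the maximum of the old
  and the new number, up to \<open>o(n)\<close>. An epoch lasts at most \<open>\<epsilon>\<^sup>2 n + 1\<close> requests; the items that
  arrive meanwhile sit in bins of their own, and since every item has size at least \<open>\<epsilon> / 14\<close> these
  are \<open>O(\<epsilon>) OPT\<close> bins.
\<close>

section \<open>Weakest preconditions with bounded loops\<close>

text \<open>The additive term of the asymptotic ratio is chosen after \<epsilon>, and items of size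
  at least \<open>\<epsilon> / 14\<close> give \<open>n <= 14 * OPT / \<epsilon>\<close>. So for
  fixed \<epsilon> every \<open>o(n)\<close> is an \<open>o(OPT)\<close>, however slowly it sets in,
  and only losses linear in \<open>n\<close> enter the ratio; these come from the requests of the
  current and of the previous epoch alone. The migration factor is even
  \<open>O(1 / \<epsilon>^3)\<close>, since the volume moved per request does not depend on the
  quality of the packing. The time bound permits computing a whole plan within one request, so only
  the moves are spread over the epoch. The obstacle is the mixed packing in between: old bins
  emptied in an arbitrary order could open nearly all new bins early, and old and new bins together
  might come close to \<open>2 * OPT\<close>. This is what the balanced order prevents; the same
  balancing, applied to an unknown optimal packing, also shows that a good pattern exists. The
  machine neither rounds nor multiplies or divides naturals, so powers, quotients, digits and the
  number of moves are all obtained by counting loops.\<close>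

definition setN :: "string \<Rightarrow> nat \<Rightarrow> nat \<Rightarrow> state \<Rightarrow> state" where
  "setN a k v \<sigma> = \<sigma>\<lparr>nats := upd_cell (nats \<sigma>) a k v\<rparr>"

definition setR :: "string \<Rightarrow> nat \<Rightarrow> real \<Rightarrow> state \<Rightarrow> state" where
  "setR a k v \<sigma> = \<sigma>\<lparr>reals := upd_cell (reals \<sigma>) a k v\<rparr>"

lemma set_simps [simp]:
  "nats (setN a k v \<sigma>) = (nats \<sigma>)(a := (nats \<sigma> a)(k := v))"
  "reals (setN a k v \<sigma>) = reals \<sigma>"
  "reals (setR a k x \<sigma>) = (reals \<sigma>)(a := (reals \<sigma> a)(k := x))"
  "nats (setR a k x \<sigma>) = nats \<sigma>"
  by (auto simp: setN_def setR_def upd_cell_def)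

text \<open>
  Besides partial correctness, \<open>wp\<close> demands that every loop stops within \<open>W\<close> iterations each time
  it is reached. This is all that is needed to bound the running time, see \<open>wp_sound\<close>.
\<close>

primrec wp :: "nat \<Rightarrow> com \<Rightarrow> (state \<Rightarrow> bool) \<Rightarrow> state \<Rightarrow> bool" where
  "wp W Skip Q = Q"
| "wp W (NAssign a i e) Q = (\<lambda>\<sigma>. Q (setN a (nval i \<sigma>) (nval e \<sigma>) \<sigma>))"
| "wp W (RAssign a i e) Q = (\<lambda>\<sigma>. Q (setR a (nval i \<sigma>) (rval e \<sigma>) \<sigma>))"
| "wp W (Seq c1 c2) Q = (\<lambda>\<sigma>. wp W c1 (wp W c2 Q) \<sigma>)"
| "wp W (Cond b c1 c2) Q = (\<lambda>\<sigma>. if bval b \<sigma> then wp W c1 Q \<sigma> else wp W c2 Q \<sigma>)"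
| "wp W (While b c) Q = rec_nat (\<lambda>\<tau>. \<not> bval b \<tau> \<and> Q \<tau>)
     (\<lambda>_ R \<tau>. if bval b \<tau> then wp W c R \<tau> else Q \<tau>) W"

text \<open>Exponent of the time bound. For \<open>3 <= W\<close> one further factor
  \<open>W\<close> absorbs the overhead of a sequence or a conditional; a loop takes two, one for
  its iterations and one for its tests. It depends on the program only, so the time is polynomial in
  \<open>W\<close>.\<close>

primrec dep :: "com \<Rightarrow> nat" where
  "dep Skip = 0"
| "dep (NAssign a i e) = 0"
| "dep (RAssign a i e) = 0"
| "dep (Seq c1 c2) = Suc (max (dep c1) (dep c2))"
| "dep (Cond b c1 c2) = Suc (max (dep c1) (dep c2))"
| "dep (While b c) = dep c + 2"

lemma wp_sound:
  assumes W: "3 \<le> W" and "wp W c Q \<sigma>"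
  shows "\<exists>k \<tau>. exec c \<sigma> k \<tau> \<and> k \<le> W ^ dep c \<and> Q \<tau>"
  using assms(2)
proof (induction c arbitrary: Q \<sigma>)
  case Skip
  then show ?case by (intro exI[of _ 1] exI[of _ \<sigma>]) (auto intro: exec.Skip[simplified])
next
  case (NAssign a i e)
  then show ?case by (force intro: exec.NAssign simp: setN_def)
next
  case (RAssign a i e)
  then show ?case by (force intro: exec.RAssign simp: setR_def)
next
  case (Seq c1 c2)
  from Seq.prems have "wp W c1 (wp W c2 Q) \<sigma>" by simp
  from Seq.IH(1)[OF this] obtain k1 \<tau>1 where 1: "exec c1 \<sigma> k1 \<tau>1" "k1 \<le> W ^ dep c1" "wp W c2 Q \<tau>1"
    by blast
  from Seq.IH(2)[OF 1(3)] obtain k2 \<tau> where 2: "exec c2 \<tau>1 k2 \<tau>" "k2 \<le> W ^ dep c2" "Q \<tau>"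
    by blast
  let ?d = "max (dep c1) (dep c2)"
  have "W ^ dep c1 \<le> W ^ ?d" "W ^ dep c2 \<le> W ^ ?d"
    using W by (auto intro: power_increasing)
  then have "k1 + k2 \<le> 2 * W ^ ?d" using 1 2 by linarith
  also have "\<dots> \<le> W * W ^ ?d" using W by (intro mult_right_mono) auto
  finally show ?case using 1 2 by (auto intro!: exec.Seq exI[of _ "k1 + k2"])
next
  case (Cond b c1 c2)
  let ?d = "max (dep c1) (dep c2)"
  have le: "W ^ dep c1 \<le> W ^ ?d" "W ^ dep c2 \<le> W ^ ?d"
    using W by (auto intro: power_increasing)
  have pos: "1 \<le> W ^ ?d" using W by simp
  have "2 * W ^ ?d \<le> W * W ^ ?d" using W by (intro mult_right_mono) auto
  then have le': "1 + k \<le> W * W ^ ?d" if "k \<le> W ^ ?d" for k using pos that by linarith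
  show ?case
  proof (cases "bval b \<sigma>")
    case True
    with Cond.prems have "wp W c1 Q \<sigma>" by simp
    from Cond.IH(1)[OF this] obtain k \<tau> where "exec c1 \<sigma> k \<tau>" "k \<le> W ^ dep c1" "Q \<tau>" by blast
    then show ?thesis using True le le'[of k]
      by (auto intro!: exec.CondTrue exI[of _ "1 + k"])
  next
    case False
    with Cond.prems have "wp W c2 Q \<sigma>" by simp
    from Cond.IH(2)[OF this] obtain k \<tau> where "exec c2 \<sigma> k \<tau>" "k \<le> W ^ dep c2" "Q \<tau>" by blast
    then show ?thesis using False le le'[of k]
      by (auto intro!: exec.CondFalse exI[of _ "1 + k"])
  qed
next
  case (While b c)
  let ?I = "\<lambda>N. rec_nat (\<lambda>\<tau>. \<not> bval b \<tau> \<and> Q \<tau>)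
    (\<lambda>_ R \<tau>. if bval b \<tau> then wp W c R \<tau> else Q \<tau>) N"
  \<comment> \<open>The induction is on the remaining budget \<open>N\<close> of iterations. Each
    iteration pays one unit for its test, and the failing test at the end is the summand 1.\<close>
  have *: "\<exists>k \<tau>. exec (While b c) \<sigma> k \<tau> \<and> k \<le> 1 + N * (1 + W ^ dep c) \<and> Q \<tau>" if "?I N \<sigma>" for N \<sigma>
    using that
  proof (induction N arbitrary: \<sigma>)
    case 0
    then show ?case by (intro exI[of _ "Suc 0"] exI[of _ \<sigma>]) (auto intro: exec.WhileFalse[simplified])
  next
    case (Suc N)
    show ?case
    proof (cases "bval b \<sigma>")
      case False
      then show ?thesis using Suc.prems
        by (intro exI[of _ 1] exI[of _ \<sigma>]) (auto intro: exec.WhileFalse[simplified])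
    next
      case True
      then have "wp W c (?I N) \<sigma>" using Suc.prems by auto
      from While.IH[OF this] obtain k1 \<tau>1 where 1: "exec c \<sigma> k1 \<tau>1" "k1 \<le> W ^ dep c" "?I N \<tau>1"
        by blast
      from Suc.IH[OF 1(3)] obtain k2 \<tau> where
        2: "exec (While b c) \<tau>1 k2 \<tau>" "k2 \<le> 1 + N * (1 + W ^ dep c)" "Q \<tau>" by blast
      have "exec (While b c) \<sigma> (1 + k1 + k2) \<tau>" by (rule exec.WhileTrue[OF True 1(1) 2(1)])
      moreover have "1 + k1 + k2 \<le> 1 + Suc N * (1 + W ^ dep c)" using 1 2 by simp
      ultimately show ?thesis using 2 by blast
    qed
  qed
  from While.prems have "?I W \<sigma>" by simp
  from *[OF this] obtain k \<tau> where k: "exec (While b c) \<sigma> k \<tau>" "k \<le> 1 + W * (1 + W ^ dep c)" "Q \<tau>"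
    by blast
  define P where "P = W ^ dep c"
  have P: "1 \<le> P" using W by (simp add: P_def)
  have "k \<le> 1 + W * (1 + P)"
    using k(2) by (simp add: P_def)
  also have "\<dots> \<le> W * (3 * P)"
  proof -
    have "1 \<le> W * P" "W \<le> W * P" using W P by simp_all
    moreover have "W * (1 + P) = W + W * P" "W * (3 * P) = 3 * (W * P)" by (simp_all add: algebra_simps)
    ultimately show ?thesis by linarith
  qed
  also have "\<dots> \<le> W * (W * P)" using W by (intro mult_left_mono mult_right_mono) auto
  finally show ?case using k by (auto simp: P_def)
qed

section \<open>Frame conditions and rules for loops\<close>

primrec nw :: "com \<Rightarrow> string set" where
  "nw Skip = {}"
| "nw (NAssign a i e) = {a}"
| "nw (RAssign a i e) = {}"
| "nw (Seq c1 c2) = nw c1 \<union> nw c2"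
| "nw (Cond b c1 c2) = nw c1 \<union> nw c2"
| "nw (While b c) = nw c"

primrec rw :: "com \<Rightarrow> string set" where
  "rw Skip = {}"
| "rw (NAssign a i e) = {}"
| "rw (RAssign a i e) = {a}"
| "rw (Seq c1 c2) = rw c1 \<union> rw c2"
| "rw (Cond b c1 c2) = rw c1 \<union> rw c2"
| "rw (While b c) = rw c"

text \<open>Frames are kept for whole arrays. This is coarse, but it can be read off the program
  text, and the rules below hand it over without a separate proof.\<close>

definition agree :: "com \<Rightarrow> state \<Rightarrow> state \<Rightarrow> bool" where
  "agree c \<sigma> \<tau> \<longleftrightarrow> (\<forall>a. a \<notin> nw c \<longrightarrow> nats \<tau> a = nats \<sigma> a) \<and> (\<forall>a. a \<notin> rw c \<longrightarrow> reals \<tau> a = reals \<sigma> a)"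

lemma agreeN: "agree c \<sigma> \<tau> \<Longrightarrow> a \<notin> nw c \<Longrightarrow> nats \<tau> a = nats \<sigma> a"
  and agreeR: "agree c \<sigma> \<tau> \<Longrightarrow> a \<notin> rw c \<Longrightarrow> reals \<tau> a = reals \<sigma> a"
  by (auto simp: agree_def)

lemma agree_refl [simp]: "agree c \<sigma> \<sigma>"
  by (simp add: agree_def)

lemma agree_trans: "agree c \<sigma> \<tau> \<Longrightarrow> agree c \<tau> \<upsilon> \<Longrightarrow> agree c \<sigma> \<upsilon>"
  by (simp add: agree_def)

text \<open>Serves as the frame rule as well: the new postcondition may use that arrays not written
  by \<open>c\<close> are unchanged, so a specification mentions only what its program
  computes.\<close>

lemma wp_mono:
  assumes "wp W c Q \<sigma>" "\<And>\<tau>. agree c \<sigma> \<tau> \<Longrightarrow> Q \<tau> \<Longrightarrow> Q' \<tau>"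
  shows "wp W c Q' \<sigma>"
  using assms
proof (induction c arbitrary: Q Q' \<sigma>)
  case (Seq c1 c2)
  from Seq.prems(1) have "wp W c1 (wp W c2 Q) \<sigma>" by simp
  then have "wp W c1 (wp W c2 Q') \<sigma>"
  proof (rule Seq.IH(1))
    fix \<tau> assume 1: "agree c1 \<sigma> \<tau>" and "wp W c2 Q \<tau>"
    from this(2) show "wp W c2 Q' \<tau>"
    proof (rule Seq.IH(2))
      fix \<upsilon> assume "agree c2 \<tau> \<upsilon>" "Q \<upsilon>"
      with 1 show "Q' \<upsilon>" by (intro Seq.prems(2)) (auto simp: agree_def)
    qed
  qed
  then show ?case by simp
next
  case (Cond b c1 c2)
  then show ?case by (auto simp: agree_def split: if_splits)
next
  case (While b c)
  let ?I = "\<lambda>Q N. rec_nat (\<lambda>\<tau>. \<not> bval b \<tau> \<and> Q \<tau>)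
    (\<lambda>_ R \<tau>. if bval b \<tau> then wp W c R \<tau> else Q \<tau>) N"
  have mono: "wp W c R' \<tau>" if "wp W c R \<tau>" "\<And>\<upsilon>. agree c \<tau> \<upsilon> \<Longrightarrow> R \<upsilon> \<Longrightarrow> R' \<upsilon>" for R R' \<tau>
    using that by (rule While.IH)
  have "?I Q' N \<sigma>" if "?I Q N \<sigma>" "\<And>\<tau>. agree c \<sigma> \<tau> \<Longrightarrow> Q \<tau> \<Longrightarrow> Q' \<tau>" for N
    using that
  proof (induction N arbitrary: \<sigma>)
    case 0
    then show ?case by auto
  next
    case (Suc N)
    show ?case
    proof (cases "bval b \<sigma>")
      case True
      with Suc.prems have "wp W c (?I Q N) \<sigma>" by simp
      then have "wp W c (?I Q' N) \<sigma>"
      proof (rule mono)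
        fix \<tau> assume a: "agree c \<sigma> \<tau>" "?I Q N \<tau>"
        from a(2) show "?I Q' N \<tau>"
          by (rule Suc.IH) (blast intro: Suc.prems(2) agree_trans[OF a(1)])
      qed
      then show ?thesis using True by simp
    next
      case False
      with Suc.prems show ?thesis by simp
    qed
  qed
  from this[of W] While.prems have "?I Q' W \<sigma>" by (simp add: agree_def)
  then show ?case by simp
qed (auto simp: agree_def)

text \<open>The number \<open>k\<close> in \<open>Inv k\<close> bounds the iterations still to come:
  it drops by one per iteration, and at 0 the test must fail. The loop may stop earlier, so the last
  premise allows any \<open>k\<close>.\<close>

lemma wp_While:
  assumes "Inv N \<sigma>" "N \<le> W"
    and step: "\<And>k \<tau>. k < N \<Longrightarrow> Inv (Suc k) \<tau> \<Longrightarrow> agree c \<sigma> \<tau> \<Longrightarrow> bval b \<tau> \<Longrightarrow>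
      wp W c (\<lambda>\<upsilon>. agree c \<sigma> \<upsilon> \<longrightarrow> Inv k \<upsilon>) \<tau>"
    and bv: "\<And>\<tau>. Inv 0 \<tau> \<Longrightarrow> agree c \<sigma> \<tau> \<Longrightarrow> \<not> bval b \<tau>"
    and post: "\<And>k \<tau>. Inv k \<tau> \<Longrightarrow> agree c \<sigma> \<tau> \<Longrightarrow> \<not> bval b \<tau> \<Longrightarrow> Q \<tau>"
  shows "wp W (While b c) Q \<sigma>"
proof -
  let ?I = "\<lambda>N. rec_nat (\<lambda>\<tau>. \<not> bval b \<tau> \<and> Q \<tau>)
    (\<lambda>_ R \<tau>. if bval b \<tau> then wp W c R \<tau> else Q \<tau>) N"
  have "?I M \<tau>" if "k \<le> N" "Inv k \<tau>" "agree c \<sigma> \<tau>" "k \<le> M" for k M \<tau>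
    using that
  proof (induction M arbitrary: k \<tau>)
    case 0
    then show ?case using bv post by auto
  next
    case (Suc M)
    show ?case
    proof (cases "bval b \<tau>")
      case False
      then show ?thesis using Suc.prems post by auto
    next
      case True
      with bv Suc.prems obtain j where j: "k = Suc j" by (cases k) auto
      have "wp W c (?I M) \<tau>"
      proof (rule wp_mono)
        show "wp W c (\<lambda>\<upsilon>. agree c \<sigma> \<upsilon> \<longrightarrow> Inv j \<upsilon>) \<tau>"
          using step[of j \<tau>] True Suc.prems j by simp
      next
        fix \<upsilon> assume a: "agree c \<tau> \<upsilon>" "agree c \<sigma> \<upsilon> \<longrightarrow> Inv j \<upsilon>"
        have "agree c \<sigma> \<upsilon>" by (rule agree_trans[OF Suc.prems(3) a(1)])
        with a(2) show "?I M \<upsilon>" using Suc.prems j by (intro Suc.IH[of j]) auto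
      qed
      then show ?thesis using True by simp
    qed
  qed
  from this[of N \<sigma> W] show ?thesis using assms(1,2) by auto
qed

declare wp.simps(6) [simp del]
lemmas wp_basic = wp.simps(1-5)

definition For :: "string \<Rightarrow> nexp \<Rightarrow> com \<Rightarrow> com" where
  "For v e c = Seq (NAssign v (NNum 0) (NNum 0)) (While (NLess (NCell v (NNum 0)) e)
     (Seq c (NAssign v (NNum 0) (NAdd (NCell v (NNum 0)) (NNum 1)))))"

lemma nw_For [simp]: "nw (For v e c) = insert v (nw c)"
  and rw_For [simp]: "rw (For v e c) = rw c"
  by (auto simp: For_def)

text \<open>The bound is evaluated again before each iteration; premise \<open>e\<close> says that
  it stays \<open>N\<close> as long as only arrays written by the loop change. Since the body does
  not write the counter, this equals \<open>k\<close> in round \<open>k\<close>.\<close>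

lemma wp_For:
  assumes "N \<le> W" "v \<notin> nw c" "Inv 0 (setN v 0 0 \<sigma>)"
    and e: "\<And>\<tau>. agree (For v e c) \<sigma> \<tau> \<Longrightarrow> nval e \<tau> = N"
    and step: "\<And>k \<tau>. k < N \<Longrightarrow> Inv k \<tau> \<Longrightarrow> nats \<tau> v 0 = k \<Longrightarrow> agree (For v e c) \<sigma> \<tau> \<Longrightarrow>
      wp W c (\<lambda>\<upsilon>. agree c \<tau> \<upsilon> \<longrightarrow> Inv (Suc k) (setN v 0 (Suc k) \<upsilon>)) \<tau>"
    and post: "\<And>\<tau>. Inv N \<tau> \<Longrightarrow> agree (For v e c) \<sigma> \<tau> \<Longrightarrow> Q \<tau>"
  shows "wp W (For v e c) Q \<sigma>"
proof -
  let ?c = "Seq c (NAssign v (NNum 0) (NAdd (NCell v (NNum 0)) (NNum 1)))"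
  let ?\<sigma> = "setN v 0 0 \<sigma>"
  have agr: "agree (For v e c) \<sigma> \<tau>" if "agree ?c ?\<sigma> \<tau>" for \<tau>
    using that by (auto simp: agree_def)
  have "wp W (While (NLess (NCell v (NNum 0)) e) ?c) Q ?\<sigma>"
  \<comment> \<open>The rule for loops counts down while the invariant here counts up, hence
    \<open>N - k\<close>.\<close>
  proof (rule wp_While[where N = N and Inv = "\<lambda>k \<tau>. k \<le> N \<and> nats \<tau> v 0 = N - k \<and> Inv (N - k) \<tau>"])
    show "N \<le> N \<and> nats ?\<sigma> v 0 = N - N \<and> Inv (N - N) ?\<sigma>"
      using assms(3) by simp
  next
    fix k \<tau>
    assume k: "k < N" and inv: "Suc k \<le> N \<and> nats \<tau> v 0 = N - Suc k \<and> Inv (N - Suc k) \<tau>"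
      and a: "agree ?c ?\<sigma> \<tau>"
    have eq: "Suc (N - Suc k) = N - k" using k by simp
    have "wp W c (\<lambda>\<upsilon>. agree c \<tau> \<upsilon> \<longrightarrow> Inv (N - k) (setN v 0 (N - k) \<upsilon>)) \<tau>"
      using step[of "N - Suc k" \<tau>] inv agr[OF a] k unfolding eq by auto
    then have "wp W c (\<lambda>\<upsilon>. k \<le> N \<and> nats (setN v 0 (Suc (nats \<upsilon> v 0)) \<upsilon>) v 0 = N - k
        \<and> Inv (N - k) (setN v 0 (Suc (nats \<upsilon> v 0)) \<upsilon>)) \<tau>"
    proof (rule wp_mono)
      fix \<upsilon> assume b: "agree c \<tau> \<upsilon>" "agree c \<tau> \<upsilon> \<longrightarrow> Inv (N - k) (setN v 0 (N - k) \<upsilon>)"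
      have "nats \<upsilon> v 0 = N - Suc k" using b(1) inv assms(2) by (simp add: agreeN)
      then show "k \<le> N \<and> nats (setN v 0 (Suc (nats \<upsilon> v 0)) \<upsilon>) v 0 = N - k
        \<and> Inv (N - k) (setN v 0 (Suc (nats \<upsilon> v 0)) \<upsilon>)"
        using b k eq by simp
    qed
    then show "wp W ?c (\<lambda>\<upsilon>. agree ?c ?\<sigma> \<upsilon> \<longrightarrow> k \<le> N \<and> nats \<upsilon> v 0 = N - k \<and> Inv (N - k) \<upsilon>) \<tau>"
      unfolding wp.simps nval.simps by (rule wp_mono) (use eq in auto)
  next
    fix \<tau> assume "0 \<le> N \<and> nats \<tau> v 0 = N - 0 \<and> Inv (N - 0) \<tau>" "agree ?c ?\<sigma> \<tau>"
    then show "\<not> bval (NLess (NCell v (NNum 0)) e) \<tau>" using e[OF agr] by simp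
  next
    fix k \<tau> assume *: "k \<le> N \<and> nats \<tau> v 0 = N - k \<and> Inv (N - k) \<tau>" and a: "agree ?c ?\<sigma> \<tau>"
      and "\<not> bval (NLess (NCell v (NNum 0)) e) \<tau>"
    then have "k = 0 \<or> N = 0" using e[OF agr[OF a]] by auto
    with * have "Inv N \<tau>" by auto
    with agr[OF a] show "Q \<tau>" by (intro post)
  qed fact
  then show ?thesis by (simp add: For_def)
qed

section \<open>Balanced orders of the bins\<close>

text \<open>What \<open>M\<close> has in excess is what the other bins lack. So over the bins
  outside \<open>M\<close>, the inner products with \<open>D\<close>, each reduced by that of the
  mean vector, sum to minus the squared norm of \<open>D\<close>. Hence the least of them is at most
  that of the mean, and the linear term in the expansion of the new squared norm is not positive.
  The squares of the bin and of the mean contribute \<open>\<Delta>\<^sup>2\<close> each.\<close>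

lemma balance_step:
  fixes c :: "'b \<Rightarrow> nat \<Rightarrow> real"
  assumes fin: "finite Bn" and M: "M \<subseteq> Bn" and b: "b \<in> Bn - M"
    and min: "\<And>b'. b' \<in> Bn - M \<Longrightarrow> (\<Sum>k<L. c b k * D k) \<le> (\<Sum>k<L. c b' k * D k)"
    and G: "\<And>k. k < L \<Longrightarrow> G k = (\<Sum>b'\<in>Bn. c b' k)"
    and D: "\<And>k. k < L \<Longrightarrow> D k = (\<Sum>b'\<in>M. c b' k) - card M * (G k / card Bn)"
    and nonneg: "\<And>b' k. b' \<in> Bn \<Longrightarrow> k < L \<Longrightarrow> 0 \<le> c b' k"
    and \<Delta>: "\<And>b'. b' \<in> Bn \<Longrightarrow> (\<Sum>k<L. c b' k) \<le> \<Delta>"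
  shows "(\<Sum>k<L. (D k + c b k - G k / card Bn)\<^sup>2) \<le> (\<Sum>k<L. (D k)\<^sup>2) + 2 * \<Delta>\<^sup>2"
proof -
  define N where "N = card Bn"
  define S where "S b' = (\<Sum>k<L. c b' k * D k)" for b'
  define A where "A = (\<Sum>k<L. G k / N * D k)"
  have N0: "0 < N" using fin b by (auto simp: N_def card_gt_0_iff)
  have cM: "card M \<le> N" "real (card (Bn - M)) = N - card M"
    using card_mono[OF fin M] card_Diff_subset[of M Bn] M fin finite_subset[OF M fin]
    by (auto simp: N_def of_nat_diff)
  have "(\<Sum>b'\<in>Bn - M. S b' - A) = - (\<Sum>k<L. (D k)\<^sup>2)"
  proof -
    have "(\<Sum>b'\<in>Bn - M. S b') = (\<Sum>k<L. (\<Sum>b'\<in>Bn - M. c b' k) * D k)"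
      unfolding S_def by (subst sum.swap) (simp add: sum_distrib_right)
    also have "\<dots> = (\<Sum>k<L. (G k - (\<Sum>b'\<in>M. c b' k)) * D k)"
      using G sum_diff[OF fin M] by (intro sum.cong) auto
    finally have "(\<Sum>b'\<in>Bn - M. S b' - A) =
        (\<Sum>k<L. (G k - (\<Sum>b'\<in>M. c b' k)) * D k) - (N - real (card M)) * A"
      by (simp add: sum_subtractf cM)
    also have "\<dots> = (\<Sum>k<L. (G k - (\<Sum>b'\<in>M. c b' k)) * D k - (N - real (card M)) * (G k / N * D k))"
      by (simp add: sum_subtractf A_def sum_distrib_left)
    also have "\<dots> = (\<Sum>k<L. - (D k)\<^sup>2)"
    proof (intro sum.cong refl)
      fix k assume "k \<in> {..<L}"
      then have s: "(\<Sum>b'\<in>M. c b' k) = D k + card M * (G k / N)" using D by (simp add: N_def)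
      show "(G k - (\<Sum>b'\<in>M. c b' k)) * D k - (N - real (card M)) * (G k / N * D k) = - (D k)\<^sup>2"
        unfolding s using N0 by (simp add: field_simps power2_eq_square)
    qed
    finally show ?thesis by (simp add: sum_negf)
  qed
  also have "\<dots> \<le> 0" by (simp add: sum_nonneg)
  finally have le0: "(\<Sum>b'\<in>Bn - M. S b' - A) \<le> 0" .
  have SA: "S b \<le> A"
  proof (rule ccontr)
    assume "\<not> S b \<le> A"
    then have "0 < (\<Sum>b'\<in>Bn - M. S b' - A)"
      using min b fin by (intro sum_pos) (force simp: S_def)+
    with le0 show False by simp
  qed
  \<comment> \<open>For nonnegative vectors the Euclidean norm is at most the sum of the entries;
    thus \<open>\<Delta>\<close> bounds the norm of a bin and of the mean.\<close>
  have sq: "(\<Sum>k<L. (f k)\<^sup>2) \<le> (\<Sum>k<L. f k)\<^sup>2" if "\<And>k. k < L \<Longrightarrow> 0 \<le> f k" for f :: "nat \<Rightarrow> real"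
  proof -
    have "(\<Sum>k<L. (f k)\<^sup>2) \<le> (\<Sum>k<L. f k * (\<Sum>k<L. f k))"
      using that by (intro sum_mono) (auto simp: power2_eq_square intro!: mult_left_mono member_le_sum)
    then show ?thesis by (simp add: power2_eq_square sum_distrib_right)
  qed
  have cb: "0 \<le> c b k" if "k < L" for k using nonneg b that by auto
  have G0: "0 \<le> G k" if "k < L" for k using G nonneg that by (auto intro: sum_nonneg)
  have "(\<Sum>k<L. c b k) \<le> \<Delta>" using \<Delta> b by auto
  moreover have "0 \<le> (\<Sum>k<L. c b k)" using cb by (auto intro: sum_nonneg)
  ultimately have 1: "(\<Sum>k<L. (c b k)\<^sup>2) \<le> \<Delta>\<^sup>2"
    using sq[of "c b"] cb by (meson order.trans power_mono)
  have "(\<Sum>k<L. G k / N) = (\<Sum>b'\<in>Bn. \<Sum>k<L. c b' k) / N"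
    by (subst sum.swap) (simp add: G sum_divide_distrib)
  also have "\<dots> \<le> (\<Sum>b'\<in>Bn. \<Delta>) / N" using \<Delta> by (intro divide_right_mono sum_mono) auto
  also have "\<dots> = \<Delta>" using N0 by (simp add: N_def)
  finally have "(\<Sum>k<L. G k / N) \<le> \<Delta>" .
  moreover have "0 \<le> (\<Sum>k<L. G k / N)" using G0 by (auto intro: sum_nonneg)
  ultimately have 2: "(\<Sum>k<L. (G k / N)\<^sup>2) \<le> \<Delta>\<^sup>2"
    using sq[of "\<lambda>k. G k / N"] G0 by (meson order.trans power_mono divide_nonneg_nonneg of_nat_0_le_iff)
  have "(\<Sum>k<L. (D k + c b k - G k / N)\<^sup>2) \<le>
      (\<Sum>k<L. (D k)\<^sup>2 + 2 * (c b k * D k - G k / N * D k) + ((c b k)\<^sup>2 + (G k / N)\<^sup>2))"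
  proof (intro sum_mono)
    fix k assume "k \<in> {..<L}"
    then have "0 \<le> c b k * (G k / N)" using cb G0 by simp
    moreover have "(d + u - v)\<^sup>2 \<le> d\<^sup>2 + 2 * (u * d - v * d) + (u\<^sup>2 + v\<^sup>2)" if "0 \<le> u * v"
      for d u v :: real using that by (simp add: power2_eq_square algebra_simps)
    ultimately show "(D k + c b k - G k / N)\<^sup>2 \<le> (D k)\<^sup>2 + 2 * (c b k * D k - G k / N * D k) + ((c b k)\<^sup>2 + (G k / N)\<^sup>2)"
      by blast
  qed
  also have "\<dots> = (\<Sum>k<L. (D k)\<^sup>2) + 2 * (S b - A) + ((\<Sum>k<L. (c b k)\<^sup>2) + (\<Sum>k<L. (G k / N)\<^sup>2))"
    unfolding S_def A_def by (simp only: sum.distrib sum_subtractf sum_distrib_left[symmetric])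
  also have "\<dots> \<le> (\<Sum>k<L. (D k)\<^sup>2) + 2 * \<Delta>\<^sup>2" using SA add_mono[OF 1 2] by simp
  finally show ?thesis by (simp add: N_def)
qed

text \<open>The greedy choice starts with deviation zero and each bin adds at most
  \<open>2 * \<Delta>\<^sup>2\<close>. Existence is enough here: the subset belongs to the analysis
  of an optimal packing, which no program sees.\<close>

lemma balanced_subset:
  fixes c :: "'b \<Rightarrow> nat \<Rightarrow> real"
  assumes fin: "finite Bn"
    and G: "\<And>k. k < L \<Longrightarrow> G k = (\<Sum>b'\<in>Bn. c b' k)"
    and nonneg: "\<And>b' k. b' \<in> Bn \<Longrightarrow> k < L \<Longrightarrow> 0 \<le> c b' k"
    and \<Delta>: "\<And>b'. b' \<in> Bn \<Longrightarrow> (\<Sum>k<L. c b' k) \<le> \<Delta>"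
    and "x \<le> card Bn"
  shows "\<exists>M\<subseteq>Bn. card M = x \<and> (\<Sum>k<L. ((\<Sum>b\<in>M. c b k) - x * (G k / card Bn))\<^sup>2) \<le> 2 * x * \<Delta>\<^sup>2"
  using assms(5)
proof (induction x)
  case 0
  show ?case by (intro exI[of _ "{}"]) simp
next
  case (Suc x)
  then obtain M where M: "M \<subseteq> Bn" "card M = x"
    and le: "(\<Sum>k<L. ((\<Sum>b\<in>M. c b k) - x * (G k / card Bn))\<^sup>2) \<le> 2 * x * \<Delta>\<^sup>2" by auto
  define D where "D k = (\<Sum>b\<in>M. c b k) - x * (G k / card Bn)" for k
  have fM: "finite M" using M fin finite_subset by blast
  have "Bn - M \<noteq> {}" using M Suc.prems fM by (metis Diff_eq_empty_iff card_mono not_less_eq_eq)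
  with fin obtain b where b: "b \<in> Bn - M"
    and "\<And>b'. b' \<in> Bn - M \<Longrightarrow> (\<Sum>k<L. c b k * D k) \<le> (\<Sum>k<L. c b' k * D k)"
    using ex_min_if_finite[of "(\<lambda>b. \<Sum>k<L. c b k * D k) ` (Bn - M)"] by (force simp: not_less)
  then have step: "(\<Sum>k<L. (D k + c b k - G k / card Bn)\<^sup>2) \<le> (\<Sum>k<L. (D k)\<^sup>2) + 2 * \<Delta>\<^sup>2"
    using M by (intro balance_step[where M = M]) (auto simp: D_def assms)
  have "(\<Sum>k<L. ((\<Sum>b\<in>insert b M. c b k) - Suc x * (G k / card Bn))\<^sup>2)
      = (\<Sum>k<L. (D k + c b k - G k / card Bn)\<^sup>2)"
    using b fM by (intro sum.cong) (auto simp: D_def algebra_simps add_divide_distrib)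
  also have "\<dots> \<le> 2 * Suc x * \<Delta>\<^sup>2"
    using step le by (simp add: D_def algebra_simps)
  finally show ?case using M b fM by (intro exI[of _ "insert b M"]) auto
qed

section \<open>Bin packing\<close>

lemma packing_bin_card:
  assumes "is_packing s I B" "finite I" "\<And>i. i \<in> I \<Longrightarrow> \<delta> \<le> s i" "0 < \<delta>"
  shows "real (card {i \<in> I. B i = b}) \<le> 1 / \<delta>"
proof -
  have "real (card {i \<in> I. B i = b}) * \<delta> = (\<Sum>i\<in>{i \<in> I. B i = b}. \<delta>)" by simp
  also have "\<dots> \<le> (\<Sum>i\<in>{i \<in> I. B i = b}. s i)" using assms by (intro sum_mono) auto
  also have "\<dots> \<le> 1" using assms(1) by (auto simp: is_packing_def)
  finally show ?thesis using assms(4) by (simp add: field_simps)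
qed

lemma OPT_le: "is_packing s I B \<Longrightarrow> OPT s I \<le> num_bins I B"
  unfolding OPT_def by (rule Least_le) blast

lemma inj_is_packing:
  assumes "inj_on B I" "\<And>i. i \<in> I \<Longrightarrow> s i \<le> 1"
  shows "is_packing s I B"
  unfolding is_packing_def
proof
  fix b
  consider "{i \<in> I. B i = b} = {}" | i where "i \<in> I" "{i \<in> I. B i = b} = {i}"
    using assms(1) by (auto dest: inj_onD)
  then show "(\<Sum>i\<in>{i \<in> I. B i = b}. s i) \<le> 1"
  proof cases
    case 1
    show ?thesis unfolding 1 by simp
  next
    case 2
    show ?thesis unfolding 2(2) using assms(2) 2(1) by simp
  qed
qed

lemma OPT_packing:
  assumes "\<And>i. i \<in> I \<Longrightarrow> s i \<le> 1"
  obtains B where "is_packing s I B" "num_bins I B = OPT s I"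
proof -
  have "is_packing s I id" using assms by (intro inj_is_packing) auto
  then have "\<exists>k B. is_packing s I B \<and> num_bins I B = k" by blast
  from LeastI_ex[OF this] show ?thesis using that unfolding OPT_def by blast
qed

text \<open>Volume bound: the total size is at most the number of bins. It turns errors linear in
  the number of items into errors linear in \<open>OPT\<close>.\<close>

lemma card_le_OPT:
  assumes "finite I" "\<And>i. i \<in> I \<Longrightarrow> \<delta> \<le> s i \<and> s i \<le> 1" "0 < \<delta>"
  shows "real (card I) * \<delta> \<le> OPT s I"
proof -
  obtain B where B: "is_packing s I B" "num_bins I B = OPT s I"
    using OPT_packing assms(2) by metis
  have "real (card I) * \<delta> = (\<Sum>i\<in>I. \<delta>)" by simp
  also have "\<dots> \<le> (\<Sum>i\<in>I. s i)" using assms by (intro sum_mono) auto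
  also have "\<dots> = (\<Sum>b\<in>B ` I. \<Sum>i\<in>{i \<in> I. B i = b}. s i)" using assms by (simp add: sum.image_gen)
  also have "\<dots> \<le> (\<Sum>b\<in>B ` I. 1)" using B by (intro sum_mono) (auto simp: is_packing_def)
  finally show ?thesis using B by (simp add: num_bins_def)
qed

text \<open>An optimal packing of \<open>J\<close> is kept, and every item \<open>i\<close> of
  \<open>I - J\<close> gets the bin \<open>z + i\<close>, beyond all bins in use.\<close>

lemma OPT_diff:
  assumes "finite I" "finite J" "\<And>i. i \<in> I \<union> J \<Longrightarrow> 0 \<le> s i \<and> s i \<le> 1"
  shows "OPT s I \<le> OPT s J + card (I - J)"
proof -
  obtain B where B: "is_packing s J B" "num_bins J B = OPT s J"
    using OPT_packing assms(3) by (metis UnI2)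
  define z where "z = Suc (Max (insert 0 (B ` J)))"
  have z: "B j < z" if "j \<in> J" for j using that assms by (auto simp: z_def less_Suc_eq_le)
  define B' where "B' i = (if i \<in> J then B i else z + i)" for i
  have "is_packing s I B'"
    unfolding is_packing_def
  proof
    fix b
    show "(\<Sum>i\<in>{i \<in> I. B' i = b}. s i) \<le> 1"
    proof (cases "b < z")
      case True
      then have "{i \<in> I. B' i = b} \<subseteq> {i \<in> J. B i = b}" by (auto simp: B'_def split: if_splits)
      then have "(\<Sum>i\<in>{i \<in> I. B' i = b}. s i) \<le> (\<Sum>i\<in>{i \<in> J. B i = b}. s i)"
        using assms by (intro sum_mono2) auto
      also have "\<dots> \<le> 1" using B by (auto simp: is_packing_def)
      finally show ?thesis .
    next
      case False
      then have "{i \<in> I. B' i = b} \<subseteq> {b - z}" using z by (fastforce simp: B'_def split: if_splits)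
      then have *: "{i \<in> I. B' i = b} = {} \<or> {i \<in> I. B' i = b} = {b - z}" by (rule subset_singletonD)
      show ?thesis
      proof (cases "{i \<in> I. B' i = b} = {}")
        case True
        then show ?thesis by (simp only:) simp
      next
        case False
        with * have **: "{i \<in> I. B' i = b} = {b - z}" by satx
        then have "b - z \<in> I" by blast
        with assms(3) show ?thesis unfolding ** by simp
      qed
    qed
  qed
  then have "OPT s I \<le> card (B' ` I)" using OPT_le by (auto simp: num_bins_def)
  also have "\<dots> \<le> card (B ` J \<union> (\<lambda>i. z + i) ` (I - J))"
    using assms by (intro card_mono) (auto simp: B'_def)
  also have "\<dots> \<le> card (B ` J) + card (I - J)"
    using card_Un_le card_image_le[of "I - J"] assms by (meson add_left_mono finite_Diff order.trans)
  finally show ?thesis using B by (simp add: num_bins_def)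
qed

text \<open>For matching slots with the items whose room they take over; the truncated difference
  covers a shortage and a surplus of items alike.\<close>

lemma partial_injection:
  assumes "finite A" "finite B"
  obtains T \<phi> where "T \<subseteq> A" "inj_on \<phi> T" "\<phi> ` T \<subseteq> B" "card (A - T) = card A - card B"
proof (cases "card A \<le> card B")
  case True
  then obtain \<phi> where "inj_on \<phi> A" "\<phi> ` A \<subseteq> B" using inj_on_iff_card_le[OF assms] by blast
  then show ?thesis using that[of A \<phi>] True by simp
next
  case False
  then obtain T where T: "T \<subseteq> A" "card T = card B"
    using obtain_subset_with_card_n[of "card B" A] by auto
  then have fT: "finite T" using assms finite_subset by blast
  then obtain \<phi> where "inj_on \<phi> T" "\<phi> ` T \<subseteq> B" using inj_on_iff_card_le[OF fT assms(2)] T by force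
  then show ?thesis using that[of T \<phi>] T fT by (simp add: card_Diff_subset)
qed

text \<open>
  The items, sorted by decreasing size, are cut into \<open>L\<close> groups of \<open>m\<close>, and one slot per group
  has to be packed. Merge every \<open>q\<close> consecutive groups into a class. About \<open>N / m\<close> bins of the
  given packing, chosen by balancing, contain almost \<open>q\<close> items of each class, and these items make
  room for the slots of the next class, whose sizes are smaller.
\<close>

lemma quantile_pattern_exists:
  fixes a :: "nat \<Rightarrow> real" and n m L K :: nat
  assumes anti: "\<And>p p'. p \<le> p' \<Longrightarrow> p' < n \<Longrightarrow> a p' \<le> a p"
    and sz: "\<And>p. p < n \<Longrightarrow> \<delta> \<le> a p \<and> a p \<le> 1" and "0 < \<delta>"
    and pack: "is_packing a {..<n} B"
    and m: "0 < m" "n \<le> m * L" and K: "0 < K"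
    and g: "\<And>k. k < L \<Longrightarrow> g k = (if k * m < n then a (k * m) else 0)"
  obtains f where "\<And>k. k < L \<Longrightarrow> f k < L" "\<And>b. (\<Sum>k\<in>{k. k < L \<and> f k = b}. g k) \<le> 1"
    "real (card (f ` {k. k < L \<and> 0 < g k})) \<le>
      num_bins {..<n} B / m + 2 + L / K + K * sqrt (2 * (L + 1)) / \<delta>"
proof -
  \<comment> \<open>\<open>q\<close> groups form a class, such that \<open>K\<close> classes cover
    all \<open>L\<close> groups, and \<open>w\<close> is the number of items of a full class. With
    \<open>x\<close> being \<open>N / m\<close> rounded up, a balanced choice of \<open>x\<close>
    out of \<open>N\<close> bins holds about \<open>w / m = q\<close> items of each full class, one
    for every slot of a class. \<open>R\<close> is the deviation that balancing leaves in a single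
    class.\<close>
  define q where "q = L div K + 1"
  define w where "w = m * q"
  define Bn where "Bn = B ` {..<n}"
  define N where "N = card Bn"
  define x where "x = (N + (m - 1)) div m"
  define R where "R = sqrt (2 * x) / \<delta>"
  have q: "L \<le> q * K" "0 < q" "real q \<le> L / K + 1"
  proof -
    have "L = K * (L div K) + L mod K" by simp
    also have "\<dots> \<le> K * (L div K) + K" using K by (meson add_left_mono less_imp_le_nat mod_less_divisor)
    finally show "L \<le> q * K" by (simp add: q_def algebra_simps)
    show "real q \<le> L / K + 1" using of_nat_div_le_of_nat[of L K] by (simp add: q_def)
  qed (simp add: q_def)
  have w: "0 < w" using m q by (simp add: w_def)
  \<comment> \<open>The group of slot \<open>l\<close> begins at position \<open>l * m\<close>,
    which is not before the beginning \<open>l div q * w\<close> of its class.\<close>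
  have lw: "l div q * w \<le> l * m" for l
    using mult_le_mono1[OF div_times_less_eq_dividend[of l q], of m] by (simp add: w_def ac_simps)
  have x: "real N / m \<le> x" "real x \<le> real N / m + 1" "x \<le> N"
  proof -
    have "N + (m - 1) = m * x + (N + (m - 1)) mod m" by (simp add: x_def)
    moreover have "(N + (m - 1)) mod m < m" using m by simp
    ultimately have *: "N \<le> m * x" "m * x \<le> N + (m - 1)" by linarith+
    then have "real N \<le> real m * real x" "real m * real x \<le> real N + real m"
      using m by (simp_all flip: of_nat_mult of_nat_add add: )
    then show "real N / m \<le> x" "real x \<le> real N / m + 1" using m by (simp_all add: field_simps)
    show "x \<le> N"
    proof (cases "N = 0")
      case True then show ?thesis using m by (simp add: x_def)
    next
      case False
      then have "N + (m - 1) \<le> m * N" using m by (cases m; cases N) auto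
      then show ?thesis using m by (metis *(2) le_trans mult_le_cancel1)
    qed
  qed
  have Nn: "N \<le> n" using card_image_le[of "{..<n}" B] by (simp add: N_def Bn_def)
  have xL: "real x \<le> L + 1"
  proof -
    have "real N / m \<le> real n / m" using Nn by (simp add: divide_right_mono)
    also have "\<dots> \<le> L" using m by (simp add: field_simps flip: of_nat_mult)
    finally show ?thesis using x by linarith
  qed
  define c where "c b k = real (card {p. p < n \<and> B p = b \<and> p div w = k})" for b k
  define G where "G k = (\<Sum>b\<in>Bn. c b k)" for k
  have csum: "(\<Sum>b\<in>M. c b k) = card {p. p < n \<and> B p \<in> M \<and> p div w = k}" if "finite M" for M k
  proof -
    have "card {p. p < n \<and> B p \<in> M \<and> p div w = k} = card (\<Union>b\<in>M. {p. p < n \<and> B p = b \<and> p div w = k})"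
      by (rule arg_cong[where f = card]) auto
    also have "\<dots> = (\<Sum>b\<in>M. card {p. p < n \<and> B p = b \<and> p div w = k})"
      using that by (intro card_UN_disjoint) auto
    finally show ?thesis by (simp add: c_def)
  qed
  have ck: "(\<Sum>k<K. c b k) \<le> 1 / \<delta>" for b
  proof -
    have "(\<Sum>k<K. card {p. p < n \<and> B p = b \<and> p div w = k}) = card (\<Union>k<K. {p. p < n \<and> B p = b \<and> p div w = k})"
      by (intro card_UN_disjoint[symmetric]) auto
    also have "\<dots> \<le> card {p \<in> {..<n}. B p = b}" by (intro card_mono) auto
    finally have "(\<Sum>k<K. c b k) \<le> card {p \<in> {..<n}. B p = b}"
      unfolding c_def by (simp flip: of_nat_sum)
    also have "\<dots> \<le> 1 / \<delta>" using packing_bin_card[OF pack, of \<delta>] sz \<open>0 < \<delta>\<close> by auto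
    finally show ?thesis .
  qed
  have fB: "finite Bn" by (simp add: Bn_def)
  obtain M where M: "M \<subseteq> Bn" "card M = x"
    and bal: "(\<Sum>k<K. ((\<Sum>b\<in>M. c b k) - x * (G k / N))\<^sup>2) \<le> 2 * x * (1 / \<delta>)\<^sup>2"
    using balanced_subset[of Bn K G c "1 / \<delta>" x] ck fB x by (auto simp: N_def G_def c_def)
  have fM: "finite M" using M fB finite_subset by blast
  have bal': "x * (G k / N) - R \<le> (\<Sum>b\<in>M. c b k)" if "k < K" for k
  proof -
    have "((\<Sum>b\<in>M. c b k) - x * (G k / N))\<^sup>2 \<le> (\<Sum>k<K. ((\<Sum>b\<in>M. c b k) - x * (G k / N))\<^sup>2)"
      using that by (intro member_le_sum) auto
    with bal have "((\<Sum>b\<in>M. c b k) - x * (G k / N))\<^sup>2 \<le> R\<^sup>2"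
      by (simp add: R_def power_divide)
    then have "\<bar>(\<Sum>b\<in>M. c b k) - x * (G k / N)\<bar> \<le> R"
      using \<open>0 < \<delta>\<close> by (simp add: R_def abs_le_square_iff[symmetric])
    then show ?thesis by linarith
  qed
  \<comment> \<open>\<open>Sl k\<close> are the slots of class \<open>k\<close>, and
    \<open>It k\<close> the items of the class before it in the chosen bins. Class 0 has no
    predecessor, so only the matchings of classes from 1 on enter \<open>TT\<close> below.\<close>
  define Sl where "Sl k = {l. l < L \<and> l * m < n \<and> l div q = k}" for k
  define It where "It k = {p. p < n \<and> B p \<in> M \<and> p div w = k - 1}" for k
  have cSl: "card (Sl k) \<le> q" for k
  proof -
    have "Sl k \<subseteq> {k * q..<k * q + q}"
      using q by (auto simp: Sl_def) (metis div_mult_mod_eq mod_less_divisor nat_add_left_cancel_less)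
    from card_mono[OF _ this] show ?thesis by simp
  qed
  \<comment> \<open>A slot of class \<open>k\<close> begins at a position below \<open>n\<close>, so
    the class before it is complete. The chosen bins hold at least the fraction
    \<open>x / N >= 1 / m\<close> of its \<open>w\<close> items, up to \<open>R\<close>.\<close>
  have cIt: "real q - R \<le> card (It k)" if "k \<in> {1..<K}" "Sl k \<noteq> {}" for k
  proof -
    from that obtain l where l: "l * m < n" "l div q = k" by (auto simp: Sl_def)
    have "k * w \<le> l * m" using lw[of l] l by simp
    then have kn: "k * w < n" using l by simp
    have "{p. p < n \<and> p div w = k - 1} = {(k - 1) * w..<k * w}"
    proof -
      have iff: "p div w = k - 1 \<longleftrightarrow> (k - 1) * w \<le> p \<and> p < k * w" for p
      proof -
        obtain j where j: "k = Suc j" using \<open>k \<in> {1..<K}\<close> by (cases k) auto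
        show ?thesis
          using div_nat_eqI[of w j p] dividend_less_times_div[OF w, of p] times_div_less_eq_dividend[of w p]
          unfolding j by (auto simp: mult.commute)
      qed
      show ?thesis unfolding iff using kn by auto
    qed
    then have "card {p. p < n \<and> p div w = k - 1} = w" using that by (cases k) auto
    moreover have "G (k - 1) = card {p. p < n \<and> p div w = k - 1}"
      unfolding G_def using csum[OF fB, of "k - 1"] by (auto simp: Bn_def intro!: arg_cong[where f = card])
    ultimately have G: "G (k - 1) = real m * q" by (simp add: w_def)
    have N0: "0 < N" using kn by (auto simp: N_def Bn_def card_gt_0_iff)
    have k1: "k - 1 < K" using that(1) by (simp add: less_imp_diff_less)
    have "real q = (real N / m) * (G (k - 1) / N)" unfolding G using N0 m by simp
    also have "\<dots> \<le> x * (G (k - 1) / N)" unfolding G using x by (intro mult_right_mono) auto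
    finally have "real q - R \<le> (\<Sum>b\<in>M. c b (k - 1))" using bal'[OF k1] by linarith
    then show ?thesis using csum[OF fM, of "k - 1"] by (simp add: It_def)
  qed
  have R0: "0 \<le> R" using \<open>0 < \<delta>\<close> by (simp add: R_def)
  have "\<exists>T \<phi>. T \<subseteq> Sl k \<and> inj_on \<phi> T \<and> \<phi> ` T \<subseteq> It k \<and> (k \<in> {1..<K} \<longrightarrow> real (card (Sl k - T)) \<le> R)" for k
  proof -
    have "finite (Sl k)" "finite (It k)" by (auto simp: Sl_def It_def)
    then obtain T \<phi> where T: "T \<subseteq> Sl k" "inj_on \<phi> T" "\<phi> ` T \<subseteq> It k" "card (Sl k - T) = card (Sl k) - card (It k)"
      using partial_injection by metis
    have "real (card (Sl k) - card (It k)) \<le> R" if "k \<in> {1..<K}"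
      using cIt[OF that] cSl[of k] R0 by (cases "Sl k = {}") (auto simp: of_nat_diff_if)
    with T show ?thesis by (intro exI[of _ T] exI[of _ \<phi>]) simp
  qed
  then obtain T \<phi> where T: "\<And>k. T k \<subseteq> Sl k" "\<And>k. inj_on (\<phi> k) (T k)" "\<And>k. \<phi> k ` T k \<subseteq> It k"
    "\<And>k. k \<in> {1..<K} \<Longrightarrow> real (card (Sl k - T k)) \<le> R" by metis
  define TT where "TT = (\<Union>k\<in>{1..<K}. T k)"
  define \<psi> where "\<psi> l = \<phi> (l div q) l" for l
  have TT: "l < L" "l * m < n" "1 \<le> l div q" "l div q < K" "\<psi> l \<in> It (l div q)" "l \<in> T (l div q)" if "l \<in> TT" for l
    using that T(1,3) by (auto simp: TT_def \<psi>_def Sl_def subset_iff image_subset_iff)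
  have inj: "inj_on \<psi> TT"
  proof (rule inj_onI)
    fix l l' assume l: "l \<in> TT" "l' \<in> TT" "\<psi> l = \<psi> l'"
    then have "l div q - 1 = l' div q - 1" using TT(5)[OF l(1)] TT(5)[OF l(2)] by (simp add: It_def)
    with TT(3)[OF l(1)] TT(3)[OF l(2)] have eq: "l div q = l' div q" by linarith
    have "l \<in> T (l' div q)" "l' \<in> T (l' div q)" using TT(6)[OF l(1)] TT(6)[OF l(2)] eq by simp_all
    moreover have "\<phi> (l' div q) l = \<phi> (l' div q) l'" using l(3) eq by (simp add: \<psi>_def)
    ultimately show "l = l'" using T(2) by (auto dest: inj_onD)
  qed
  \<comment> \<open>The partner of a slot comes from an earlier class, hence stands further to the
    front in the decreasing order and is at least as large as the slot.\<close>
  have g\<psi>: "g l \<le> a (\<psi> l)" if "l \<in> TT" for l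
  proof -
    have p: "\<psi> l div w = l div q - 1" "\<psi> l < n" using TT(5)[OF that] by (auto simp: It_def)
    have "\<psi> l < (\<psi> l div w + 1) * w" using w by (metis Suc_eq_plus1 dividend_less_div_times mult_Suc add.commute)
    also have "\<dots> = l div q * w" using p TT(3)[OF that] by simp
    also have "\<dots> \<le> l * m" by (rule lw)
    finally have "a (l * m) \<le> a (\<psi> l)" using anti TT(2)[OF that] by simp
    then show ?thesis using g TT[OF that] by simp
  qed
  \<comment> \<open>A matched slot takes the bin of its partner, any other slot a bin of its own.
    The sum type keeps the two kinds apart, and \<open>h\<close> renames these at most
    \<open>L\<close> bins to numbers below \<open>L\<close>.\<close>
  define f0 where "f0 l = (if l \<in> TT then Inl (B (\<psi> l)) else Inr l)" for l :: nat
  have "card (f0 ` {..<L}) \<le> card {..<L}" by (rule card_image_le) simp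
  then obtain h where h: "inj_on h (f0 ` {..<L})" "h ` f0 ` {..<L} \<subseteq> {..<L}"
    using inj_on_iff_card_le[of "f0 ` {..<L}" "{..<L}"] by auto
  define f where "f l = h (f0 l)" for l
  have g1: "g l \<le> 1" if "l < L" for l using g[OF that] sz by auto
  have g0: "0 \<le> g l" if "l < L" for l using g[OF that] sz \<open>0 < \<delta>\<close> by (auto intro: order.trans[of 0 \<delta>])
  have load: "(\<Sum>k\<in>{k. k < L \<and> f k = b}. g k) \<le> 1" for b
  proof (cases "\<exists>l<L. f l = b")
    case False
    then have *: "{k. k < L \<and> f k = b} = {}" by auto
    show ?thesis unfolding * by simp
  next
    case True
    then obtain l where l: "l < L" "f l = b" by blast
    have same: "{k. k < L \<and> f k = b} = {k. k < L \<and> f0 k = f0 l}"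
      using l h(1) by (auto simp: f_def dest: inj_onD)
    show ?thesis
    proof (cases "l \<in> TT")
      case False
      then have *: "{k. k < L \<and> f0 k = f0 l} = {l}" using l by (auto simp: f0_def split: if_splits)
      show ?thesis unfolding same * using g1 l by simp
    next
      case True
      then have eq: "{k. k < L \<and> f0 k = f0 l} = {k \<in> TT. B (\<psi> k) = B (\<psi> l)}" (is "_ = ?S")
        using TT(1) by (auto simp: f0_def split: if_splits)
      have fT: "finite ?S" using TT(1) by (auto intro: finite_subset[of _ "{..<L}"])
      have "(\<Sum>k\<in>?S. g k) \<le> (\<Sum>k\<in>?S. a (\<psi> k))" using g\<psi> by (intro sum_mono) auto
      also have "\<dots> = (\<Sum>p\<in>\<psi> ` ?S. a p)"
        using inj by (subst sum.reindex) (auto intro: inj_on_subset)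
      also have "\<dots> \<le> (\<Sum>p\<in>{p \<in> {..<n}. B p = B (\<psi> l)}. a p)"
        using sz \<open>0 < \<delta>\<close> TT(5) by (intro sum_mono2) (fastforce simp: It_def)+
      also have "\<dots> \<le> 1" using pack by (auto simp: is_packing_def)
      finally show ?thesis unfolding same eq .
    qed
  qed
  have "real (card (f ` {k. k < L \<and> 0 < g k})) \<le> x + (q + K * R)"
  proof -
    let ?P = "{k. k < L \<and> 0 < g k}"
    have P: "?P \<subseteq> {l. l < L \<and> l * m < n}" using g by (auto split: if_splits)
    \<comment> \<open>The slots that need bins of their own: at most \<open>q\<close> in class 0 and
      at most \<open>R\<close> in each further class.\<close>
    have "{l. l < L \<and> l * m < n} - TT \<subseteq> Sl 0 \<union> (\<Union>k\<in>{1..<K}. Sl k - T k)"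
    proof
      fix l assume l: "l \<in> {l. l < L \<and> l * m < n} - TT"
      have "l div q < K" using l q by (auto simp: div_less_iff_less_mult mult.commute)
      then show "l \<in> Sl 0 \<union> (\<Union>k\<in>{1..<K}. Sl k - T k)"
        using l by (cases "l div q = 0") (auto simp: Sl_def TT_def)
    qed
    then have "card ({l. l < L \<and> l * m < n} - TT) \<le> card (Sl 0 \<union> (\<Union>k\<in>{1..<K}. Sl k - T k))"
      by (intro card_mono) (auto simp: Sl_def)
    also have "\<dots> \<le> card (Sl 0) + (\<Sum>k\<in>{1..<K}. card (Sl k - T k))"
      by (rule order.trans[OF card_Un_le add_left_mono[OF card_UN_le]]) simp
    finally have "real (card ({l. l < L \<and> l * m < n} - TT)) \<le> real (card (Sl 0) + (\<Sum>k\<in>{1..<K}. card (Sl k - T k)))"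
      by (rule of_nat_mono)
    also have "\<dots> = card (Sl 0) + (\<Sum>k\<in>{1..<K}. real (card (Sl k - T k)))" by simp
    also have "\<dots> \<le> q + (\<Sum>k\<in>{1..<K}. R)" using cSl T(4) by (intro add_mono sum_mono) auto
    also have "\<dots> \<le> q + K * R" using R0 K by (simp add: mult_right_mono)
    finally have rest: "real (card ({l. l < L \<and> l * m < n} - TT)) \<le> q + K * R" .
    have "f0 ` ?P \<subseteq> Inl ` M \<union> Inr ` ({l. l < L \<and> l * m < n} - TT)"
    proof (rule image_subsetI)
      fix l assume "l \<in> ?P"
      with P have "l \<in> {l. l < L \<and> l * m < n}" by blast
      then show "f0 l \<in> Inl ` M \<union> Inr ` ({l. l < L \<and> l * m < n} - TT)"
        using TT(5)[of l] by (cases "l \<in> TT") (simp_all add: f0_def It_def)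
    qed
    then have "card (f0 ` ?P) \<le> card (Inl ` M \<union> Inr ` ({l. l < L \<and> l * m < n} - TT) :: (nat + nat) set)"
      using fM by (intro card_mono) auto
    also have "\<dots> \<le> card M + card ({l. l < L \<and> l * m < n} - TT)"
      by (rule order.trans[OF card_Un_le]) (simp add: card_image)
    finally have "real (card (f0 ` ?P)) \<le> x + (q + K * R)" using rest M by linarith
    moreover have "card (f ` ?P) \<le> card (f0 ` ?P)"
      unfolding f_def image_image[symmetric, of h f0] by (rule card_image_le) simp
    ultimately show ?thesis by linarith
  qed
  also have "\<dots> \<le> real N / m + 1 + (L / K + 1 + K * R)" using x q by linarith
  also have "K * R \<le> K * (sqrt (2 * (L + 1)) / \<delta>)"
    using xL \<open>0 < \<delta>\<close> by (intro mult_left_mono) (auto simp: R_def divide_right_mono)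
  finally have "real (card (f ` {k. k < L \<and> 0 < g k})) \<le>
      num_bins {..<n} B / m + 2 + L / K + K * sqrt (2 * (L + 1)) / \<delta>"
    by (simp add: N_def Bn_def num_bins_def)
  moreover have "f k < L" if "k < L" for k using h(2) that by (auto simp: f_def)
  ultimately show ?thesis using that load by blast
qed

section \<open>Lower order terms\<close>

text \<open>\<open>L\<close> is the largest number with \<open>L ^ L \<le> n\<close>, so that the search over all patterns is affordable.\<close>

definition slack :: "real \<Rightarrow> nat \<Rightarrow> real \<Rightarrow> real \<Rightarrow> bool" where
  "slack \<delta> n v e \<longleftrightarrow> (n = 0 \<and> v \<le> 0 \<and> e \<le> 0) \<or>
     (\<exists>L::nat. 1 \<le> L \<and> L ^ L \<le> n \<and> n < (L + 1) ^ (L + 1) \<and> e \<le> 1 + L * sqrt (2 * n) / \<delta> \<and>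
        (\<forall>K::nat. 1 \<le> K \<longrightarrow> v \<le> (n / L + 1) * (2 + L / K + K * sqrt (2 * (L + 1)) / \<delta>)))"

text \<open>Relative to \<open>n\<close>, the error \<open>v\<close> consists of
  \<open>2 / K\<close> and a term that vanishes as \<open>L\<close> grows. So \<open>K\<close> has
  to be fixed before \<open>L\<close> becomes large, which is why \<open>slack\<close> demands its
  bound for every \<open>K\<close>.\<close>

lemma slack_large:
  fixes n L K :: nat and \<delta> :: real
  assumes "0 < \<delta>" "1 \<le> K" "4 \<le> L" "L ^ L \<le> n"
    and v: "v \<le> (n / L + 1) * (2 + L / K + K * sqrt (2 * (L + 1)) / \<delta>)"
    and e: "e \<le> 1 + L * sqrt (2 * n) / \<delta>"
  shows "v \<le> n * (2 / K + (4 + 4 * K / \<delta>) / sqrt L)" "e \<le> 1 + n * ((4 + 4 * K / \<delta>) / sqrt L)"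
proof -
  \<comment> \<open>From \<open>4 <= L\<close> follows \<open>L ^ 4 <= n\<close>, that is,
    \<open>L * L <= sqrt n\<close>. Hence \<open>L * sqrt n <= n / sqrt L\<close>, and the deviation
    term is a small fraction of \<open>n\<close>.\<close>
  have "L ^ 4 \<le> L ^ L" using assms(3) by (intro power_increasing) auto
  then have n4: "L ^ 4 \<le> n" using assms(4) by linarith
  have "L ^ 1 \<le> L ^ 4" using assms(3) by (intro power_increasing) auto
  then have Ln: "L \<le> n" using n4 by simp
  define r where "r = sqrt L"
  have r: "0 < r" "r * r = L" "1 \<le> r" using assms(3) by (auto simp: r_def)
  have "n / L + 1 \<le> 2 * n / L" using Ln assms(3) by (simp add: field_simps)
  then have "v \<le> (2 * n / L) * (2 + L / K + K * sqrt (2 * (L + 1)) / \<delta>)"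
    using assms by (intro order.trans[OF v] mult_right_mono) auto
  also have "\<dots> \<le> (2 * n / L) * (2 * r + L / K + K * (2 * r) / \<delta>)"
  proof -
    have "sqrt (2 * (L + 1)) \<le> sqrt (2\<^sup>2 * real L)" using assms(3) by (intro real_sqrt_le_mono) auto
    also have "\<dots> = 2 * r" by (subst real_sqrt_mult) (simp add: r_def)
    finally show ?thesis using assms r
      by (intro mult_left_mono add_mono divide_right_mono) auto
  qed
  also have "\<dots> = n * (2 / K + (4 + 4 * K / \<delta>) / r)"
    using r assms by (simp add: field_simps flip: r(2))
  finally show "v \<le> n * (2 / K + (4 + 4 * K / \<delta>) / sqrt L)" by (simp add: r_def)
  have "L * sqrt (2 * n) \<le> n * (2 / r)"
  proof -
    define w where "w = sqrt n"
    have w: "w * w = n" "0 \<le> w" by (auto simp: w_def)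
    have "sqrt (real (L ^ 4)) \<le> w" unfolding w_def using n4 by (intro real_sqrt_le_mono) simp
    moreover have "sqrt (real (L ^ 4)) = real L ^ 2"
      by (intro real_sqrt_unique) (auto simp flip: power_mult)
    ultimately have Lw: "real L * real L \<le> w" by (simp add: power2_eq_square)
    have "sqrt (2 * n) = sqrt 2 * w" by (simp add: w_def real_sqrt_mult)
    moreover have "sqrt 2 * w \<le> 2 * w" using w sqrt2_less_2 by (intro mult_right_mono) auto
    ultimately have "L * sqrt (2 * n) * r \<le> L * (2 * w) * r"
      using r by (intro mult_right_mono mult_left_mono) auto
    also have "\<dots> \<le> L * (2 * w) * L" using w r assms(3)
      by (intro mult_left_mono) (auto simp flip: r(2))
    also have "\<dots> \<le> 2 * w * w" using Lw w by (simp add: mult.commute mult.left_commute mult_left_mono)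
    finally show ?thesis using r w by (simp add: field_simps)
  qed
  then have "L * sqrt (2 * n) / \<delta> \<le> n * (2 / r) / \<delta>" using assms by (intro divide_right_mono) auto
  also have "\<dots> \<le> n * ((4 + 4 * K / \<delta>) / r)"
  proof -
    have "2 / \<delta> \<le> 4 * K / \<delta>" using assms by (intro divide_right_mono) auto
    then have "2 / \<delta> \<le> 4 + 4 * K / \<delta>" by linarith
    then have "n * (2 / \<delta> / r) \<le> n * ((4 + 4 * K / \<delta>) / r)"
      using r by (intro mult_left_mono divide_right_mono) auto
    then show ?thesis by (simp add: field_simps)
  qed
  finally show "e \<le> 1 + n * ((4 + 4 * K / \<delta>) / sqrt L)" using e by (simp add: r_def)
qed

lemma slack_sublinear:
  fixes \<delta> \<eta> :: real
  assumes "0 < \<delta>" "0 < \<eta>"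
  shows "\<exists>C\<ge>0. \<forall>n v e. slack \<delta> n v e \<longrightarrow> v \<le> \<eta> * n + C \<and> e \<le> \<eta> * n + C"
proof -
  \<comment> \<open>\<open>K\<close> makes \<open>2 / K\<close> at most \<open>\<eta> / 2\<close>,
    and \<open>L0\<close> does the same for \<open>c / sqrt L\<close> once \<open>L0 <= L\<close>.
    If \<open>L < L0\<close> then \<open>n < M\<close>, and the constant \<open>C\<close> covers
    these \<open>n\<close>, with 1 in place of \<open>K\<close>.\<close>
  define K where "K = nat \<lceil>4 / \<eta>\<rceil> + 1"
  define c where "c = 4 + 4 * K / \<delta>"
  define L0 where "L0 = nat \<lceil>(2 * c / \<eta>)\<^sup>2\<rceil> + 4"
  define M where "M = (L0 + 1) ^ (L0 + 1)"
  define C where "C = 1 + (M + 1) * (2 + L0 + sqrt (2 * (L0 + 1)) / \<delta>) + L0 * sqrt (2 * M) / \<delta>"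
  have K: "1 \<le> K" "2 / K \<le> \<eta> / 2"
  proof -
    have "4 / \<eta> \<le> K" unfolding K_def by linarith
    then have "4 \<le> K * \<eta>" using assms by (simp add: pos_divide_le_eq)
    moreover have "0 < real K" by (simp add: K_def)
    ultimately show "2 / K \<le> \<eta> / 2" by (simp add: field_simps)
  qed (simp add: K_def)
  have c: "0 < c" using assms by (auto simp: c_def intro: add_pos_nonneg)
  have C0: "1 \<le> C" "0 \<le> (M + 1) * (2 + L0 + sqrt (2 * (L0 + 1)) / \<delta>)" "0 \<le> L0 * sqrt (2 * M) / \<delta>"
    using assms by (auto simp: C_def)
  have "v \<le> \<eta> * n + C \<and> e \<le> \<eta> * n + C" if sl: "slack \<delta> n v e" for n v e
  proof (cases "n = 0 \<and> v \<le> 0 \<and> e \<le> 0")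
    case True
    then show ?thesis using C0 by simp
  next
    case False
    from this sl[unfolded slack_def] obtain L :: nat where L: "1 \<le> L" "L ^ L \<le> n" "n < (L + 1) ^ (L + 1)"
      "e \<le> 1 + L * sqrt (2 * n) / \<delta>"
      and v: "\<And>K. 1 \<le> K \<Longrightarrow> v \<le> (n / L + 1) * (2 + L / real K + K * sqrt (2 * (L + 1)) / \<delta>)"
      by (elim disjE exE conjE) auto
    show ?thesis
    proof (cases "L0 \<le> L")
      case True
      then have "4 \<le> L" by (simp add: L0_def)
      note b = slack_large[OF assms(1) K(1) this L(2) v[OF K(1)] L(4)]
      have "(2 * c / \<eta>)\<^sup>2 \<le> L0" unfolding L0_def by linarith
      also have "\<dots> \<le> L" using True by simp
      finally have "2 * c / \<eta> \<le> sqrt L" by (rule real_le_rsqrt)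
      then have "2 * c \<le> sqrt L * \<eta>" using assms by (simp add: pos_divide_le_eq)
      then have "c / sqrt L \<le> \<eta> / 2" using L(1) by (simp add: field_simps)
      then have "2 / K + c / sqrt L \<le> \<eta>" "c / sqrt L \<le> \<eta>" using K(2) assms by linarith+
      then have "n * (2 / K + c / sqrt L) \<le> n * \<eta>" "n * (c / sqrt L) \<le> n * \<eta>"
        by (intro mult_left_mono; simp)+
      then show ?thesis using b C0 by (simp add: c_def mult.commute)
    next
      case False
      then have LL: "real L \<le> L0" by simp
      have "(L + 1) ^ (L + 1) \<le> M" unfolding M_def using False
        by (intro order.trans[OF power_mono power_increasing]) auto
      then have nM: "real n \<le> M" using L(3) by simp
      have "n / L \<le> n / 1" using L(1) by (intro divide_left_mono) auto
      then have "n / L + 1 \<le> M + 1" using nM by simp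
      moreover have "sqrt (2 * (real L + 1)) \<le> sqrt (2 * (real L0 + 1))" using LL by simp
      then have "2 + L / real 1 + 1 * sqrt (2 * (L + 1)) / \<delta> \<le> 2 + L0 + sqrt (2 * (L0 + 1)) / \<delta>"
        using LL assms by (auto simp: add.commute intro!: add_mono divide_right_mono)
      ultimately have "(n / L + 1) * (2 + L / real 1 + 1 * sqrt (2 * (L + 1)) / \<delta>) \<le>
          (M + 1) * (2 + L0 + sqrt (2 * (L0 + 1)) / \<delta>)"
        using assms by (intro mult_mono) auto
      then have "v \<le> (M + 1) * (2 + L0 + sqrt (2 * (L0 + 1)) / \<delta>)" using v[of 1] by simp
      moreover have "L * sqrt (2 * n) / \<delta> \<le> L0 * sqrt (2 * M) / \<delta>"
        using LL nM assms by (intro divide_right_mono mult_mono) auto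
      moreover have "0 \<le> \<eta> * n" using assms by simp
      ultimately show ?thesis using L(4) C0 by (simp add: C_def)
    qed
  qed
  then show ?thesis using C0 by (intro exI[of _ C]) auto
qed

section \<open>Epochs\<close>

text \<open>Move number \<open>l\<close> takes item \<open>pit l\<close> to bin
  \<open>ptg l\<close>. Old bins are named below \<open>base\<close> and targets from
  \<open>base\<close> up to \<open>hi\<close>, so no bin is both. Target loads include items not yet
  moved, which reserves their places. The bound with \<open>max\<close> concerns every prefix of the
  moves, also one ending inside an old bin; \<open>V\<close> bounds the bins at the end and
  \<open>e\<close> the excess on the way.\<close>

definition plan :: "(nat \<Rightarrow> real) \<Rightarrow> real \<Rightarrow> nat set \<Rightarrow> (nat \<Rightarrow> nat) \<Rightarrow> nat \<Rightarrow> nat \<Rightarrow>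
    nat \<Rightarrow> (nat \<Rightarrow> nat) \<Rightarrow> (nat \<Rightarrow> nat) \<Rightarrow> real \<Rightarrow> real \<Rightarrow> bool" where
  "plan s \<delta> I0 B0 base hi len pit ptg V e \<longleftrightarrow>
     (\<forall>i\<in>I0. \<delta> \<le> s i \<and> s i \<le> 1) \<and> bij_betw pit {..<len} I0 \<and> is_packing s I0 B0 \<and>
     (\<forall>i\<in>I0. B0 i < base) \<and> base \<le> hi \<and> (\<forall>l<len. base \<le> ptg l \<and> ptg l < hi) \<and>
     (\<forall>b. (\<Sum>l\<in>{l. l < len \<and> ptg l = b}. s (pit l)) \<le> 1) \<and>
     (\<forall>l\<le>len. real (card (ptg ` {..<l})) + card (B0 ` pit ` {l..<len}) \<le> max (real (num_bins I0 B0)) V + e) \<and>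
     real (card (ptg ` {..<len})) \<le> V \<and> (\<exists>v. V \<le> real (OPT s I0) + v \<and> slack \<delta> len v e)"

text \<open>
  The planned moves up to \<open>ptr\<close> have been carried out; \<open>F\<close> are the items that sit alone in a bin
  since their insertion, and \<open>u\<close> bounds the number of requests since the plan was made. Moving a
  deleted or reinserted item is harmless because its place is still reserved.
\<close>

definition progress :: "nat set \<Rightarrow> (nat \<Rightarrow> nat) \<Rightarrow> nat \<Rightarrow> nat set \<Rightarrow> (nat \<Rightarrow> nat) \<Rightarrow> nat \<Rightarrow>
    nat \<Rightarrow> (nat \<Rightarrow> nat) \<Rightarrow> (nat \<Rightarrow> nat) \<Rightarrow> nat \<Rightarrow> nat \<Rightarrow> nat set \<Rightarrow> bool" where
  "progress I B nb I0 B0 hi len pit ptg ptr u F \<longleftrightarrow>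
     finite I \<and> F \<subseteq> I \<and> inj_on B F \<and> (\<forall>i\<in>F. hi \<le> B i \<and> B i < nb) \<and> card F \<le> u \<and> hi \<le> nb \<and>
     I - F \<subseteq> I0 \<and> (\<forall>l<len. pit l \<in> I - F \<longrightarrow> B (pit l) = (if l < ptr then ptg l else B0 (pit l))) \<and>
     card (I0 - I) \<le> u \<and> card (I - I0) \<le> u \<and> ptr \<le> len"

lemma plan_finite: "plan s \<delta> I0 B0 base hi len pit ptg V e \<Longrightarrow> finite I0 \<and> card I0 = len"
  unfolding plan_def by (metis bij_betw_finite bij_betw_same_card card_lessThan finite_lessThan)

lemma progress_start:
  assumes "plan s \<delta> I B base hi len pit ptg V e" "hi \<le> nb"
  shows "progress I B nb I B hi len pit ptg 0 0 {}"
  using assms plan_finite[OF assms(1)] by (auto simp: progress_def)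

lemma progress_insert:
  assumes p: "progress I B nb I0 B0 hi len pit ptg ptr u F" and i: "i \<notin> I" and f: "finite I0"
  shows "progress (insert i I) (B(i := nb)) (Suc nb) I0 B0 hi len pit ptg ptr (Suc u) (insert i F)"
proof -
  have fin: "finite F" "finite I" using p finite_subset by (auto simp: progress_def)
  have "inj_on (B(i := nb)) (insert i F)"
    using p i unfolding progress_def by (force simp: inj_on_def)
  moreover have "card (insert i F) \<le> Suc u" using p fin by (auto simp: progress_def card_insert_if)
  moreover have "card (I0 - insert i I) \<le> card (I0 - I)" using f by (intro card_mono) auto
  moreover have "card (insert i I - I0) \<le> card (insert i (I - I0))" using fin by (intro card_mono) auto
  moreover have "card (insert i (I - I0)) \<le> Suc (card (I - I0))" by (rule card_insert_le_m1) auto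
  ultimately show ?thesis using p i unfolding progress_def by (auto simp: less_Suc_eq)
qed

lemma progress_delete:
  assumes p: "progress I B nb I0 B0 hi len pit ptg ptr u F" and i: "i \<in> I" and f: "finite I0"
  shows "progress (I - {i}) B nb I0 B0 hi len pit ptg ptr (Suc u) (F - {i})"
proof -
  have fin: "finite F" "finite I" using p finite_subset by (auto simp: progress_def)
  have "card (F - {i}) \<le> card F" "card (I - {i} - I0) \<le> card (I - I0)"
    using fin by (auto intro: card_mono)
  moreover have "card (I0 - (I - {i})) \<le> card (insert i (I0 - I))" using f by (intro card_mono) auto
  moreover have "card (insert i (I0 - I)) \<le> Suc (card (I0 - I))" by (rule card_insert_le_m1) auto
  ultimately show ?thesis using p i unfolding progress_def by (auto intro: inj_on_subset)
qed

text \<open>An item that was deleted and inserted again since the plan was made sits alone and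
  belongs to \<open>F\<close>. Its move takes it to the place reserved for it, so it leaves
  \<open>F\<close>. Moving an absent item does not affect the packing of \<open>I\<close>.\<close>

lemma progress_move:
  assumes pl: "plan s \<delta> I0 B0 base hi len pit ptg V e"
    and p: "progress I B nb I0 B0 hi len pit ptg ptr u F" and ptr: "ptr < len"
  shows "progress I (B(pit ptr := ptg ptr)) nb I0 B0 hi len pit ptg (Suc ptr) u (F - {pit ptr})"
proof -
  have fin: "finite F" using p finite_subset by (auto simp: progress_def)
  have "pit ptr \<in> I0" using pl ptr by (auto simp: plan_def bij_betw_def)
  moreover have "card (F - {pit ptr}) \<le> card F" using fin by (intro card_mono) auto
  moreover have "pit l = pit ptr \<longleftrightarrow> l = ptr" if "l < len" for l
    using pl ptr that by (auto simp: plan_def bij_betw_def dest: inj_onD)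
  moreover have "inj_on (B(pit ptr := ptg ptr)) (F - {pit ptr})"
    using p unfolding progress_def by (auto simp: inj_on_def)
  ultimately show ?thesis using p ptr unfolding progress_def by auto
qed

lemma progress_cases:
  assumes pl: "plan s \<delta> I0 B0 base hi len pit ptg V e"
    and p: "progress I B nb I0 B0 hi len pit ptg ptr u F" and "i \<in> I - F"
  obtains l where "l < ptr" "i = pit l" "B i = ptg l" | l where "ptr \<le> l" "l < len" "i = pit l" "B i = B0 i"
proof -
  have "i \<in> pit ` {..<len}" using pl p assms(3) by (auto simp: progress_def plan_def bij_betw_def)
  then obtain l where "l < len" "i = pit l" by auto
  moreover from this p assms(3) have "B i = (if l < ptr then ptg l else B0 i)"
    by (auto simp: progress_def)
  ultimately show ?thesis using that(1)[of l] that(2)[of l] by (cases "l < ptr") auto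
qed

text \<open>Bin names fall into three ranges: below \<open>base\<close> a bin holds a subset of an
  old bin, from \<open>base\<close> up to \<open>hi\<close> a subset of what the plan puts there,
  and from \<open>hi\<close> on at most one item.\<close>

lemma progress_packing:
  assumes pl: "plan s \<delta> I0 B0 base hi len pit ptg V e" and "0 \<le> \<delta>"
    and p: "progress I B nb I0 B0 hi len pit ptg ptr u F" and sz: "\<And>i. i \<in> I \<Longrightarrow> 0 \<le> s i \<and> s i \<le> 1"
  shows "is_packing s I B"
  unfolding is_packing_def
proof
  fix b
  have r: "base \<le> hi" "\<And>l. l < len \<Longrightarrow> base \<le> ptg l \<and> ptg l < hi" "ptr \<le> len"
    "\<And>i. i \<in> I0 \<Longrightarrow> B0 i < base" "I - F \<subseteq> I0"
    using pl p by (auto simp: plan_def progress_def)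
  have cs: "(\<exists>l<len. i = pit l \<and> B i = ptg l) \<or> (i \<in> I0 \<and> B i = B0 i)" if "i \<in> I - F" for i
    using pl p that
  proof (rule progress_cases)
    fix l assume "l < ptr" "i = pit l" "B i = ptg l"
    then show ?thesis using r(3) by (intro disjI1 exI[of _ l]) simp
  next
    assume "B i = B0 i"
    then show ?thesis using r(5) that by blast
  qed
  have rng: "B i < hi" if "i \<in> I - F" for i
    using cs[OF that] r(1,2) r(4)[of i] by auto
  have F: "\<And>i. i \<in> F \<Longrightarrow> hi \<le> B i" "inj_on B F" "F \<subseteq> I" "finite I" using p by (auto simp: progress_def)
  have s0: "\<And>i. i \<in> I0 \<Longrightarrow> 0 \<le> s i" using pl \<open>0 \<le> \<delta>\<close> unfolding plan_def by (meson order.trans)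
  have inj: "inj_on pit {..<len}" "pit ` {..<len} = I0" using pl by (auto simp: plan_def bij_betw_def)
  consider "hi \<le> b" | "base \<le> b" "b < hi" | "b < base" by linarith
  then show "(\<Sum>i\<in>{i \<in> I. B i = b}. s i) \<le> 1"
  proof cases
    case 1
    then have "{i \<in> I. B i = b} = {i \<in> F. B i = b}" using rng F by force
    moreover have "is_packing s F B" using F sz by (intro inj_is_packing) auto
    ultimately show ?thesis unfolding is_packing_def by metis
  next
    case 2
    let ?T = "{l. l < len \<and> ptg l = b}"
    have "{i \<in> I. B i = b} \<subseteq> pit ` ?T"
    proof
      fix i assume i: "i \<in> {i \<in> I. B i = b}"
      then have "i \<in> I - F" using F(1)[of i] 2 by auto
      from cs[OF this] show "i \<in> pit ` ?T" using i 2 r(4)[of i] by auto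
    qed
    then have "(\<Sum>i\<in>{i \<in> I. B i = b}. s i) \<le> (\<Sum>i\<in>pit ` ?T. s i)"
      using s0 inj by (intro sum_mono2) auto
    also have "\<dots> = (\<Sum>l\<in>?T. s (pit l))" using inj by (subst sum.reindex) (auto intro: inj_on_subset)
    also have "\<dots> \<le> 1" using pl by (auto simp: plan_def)
    finally show ?thesis .
  next
    case 3
    have "{i \<in> I. B i = b} \<subseteq> {i \<in> I0. B0 i = b}"
    proof
      fix i assume i: "i \<in> {i \<in> I. B i = b}"
      then have "i \<in> I - F" using F(1)[of i] 3 r(1) by auto
      from cs[OF this] show "i \<in> {i \<in> I0. B0 i = b}" using i 3 r(2) by force
    qed
    then have "(\<Sum>i\<in>{i \<in> I. B i = b}. s i) \<le> (\<Sum>i\<in>{i \<in> I0. B0 i = b}. s i)"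
      using s0 plan_finite[OF pl] by (intro sum_mono2) auto
    also have "\<dots> \<le> 1" using pl by (auto simp: plan_def is_packing_def)
    finally show ?thesis .
  qed
qed

text \<open>Every bin in use is a target of a move already made, an old bin of a move still to come,
  or the bin of one of the at most \<open>u\<close> items of \<open>F\<close>.\<close>

lemma progress_bins:
  assumes pl: "plan s \<delta> I0 B0 base hi len pit ptg V e"
    and p: "progress I B nb I0 B0 hi len pit ptg ptr u F"
  shows "num_bins I B \<le> card (ptg ` {..<ptr}) + card (B0 ` pit ` {ptr..<len}) + u"
proof -
  have fin: "finite F" using p finite_subset by (auto simp: progress_def)
  have "B ` I \<subseteq> ptg ` {..<ptr} \<union> B0 ` pit ` {ptr..<len} \<union> B ` F"
  proof (rule image_subsetI)
    fix i assume "i \<in> I"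
    show "B i \<in> ptg ` {..<ptr} \<union> B0 ` pit ` {ptr..<len} \<union> B ` F"
    proof (cases "i \<in> F")
      case False
      with \<open>i \<in> I\<close> have "i \<in> I - F" by simp
      with pl p show ?thesis by (rule progress_cases) auto
    qed simp
  qed
  then have "num_bins I B \<le> card (ptg ` {..<ptr} \<union> B0 ` pit ` {ptr..<len} \<union> B ` F)"
    unfolding num_bins_def using fin by (intro card_mono) auto
  also have "\<dots> \<le> card (ptg ` {..<ptr}) + card (B0 ` pit ` {ptr..<len}) + card (B ` F)"
    by (meson card_Un_le add_right_mono order.trans)
  also have "card (B ` F) \<le> u" using p card_image_le[OF fin, of B] by (simp add: progress_def)
  finally show ?thesis by simp
qed

text \<open>
  What the packing at the start of an epoch inherits from the previous epoch, which lasted for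
  \<open>u'\<close> requests and began with \<open>n'\<close> items.
\<close>

definition inherited :: "real \<Rightarrow> real \<Rightarrow> nat \<Rightarrow> real \<Rightarrow> bool" where
  "inherited \<delta> \<epsilon> len w \<longleftrightarrow> (\<exists>u' n' v' e'. w \<le> 2 * real u' + v' \<and> real u' \<le> \<epsilon>\<^sup>2 * real n' + 1 \<and>
     slack \<delta> n' v' e' \<and> n' \<le> len + u')"

text \<open>This keeps errors from accumulating over the epochs: when all moves are made, no item is
  left in its old bin, so the excess over \<open>OPT\<close> depends on the last plan and its
  \<open>u\<close> requests only. The factor 2 arises because a request may cost a bin and may lower
  \<open>OPT\<close> by one.\<close>

lemma epoch_end_bins:
  fixes \<epsilon> :: real
  assumes pl: "plan s \<delta> I0 B0 base hi len pit ptg V e" and "0 \<le> \<delta>"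
    and p: "progress I B nb I0 B0 hi len pit ptg len u F" and u: "real u \<le> \<epsilon>\<^sup>2 * len + 1"
    and sz: "\<And>i. i \<in> I \<Longrightarrow> 0 \<le> s i \<and> s i \<le> 1"
  shows "inherited \<delta> \<epsilon> (card I) (real (num_bins I B) - OPT s I)"
proof -
  obtain v :: real where v: "V \<le> OPT s I0 + v" "slack \<delta> len v e" using pl by (auto simp: plan_def)
  have fin: "finite I" "finite I0" "card I0 = len" using p plan_finite[OF pl] by (auto simp: progress_def)
  have "real (num_bins I B) \<le> V + u" using progress_bins[OF pl p] pl by (auto simp: plan_def)
  moreover have "OPT s I0 \<le> OPT s I + card (I0 - I)"
    using fin sz pl \<open>0 \<le> \<delta>\<close> by (intro OPT_diff) (auto simp: plan_def intro: order.trans)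
  moreover have "card (I0 - I) \<le> u" using p by (simp add: progress_def)
  moreover have "len \<le> card I + card (I0 - I)"
    using fin card_Un_le[of "I \<inter> I0" "I0 - I"] card_mono[of I "I \<inter> I0"]
    by (simp add: Int_Diff_Un Int_commute Un_Diff_Int) (metis Int_Diff_Un Int_commute add_le_mono1 card_Un_le le_trans)
  ultimately have "real (num_bins I B) - OPT s I \<le> 2 * real u + v" "len \<le> card I + u" using v by linarith+
  with u v show ?thesis unfolding inherited_def by blast
qed

text \<open>In the middle of an epoch the old packing may still dominate, so its excess counts:
  \<open>2 * u'\<close> from the requests of the previous epoch, besides \<open>2 * u\<close> from
  the current one. An epoch changes the number of items by a bounded factor, up to a constant, so
  everything can be expressed by \<open>card I\<close>.\<close>

lemma epoch_bins:
  fixes \<epsilon> \<eta> C :: real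
  assumes pl: "plan s \<delta> I0 B0 base hi len pit ptg V e" and "0 \<le> \<delta>"
    and p: "progress I B nb I0 B0 hi len pit ptg ptr u F"
    and u: "real u \<le> \<epsilon>\<^sup>2 * len" and \<epsilon>: "\<epsilon>\<^sup>2 \<le> 1 / 4"
    and inh: "inherited \<delta> \<epsilon> len (real (num_bins I0 B0) - OPT s I0)"
    and sz: "\<And>i. i \<in> I \<Longrightarrow> 0 \<le> s i \<and> s i \<le> 1"
    and C: "\<And>n v e. slack \<delta> n v e \<Longrightarrow> v \<le> \<eta> * n + C \<and> e \<le> \<eta> * n + C" "0 \<le> \<eta>" "0 \<le> C"
  shows "num_bins I B \<le> OPT s I + (12 * \<epsilon>\<^sup>2 + 8 * \<eta>) * card I + (3 + 2 * \<eta> + 3 * C)"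
proof -
  obtain v :: real where v: "V \<le> OPT s I0 + v" "slack \<delta> len v e" using pl by (auto simp: plan_def)
  obtain u' n' v' e' where i: "real (num_bins I0 B0) - OPT s I0 \<le> 2 * real u' + v'"
    "real u' \<le> \<epsilon>\<^sup>2 * real n' + 1" "slack \<delta> n' v' e'" "n' \<le> len + u'"
    using inh unfolding inherited_def by blast
  have fin: "finite I" "finite I0" "card I0 = len" using p plan_finite[OF pl] by (auto simp: progress_def)
  have "real (num_bins I B) \<le> max (real (num_bins I0 B0)) V + e + u"
  proof -
    have "ptr \<le> len" using p by (simp add: progress_def)
    then have "real (card (ptg ` {..<ptr})) + card (B0 ` pit ` {ptr..<len}) \<le> max (real (num_bins I0 B0)) V + e"
      using pl by (auto simp: plan_def)
    then show ?thesis using progress_bins[OF pl p] by linarith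
  qed
  moreover have "OPT s I0 \<le> OPT s I + card (I0 - I)"
    using fin sz pl \<open>0 \<le> \<delta>\<close> by (intro OPT_diff) (auto simp: plan_def intro: order.trans)
  moreover have "card (I0 - I) \<le> u" using p by (simp add: progress_def)
  moreover have len: "len \<le> card I + card (I0 - I)"
    using fin by (metis card_Un_le card_mono finite_Un Un_Diff_cancel Un_upper2 le_trans)
  moreover have "v \<le> \<eta> * len + C" "e \<le> \<eta> * len + C" "v' \<le> \<eta> * n' + C" using C v i by blast+
  moreover have un: "\<epsilon>\<^sup>2 * n' \<le> 1 / 4 * n'" "\<epsilon>\<^sup>2 * len \<le> 1 / 4 * len"
    using \<epsilon> by (intro mult_right_mono; simp)+
  have n': "real n' \<le> 2 * len + 2" using un i by linarith
  have n0: "real len \<le> 2 * card I" using un u len calculation(3) by linarith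
  \<comment> \<open>Up to constants \<open>2 * u'\<close> costs \<open>8 * X\<close> and
    \<open>2 * u\<close> costs \<open>4 * X\<close>, while \<open>v'\<close>, \<open>v\<close> and
    \<open>e\<close> together cost at most \<open>4 * Y + 2 * Y + 2 * Y\<close>.\<close>
  define X Y where "X = \<epsilon>\<^sup>2 * card I" and "Y = \<eta> * card I"
  have "\<epsilon>\<^sup>2 * n' \<le> \<epsilon>\<^sup>2 * (4 * card I + 2)" "\<eta> * n' \<le> \<eta> * (4 * card I + 2)"
    "\<epsilon>\<^sup>2 * len \<le> \<epsilon>\<^sup>2 * (2 * card I)" "\<eta> * len \<le> \<eta> * (2 * card I)"
    using n' n0 C by (intro mult_left_mono; simp)+
  then have "\<epsilon>\<^sup>2 * n' \<le> 4 * X + 2 * \<epsilon>\<^sup>2" "\<eta> * n' \<le> 4 * Y + 2 * \<eta>"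
    "\<epsilon>\<^sup>2 * len \<le> 2 * X" "\<eta> * len \<le> 2 * Y"
    by (simp_all add: X_def Y_def algebra_simps)
  moreover have "0 \<le> X" "0 \<le> Y" using C by (simp_all add: X_def Y_def)
  moreover have "max (real (num_bins I0 B0)) V \<le> num_bins I0 B0 \<or> max (real (num_bins I0 B0)) V \<le> V" by auto
  ultimately have "num_bins I B \<le> OPT s I + (12 * X + 8 * Y) + (3 + 2 * \<eta> + 3 * C)"
    using v(1) i(1,2) u \<epsilon> C(2,3) by linarith
  then show ?thesis by (simp add: X_def Y_def algebra_simps)
qed

section \<open>The program\<close>

abbreviation seq (infixr ";;" 60) where "c ;; d \<equiv> Seq c d"
abbreviation nv where "nv x \<equiv> NCell x (NNum 0)"
abbreviation rv where "rv x \<equiv> RCell x (NNum 0)"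
abbreviation nset where "nset x e \<equiv> NAssign x (NNum 0) e"
abbreviation rset where "rset x e \<equiv> RAssign x (NNum 0) e"
abbreviation ninc where "ninc x \<equiv> nset x (NAdd (nv x) (NNum 1))"
abbreviation neq where "neq e1 e2 \<equiv> BNot (BAnd (BNot (NLess e1 e2)) (BNot (NLess e2 e1)))"

section \<open>Choosing the number of groups\<close>

definition power_prog :: com where
  "power_prog = nset ''pw'' (NNum 1) ;;
     For ''a'' (NAdd (nv ''L'') (NNum 1))
      (nset ''ac'' (NNum 0) ;;
       For ''b'' (NAdd (nv ''L'') (NNum 1)) (nset ''ac'' (NAdd (nv ''ac'') (nv ''pw''))) ;;
       nset ''pw'' (nv ''ac''))"

text \<open>Naturals can only be added, so each of the \<open>L + 1\<close> multiplications is
  itself a loop of \<open>L + 1\<close> additions.\<close>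

lemma wp_power:
  assumes L: "nats \<sigma> ''L'' 0 = L" and W: "L + 1 \<le> W"
    and post: "\<And>\<tau>. agree power_prog \<sigma> \<tau> \<Longrightarrow> nats \<tau> ''pw'' 0 = (L + 1) ^ (L + 1) \<Longrightarrow> Q \<tau>"
  shows "wp W power_prog Q \<sigma>"
proof (rule wp_mono)
  show "wp W power_prog (\<lambda>\<tau>. nats \<tau> ''pw'' 0 = (L + 1) ^ (L + 1)) \<sigma>"
    unfolding power_prog_def wp_basic
  proof (rule wp_For[where N = "L + 1" and Inv = "\<lambda>a \<tau>. nats \<tau> ''pw'' 0 = (L + 1) ^ a"], goal_cases)
    case (5 a \<tau>)
    show ?case
      unfolding wp_basic
      by (rule wp_For[where N = "L + 1" and
            Inv = "\<lambda>b \<upsilon>. nats \<upsilon> ''ac'' 0 = b * (L + 1) ^ a \<and> nats \<upsilon> ''pw'' 0 = (L + 1) ^ a"])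
        (use W 5 L in \<open>auto simp: agree_def\<close>)
  qed (use W L in \<open>auto simp: agree_def\<close>)
qed (use post in auto)

definition level_prog :: com where
  "level_prog = nset ''L'' (NNum 0) ;; nset ''pw'' (NNum 1) ;;
     While (BNot (NLess (nv ''n'') (nv ''pw''))) (ninc ''L'' ;; power_prog)"

lemma nw_power [simp]: "nw power_prog = {''pw'', ''a'', ''ac'', ''b''}" and rw_power [simp]: "rw power_prog = {}"
  by (auto simp: power_prog_def)

lemma le_self_power: "(L::nat) \<le> L ^ L"
  by (cases "L = 0") (auto intro: self_le_power)

text \<open>\<open>pw\<close> holds the power that belongs to \<open>L + 1\<close>, so the test
  looks one step ahead. At most \<open>n\<close> rounds are needed because
  \<open>L <= L ^ L <= n\<close>.\<close>

lemma wp_level: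
  assumes n: "nats \<sigma> ''n'' 0 = n" and W: "n + 2 \<le> W"
    and post: "\<And>\<tau> L. agree level_prog \<sigma> \<tau> \<Longrightarrow> nats \<tau> ''L'' 0 = L \<Longrightarrow> (n = 0 \<longrightarrow> L = 0) \<Longrightarrow>
      (0 < n \<longrightarrow> 1 \<le> L \<and> L ^ L \<le> n \<and> n < (L + 1) ^ (L + 1)) \<Longrightarrow> Q \<tau>"
  shows "wp W level_prog Q \<sigma>"
proof -
  define E :: "nat \<Rightarrow> nat" where "E x = x ^ x" for x
  have E: "x \<le> E x" for x using le_self_power by (simp add: E_def)
  define R where "R L \<tau> \<longleftrightarrow> nats \<tau> ''L'' 0 = L \<and> nats \<tau> ''pw'' 0 = E (Suc L) \<and> (L = 0 \<or> E L \<le> n)"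
    for L and \<tau> :: state
  have "wp W level_prog (\<lambda>\<tau>. \<exists>L. R L \<tau> \<and> n < E (Suc L)) \<sigma>"
    unfolding level_prog_def wp_basic
  proof (rule wp_While[where N = n and Inv = "\<lambda>k \<tau>. \<exists>L. R L \<tau> \<and> L + k = n"], goal_cases)
    case (3 k \<tau>)
    then have "nats \<tau> ''n'' 0 = n" using n by (auto simp: agree_def)
    with 3 obtain L where L: "nats \<tau> ''L'' 0 = L" "L + Suc k = n" "E (Suc L) \<le> n"
      by (auto simp: R_def)
    show ?case
      unfolding wp_basic
    proof (rule wp_power[where L = "Suc L"], goal_cases)
      case (3 \<upsilon>)
      then have "R (Suc L) \<upsilon>" using L by (simp add: R_def agree_def E_def)
      then show ?case using L(2) by (intro impI exI[of _ "Suc L"]) simp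
    qed (use L W in auto)
  next
    case (4 \<tau>)
    then have "nats \<tau> ''n'' 0 = n" using n by (auto simp: agree_def)
    with 4 show ?case using E[of "Suc n"] by (auto simp: R_def)
  next
    case (5 k \<tau>)
    then have "nats \<tau> ''n'' 0 = n" using n by (auto simp: agree_def)
    with 5 show ?case by (auto simp: R_def)
  qed (use W in \<open>auto simp: R_def E_def\<close>)
  then show ?thesis
  proof (rule wp_mono)
    fix \<tau> assume agr: "agree level_prog \<sigma> \<tau>" and "\<exists>L. R L \<tau> \<and> n < E (Suc L)"
    then obtain L where L: "R L \<tau>" "n < E (Suc L)" by blast
    have "1 \<le> L \<and> E L \<le> n" if "0 < n"
    proof -
      have "L \<noteq> 0" using that L(2) by (intro notI) (simp add: E_def)
      with L(1) show ?thesis by (simp add: R_def)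
    qed
    moreover have "L = 0" if "n = 0" using that L(1) E[of L] by (auto simp: R_def)
    ultimately show "Q \<tau>" using post[OF agr, of L] L by (auto simp: R_def E_def simp del: power_Suc)
  qed
qed

section \<open>Sorting the items and cutting them into groups\<close>

definition sort_prog :: com where
  "sort_prog = For ''a'' (nv ''n'') (For ''b'' (nv ''n'')
     (Cond (BAnd (NLess (nv ''a'') (nv ''b''))
         (RLess (RCell ''sz'' (NCell ''it'' (nv ''a''))) (RCell ''sz'' (NCell ''it'' (nv ''b'')))))
       (nset ''x'' (NCell ''it'' (nv ''a'')) ;;
        NAssign ''it'' (nv ''a'') (NCell ''it'' (nv ''b'')) ;;
        NAssign ''it'' (nv ''b'') (nv ''x''))
       Skip))"

lemma bij_betw_swap_values:
  assumes "bij_betw f {..<n} I" "a < n" "b < n"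
  shows "bij_betw (f(a := f b, b := f a)) {..<n} I"
proof -
  have eq: "f(a := f b, b := f a) = f \<circ> (\<lambda>p. if p = a then b else if p = b then a else p)" by auto
  have "bij_betw (\<lambda>p. if p = a then b else if p = b then a else p) {..<n} {..<n}"
    using assms by (intro bij_betw_byWitness[where f' = "\<lambda>p. if p = a then b else if p = b then a else p"]) auto
  then show ?thesis unfolding eq using assms(1) by (rule bij_betw_trans)
qed

text \<open>Round \<open>a\<close> exchanges items until position \<open>a\<close> holds a largest
  one among those from \<open>a\<close> on. The invariant \<open>R a\<close> compares settled
  positions with all later ones, so exchanges among later positions do not disturb it.\<close>

lemma wp_sort:
  assumes n: "nats \<sigma> ''n'' 0 = n" and W: "n + 2 \<le> W" and it: "bij_betw (nats \<sigma> ''it'') {..<n} I"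
    and s: "reals \<sigma> ''sz'' = s"
    and post: "\<And>\<tau>. agree sort_prog \<sigma> \<tau> \<Longrightarrow> bij_betw (nats \<tau> ''it'') {..<n} I \<Longrightarrow>
      (\<And>p q. p \<le> q \<Longrightarrow> q < n \<Longrightarrow> s (nats \<tau> ''it'' q) \<le> s (nats \<tau> ''it'' p)) \<Longrightarrow> Q \<tau>"
  shows "wp W sort_prog Q \<sigma>"
proof (rule wp_mono)
  define R where "R a it \<longleftrightarrow> bij_betw it {..<n} I \<and>
    (\<forall>p q. p < a \<and> p \<le> q \<and> q < n \<longrightarrow> s (it q) \<le> s (it p))" for a and it :: "nat \<Rightarrow> nat"
  show "wp W sort_prog (\<lambda>\<tau>. R n (nats \<tau> ''it'')) \<sigma>"
    unfolding sort_prog_def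
  proof (rule wp_For[where N = n and Inv = "\<lambda>a \<tau>. R a (nats \<tau> ''it'')"], goal_cases)
    case (5 a \<tau>)
    have st: "nats \<tau> ''n'' 0 = n" "reals \<tau> ''sz'' = s" "nats \<tau> ''a'' 0 = a"
      using 5 n s by (auto simp: agree_def)
    show ?case
    proof (rule wp_For[where N = n and Inv = "\<lambda>b \<upsilon>. R a (nats \<upsilon> ''it'') \<and>
        (\<forall>q. a \<le> q \<and> q < b \<longrightarrow> s (nats \<upsilon> ''it'' q) \<le> s (nats \<upsilon> ''it'' a))"], goal_cases)
      case (5 b \<upsilon>)
      have st': "reals \<upsilon> ''sz'' = s" "nats \<upsilon> ''a'' 0 = a"
        using 5 st by (auto simp: agree_def)
      define it where "it = nats \<upsilon> ''it''"
      have R: "bij_betw it {..<n} I" "\<And>p q. p < a \<Longrightarrow> p \<le> q \<Longrightarrow> q < n \<Longrightarrow> s (it q) \<le> s (it p)"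
        "\<And>q. a \<le> q \<Longrightarrow> q < b \<Longrightarrow> s (it q) \<le> s (it a)"
        using 5 by (auto simp: R_def it_def)
      show ?case
      proof (cases "a < b \<and> s (it a) < s (it b)")
        case True
        have "R a (it(a := it b, b := it a))"
          unfolding R_def
        proof (intro conjI allI impI)
          show "bij_betw (it(a := it b, b := it a)) {..<n} I"
            using R(1) \<open>a < n\<close> \<open>b < n\<close> by (rule bij_betw_swap_values)
          fix p q assume "p < a \<and> p \<le> q \<and> q < n"
          then show "s ((it(a := it b, b := it a)) q) \<le> s ((it(a := it b, b := it a)) p)"
            using True R(2)[of p] \<open>b < n\<close> by (auto simp: fun_upd_def)
        qed
        moreover have "s ((it(a := it b, b := it a)) q) \<le> s ((it(a := it b, b := it a)) a)"
          if "a \<le> q \<and> q < Suc b" for q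
          using R(3)[of q] that True by (auto simp: less_Suc_eq)
        ultimately show ?thesis using True st' 5
          by (auto simp: it_def[symmetric])
      next
        case False
        have "s (it q) \<le> s (it a)" if "a \<le> q \<and> q < Suc b" for q
          using R(3)[of q] that False by (cases "q = b"; cases "q = a") auto
        then show ?thesis using False st' 5 by (auto simp: it_def)
      qed
    next
      case (6 \<upsilon>)
      then show ?case by (auto simp: R_def less_Suc_eq)
    qed (use W 5 st in \<open>auto simp: agree_def R_def\<close>)
  qed (use W n it in \<open>auto simp: agree_def R_def\<close>)
  show "Q \<tau>" if "agree sort_prog \<sigma> \<tau>" "R n (nats \<tau> ''it'')" for \<tau>
    using that by (intro post) (auto simp: R_def)
qed

text \<open>Rounds \<open>n / L\<close> up by counting how many copies of \<open>L\<close> cover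
  \<open>n\<close>.\<close>

definition group_size_prog :: com where
  "group_size_prog = nset ''m'' (NNum 0) ;; nset ''x'' (NNum 0) ;;
     While (NLess (nv ''x'') (nv ''n'')) (nset ''x'' (NAdd (nv ''x'') (nv ''L'')) ;; ninc ''m'')"

lemma wp_group_size:
  assumes n: "nats \<sigma> ''n'' 0 = n" and L: "nats \<sigma> ''L'' 0 = L" "0 < n \<Longrightarrow> 0 < L" and W: "n + 2 \<le> W"
    and post: "\<And>\<tau> m. agree group_size_prog \<sigma> \<tau> \<Longrightarrow> nats \<tau> ''m'' 0 = m \<Longrightarrow> n \<le> m * L \<Longrightarrow>
      (0 < n \<Longrightarrow> 0 < m \<and> (m - 1) * L < n) \<Longrightarrow> Q \<tau>"
  shows "wp W group_size_prog Q \<sigma>"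
proof (rule wp_mono)
  define R where "R m x \<longleftrightarrow> x = m * L \<and> (m = 0 \<or> (m - 1) * L < n)" for m x
  show "wp W group_size_prog (\<lambda>\<tau>. \<exists>x. R (nats \<tau> ''m'' 0) x \<and> n \<le> x) \<sigma>"
    unfolding group_size_prog_def wp_basic
  proof (rule wp_While[where N = n and
        Inv = "\<lambda>k \<tau>. R (nats \<tau> ''m'' 0) (nats \<tau> ''x'' 0) \<and> n \<le> nats \<tau> ''x'' 0 + k"], goal_cases)
    case (3 k \<tau>)
    then have "nats \<tau> ''n'' 0 = n" "nats \<tau> ''L'' 0 = L" using n L by (auto simp: agree_def)
    with 3 L(2) show ?case by (auto simp: R_def)
  next
    case (4 \<tau>)
    then have "nats \<tau> ''n'' 0 = n" using n by (auto simp: agree_def)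
    with 4 show ?case by auto
  next
    case (5 k \<tau>)
    then have "nats \<tau> ''n'' 0 = n" using n by (auto simp: agree_def)
    with 5 show ?case by auto
  qed (use W in \<open>auto simp: R_def\<close>)
  fix \<tau> assume a: "agree group_size_prog \<sigma> \<tau>" "\<exists>x. R (nats \<tau> ''m'' 0) x \<and> n \<le> x"
  then show "Q \<tau>" by (intro post[OF a(1) refl]) (auto simp: R_def intro: gr0I)
qed

definition clear_prog :: com where
  "clear_prog = For ''k'' (nv ''L'') (RAssign ''g'' (nv ''k'') (RNum 0) ;;
     RAssign ''gs'' (nv ''k'') (RNum 0) ;; RAssign ''D'' (nv ''k'') (RNum 0))"

lemma wp_clear:
  assumes L: "nats \<sigma> ''L'' 0 = L" and W: "L \<le> W"
    and post: "\<And>\<tau>. agree clear_prog \<sigma> \<tau> \<Longrightarrow>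
      (\<And>k. k < L \<Longrightarrow> reals \<tau> ''g'' k = 0 \<and> reals \<tau> ''gs'' k = 0 \<and> reals \<tau> ''D'' k = 0) \<Longrightarrow> Q \<tau>"
  shows "wp W clear_prog Q \<sigma>"
proof (rule wp_mono)
  show "wp W clear_prog (\<lambda>\<tau>. \<forall>k<L. reals \<tau> ''g'' k = 0 \<and> reals \<tau> ''gs'' k = 0 \<and> reals \<tau> ''D'' k = 0) \<sigma>"
    unfolding clear_prog_def
    by (rule wp_For[where N = L and Inv =
          "\<lambda>a \<tau>. \<forall>k<a. reals \<tau> ''g'' k = 0 \<and> reals \<tau> ''gs'' k = 0 \<and> reals \<tau> ''D'' k = 0"])
      (use L W in \<open>auto simp: agree_def less_Suc_eq\<close>)
qed (use post in auto)

text \<open>The counters \<open>k\<close> and \<open>j\<close> follow \<open>p div m\<close> and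
  \<open>p mod m\<close>. Group sizes are counted as reals because they are divided later and
  naturals cannot be converted. Groups beyond the last item keep slot size 0.\<close>

definition group_prog :: com where
  "group_prog = nset ''k'' (NNum 0) ;; nset ''j'' (NNum 0) ;;
     For ''p'' (nv ''n'')
      (NAssign ''grp'' (nv ''p'') (nv ''k'') ;;
       Cond (NLess (nv ''j'') (NNum 1))
         (RAssign ''g'' (nv ''k'') (RCell ''sz'' (NCell ''it'' (nv ''p'')))) Skip ;;
       RAssign ''gs'' (nv ''k'') (RAdd (RCell ''gs'' (nv ''k'')) (RNum 1)) ;;
       ninc ''j'' ;;
       Cond (NLess (nv ''j'') (nv ''m'')) Skip (ninc ''k'' ;; nset ''j'' (NNum 0)))"

lemma wp_group:
  assumes n: "nats \<sigma> ''n'' 0 = n" and m: "nats \<sigma> ''m'' 0 = m" "0 < n \<Longrightarrow> 0 < m"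
    and W: "n \<le> W"
    and z: "\<And>k. k < L \<Longrightarrow> reals \<sigma> ''g'' k = 0" "\<And>k. k < L \<Longrightarrow> reals \<sigma> ''gs'' k = 0"
    and s: "nats \<sigma> ''it'' = it" "reals \<sigma> ''sz'' = s"
    and post: "\<And>\<tau>. agree group_prog \<sigma> \<tau> \<Longrightarrow>
      (\<And>p. p < n \<Longrightarrow> nats \<tau> ''grp'' p = p div m) \<Longrightarrow>
      (\<And>k. k < L \<Longrightarrow> reals \<tau> ''g'' k = (if k * m < n then s (it (k * m)) else 0)) \<Longrightarrow>
      (\<And>k. k < L \<Longrightarrow> reals \<tau> ''gs'' k = card {p. p < n \<and> p div m = k}) \<Longrightarrow> Q \<tau>"
  shows "wp W group_prog Q \<sigma>"
proof (cases "n = 0")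
  case True
  show ?thesis
    unfolding group_prog_def wp_basic
    by (rule wp_For[where N = 0 and Inv = "\<lambda>p \<tau>. \<forall>k<L. reals \<tau> ''g'' k = 0 \<and> reals \<tau> ''gs'' k = 0"])
      (use n True z in \<open>auto simp: agree_def group_prog_def intro!: post\<close>)
next
  case False
  with m have m0: "0 < m" by simp
  define R where "R p grp g gs \<longleftrightarrow> (\<forall>p'<p. grp p' = p' div m) \<and>
    (\<forall>k<L. g k = (if k * m < p then s (it (k * m)) else 0)) \<and>
    (\<forall>k<L. gs k = real (card {p'. p' < p \<and> p' div m = k}))" for p grp g gs
  show ?thesis
  proof (rule wp_mono)
    show "wp W group_prog (\<lambda>\<tau>. R n (nats \<tau> ''grp'') (reals \<tau> ''g'') (reals \<tau> ''gs'')) \<sigma>"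
      unfolding group_prog_def wp_basic
    proof (rule wp_For[where N = n and Inv = "\<lambda>p \<tau>. nats \<tau> ''k'' 0 = p div m \<and> nats \<tau> ''j'' 0 = p mod m \<and>
        R p (nats \<tau> ''grp'') (reals \<tau> ''g'') (reals \<tau> ''gs'')"], goal_cases)
      case (5 p \<tau>)
      have st: "nats \<tau> ''m'' 0 = m" "nats \<tau> ''it'' = it" "reals \<tau> ''sz'' = s" "nats \<tau> ''p'' 0 = p"
        "nats \<tau> ''k'' 0 = p div m" "nats \<tau> ''j'' 0 = p mod m"
        using 5 m s by (auto simp: agree_def)
      define grp g gs where d: "grp = nats \<tau> ''grp''" "g = reals \<tau> ''g''" "gs = reals \<tau> ''gs''"
      have R: "R p grp g gs" using 5 by (simp add: d)
      have eq: "k * m = p \<longleftrightarrow> k = p div m \<and> p mod m = 0" for k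
        using m0 by (metis div_mult_mod_eq add.right_neutral nonzero_mult_div_cancel_right less_not_refl2 mod_mult_self2_is_0)
      have le: "k * m < Suc p \<longleftrightarrow> k * m < p \<or> k = p div m \<and> p mod m = 0" for k
        using eq[of k] by (auto simp: less_Suc_eq)
      have nlt: "\<not> p div m * m < p" if "p mod m = 0"
        using that by (metis div_mult_mod_eq add.right_neutral less_irrefl)
      have cs: "{p'. p' < Suc p \<and> p' div m = k} =
          (if k = p div m then insert p {p'. p' < p \<and> p' div m = k} else {p'. p' < p \<and> p' div m = k})" for k
        by (auto simp: less_Suc_eq)
      have R1: "R (Suc p) (grp(p := p div m)) (if p mod m = 0 then g(p div m := s (it p)) else g)
          (gs(p div m := gs (p div m) + 1))"
        using R unfolding R_def le cs
        by (auto simp: less_Suc_eq eq)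
      have dm: "Suc p div m = (if Suc (p mod m) < m then p div m else Suc (p div m))"
        "Suc p mod m = (if Suc (p mod m) < m then Suc (p mod m) else 0)"
        using m0 by (auto simp: div_Suc mod_Suc mod_less_divisor Suc_lessI)
      show ?case
        using R1 by (cases "p mod m = 0") (simp_all add: st dm d)
    qed (use W n False in \<open>auto simp: agree_def R_def z\<close>)
  qed (auto intro!: post simp: R_def)
qed

section \<open>Searching all patterns\<close>

definition load :: "(nat \<Rightarrow> real) \<Rightarrow> nat \<Rightarrow> (nat \<Rightarrow> nat) \<Rightarrow> nat \<Rightarrow> real" where
  "load g L f b = (\<Sum>k\<in>{k. k < L \<and> f k = b}. g k)"

text \<open>Slots of empty groups have size 0; counting only bins of positive load keeps them from
  costing bins.\<close>

definition used :: "(nat \<Rightarrow> real) \<Rightarrow> nat \<Rightarrow> (nat \<Rightarrow> nat) \<Rightarrow> nat" where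
  "used g L f = card {b. b < L \<and> 0 < load g L f b}"

definition digit :: "nat \<Rightarrow> nat \<Rightarrow> nat \<Rightarrow> nat" where
  "digit L c k = c div L ^ k mod L"

lemma load_cong: "(\<And>k. k < L \<Longrightarrow> f k = f' k) \<Longrightarrow> load g L f b = load g L f' b"
  unfolding load_def by (intro sum.cong) auto

lemma used_cong: "(\<And>k. k < L \<Longrightarrow> f k = f' k) \<Longrightarrow> used g L f = used g L f'"
  unfolding used_def using load_cong[of L f f' g] by simp

text \<open>Base \<open>L\<close> notation. For \<open>N = L\<close> it gives every pattern a code
  below \<open>L ^ L <= n\<close>, so a search over all \<open>c < n\<close> misses none.\<close>

lemma digits_exist:
  assumes "\<And>k. k < N \<Longrightarrow> f k < L"
  shows "\<exists>c<L ^ N. \<forall>k<N. digit L c k = f k"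
  using assms
proof (induction N)
  case (Suc N)
  then obtain c where c: "c < L ^ N" "\<forall>k<N. digit L c k = f k" by auto
  have fN: "f N < L" using Suc.prems by simp
  define c' where "c' = c + f N * L ^ N"
  have "c' < (f N + 1) * L ^ N" using c(1) by (simp add: c'_def)
  also have "\<dots> \<le> L * L ^ N" using fN by (intro mult_right_mono) auto
  finally have "c' < L ^ Suc N" by simp
  moreover have "digit L c' k = f k" if "k < Suc N" for k
  proof (cases "k = N")
    case True
    then show ?thesis using c(1) fN by (simp add: digit_def c'_def)
  next
    case False
    with that have k: "k < N" by simp
    then obtain d where d: "N = k + Suc d" using less_natE by (metis add_Suc_right add_Suc)
    have "c' = c + (f N * L ^ d * L) * L ^ k" by (simp add: c'_def d power_add)
    moreover have "0 < L ^ k" using fN by simp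
    ultimately have "c' div L ^ k = c div L ^ k + f N * L ^ d * L" by simp
    then show ?thesis using c(2) k by (simp add: digit_def)
  qed
  ultimately show ?case by blast
qed auto

text \<open>Digits are split off by repeated subtraction of \<open>L\<close>, at most
  \<open>c\<close> times for each digit.\<close>

definition decode_prog :: com where
  "decode_prog = nset ''x'' (nv ''c'') ;;
     For ''k'' (nv ''L'')
      (nset ''q'' (NNum 0) ;;
       While (BNot (NLess (nv ''x'') (nv ''L''))) (nset ''x'' (NSub (nv ''x'') (nv ''L'')) ;; ninc ''q'') ;;
       NAssign ''dig'' (nv ''k'') (nv ''x'') ;; nset ''x'' (nv ''q''))"

lemma wp_decode:
  assumes L: "nats \<sigma> ''L'' 0 = L" and c: "nats \<sigma> ''c'' 0 = c" and W: "L \<le> W" "c \<le> W"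
    and post: "\<And>\<tau>. agree decode_prog \<sigma> \<tau> \<Longrightarrow> (\<And>k. k < L \<Longrightarrow> nats \<tau> ''dig'' k = digit L c k) \<Longrightarrow> Q \<tau>"
  shows "wp W decode_prog Q \<sigma>"
proof (rule wp_mono)
  show "wp W decode_prog (\<lambda>\<tau>. \<forall>k<L. nats \<tau> ''dig'' k = digit L c k) \<sigma>"
    unfolding decode_prog_def wp_basic
  proof (rule wp_For[where N = L and Inv = "\<lambda>k \<tau>. nats \<tau> ''x'' 0 = c div L ^ k \<and>
        (\<forall>k'<k. nats \<tau> ''dig'' k' = digit L c k')"], goal_cases)
    case (5 k \<tau>)
    define x where "x = c div L ^ k"
    have st: "nats \<tau> ''x'' 0 = x" "nats \<tau> ''L'' 0 = L" "nats \<tau> ''k'' 0 = k"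
      using 5 L by (auto simp: agree_def x_def)
    have xW: "x \<le> W" using W(2) div_le_dividend[of c "L ^ k"] unfolding x_def by linarith
    show ?case
      unfolding wp_basic
    proof (rule wp_While[where N = x and
          Inv = "\<lambda>r \<upsilon>. nats \<upsilon> ''x'' 0 \<le> r \<and> nats \<upsilon> ''x'' 0 + nats \<upsilon> ''q'' 0 * L = x"], goal_cases)
      case (3 r \<upsilon>)
      then have "nats \<upsilon> ''L'' 0 = L" using st by (auto simp: agree_def)
      with 3 \<open>k < L\<close> show ?case by auto
    next
      case (4 \<upsilon>)
      then have "nats \<upsilon> ''L'' 0 = L" using st by (auto simp: agree_def)
      with 4 \<open>k < L\<close> show ?case by auto
    next
      case (5 r \<upsilon>)
      then have v: "nats \<upsilon> ''L'' 0 = L" "nats \<upsilon> ''k'' 0 = k" "nats \<upsilon> ''dig'' = nats \<tau> ''dig''"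
        using st by (auto simp: agree_def)
      define y q where yq: "y = nats \<upsilon> ''x'' 0" "q = nats \<upsilon> ''q'' 0"
      have "y + q * L = x" "y < L" using 5 v by (auto simp: yq)
      then have "x div L = q" "x mod L = y" by auto
      then have "q = c div L ^ Suc k" "y = digit L c k"
        by (simp_all add: x_def digit_def power_Suc2 div_mult2_eq del: power_Suc)
      then show ?case using \<open>nats \<tau> ''x'' 0 = c div L ^ k \<and> (\<forall>k'<k. nats \<tau> ''dig'' k' = digit L c k')\<close>
        by (auto simp: v yq less_Suc_eq)
    qed (use xW st in auto)
  qed (use W L c in \<open>auto simp: agree_def\<close>)
qed (use post in auto)

definition load_prog :: com where
  "load_prog = For ''k'' (nv ''L'') (RAssign ''load'' (nv ''k'') (RNum 0)) ;;
     For ''k'' (nv ''L'') (RAssign ''load'' (NCell ''dig'' (nv ''k''))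
       (RAdd (RCell ''load'' (NCell ''dig'' (nv ''k''))) (RCell ''g'' (nv ''k''))))"

lemma load_Suc: "load g (Suc k) f b = load g k f b + (if f k = b then g k else 0)"
proof -
  have "{k'. k' < Suc k \<and> f k' = b} = (if f k = b then insert k {k'. k' < k \<and> f k' = b} else {k'. k' < k \<and> f k' = b})"
    by (auto simp: less_Suc_eq)
  then show ?thesis by (simp add: load_def)
qed

lemma wp_load:
  assumes L: "nats \<sigma> ''L'' 0 = L" and f: "nats \<sigma> ''dig'' = f" "\<And>k. k < L \<Longrightarrow> f k < L" and W: "L \<le> W"
    and g: "reals \<sigma> ''g'' = g"
    and post: "\<And>\<tau>. agree load_prog \<sigma> \<tau> \<Longrightarrow> (\<And>b. b < L \<Longrightarrow> reals \<tau> ''load'' b = load g L f b) \<Longrightarrow> Q \<tau>"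
  shows "wp W load_prog Q \<sigma>"
proof (rule wp_mono)
  show "wp W load_prog (\<lambda>\<tau>. \<forall>b<L. reals \<tau> ''load'' b = load g L f b) \<sigma>"
    unfolding load_prog_def wp_basic
  proof (rule wp_For[where N = L and Inv = "\<lambda>k \<tau>. \<forall>b<k. reals \<tau> ''load'' b = 0"], goal_cases)
    case (6 \<tau>)
    then have st: "nats \<tau> ''L'' 0 = L" "nats \<tau> ''dig'' = f" "reals \<tau> ''g'' = g"
      using L f g by (auto simp: agree_def)
    show ?case
      by (rule wp_For[where N = L and Inv = "\<lambda>k \<tau>. \<forall>b<L. reals \<tau> ''load'' b = load g k f b"])
        (use W st f 6 in \<open>auto simp: agree_def load_Suc\<close>, simp add: load_def)
  qed (use W L in \<open>auto simp: agree_def less_Suc_eq\<close>)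
qed (use post in auto)

definition count_prog :: com where
  "count_prog = nset ''ok'' (NNum 1) ;; nset ''cnt'' (NNum 0) ;;
     For ''k'' (nv ''L'')
      (Cond (RLess (RNum 1) (RCell ''load'' (nv ''k''))) (nset ''ok'' (NNum 0)) Skip ;;
       Cond (RLess (RNum 0) (RCell ''load'' (nv ''k''))) (ninc ''cnt'') Skip)"

lemma wp_count:
  assumes L: "nats \<sigma> ''L'' 0 = L" and W: "L \<le> W" and l: "reals \<sigma> ''load'' = l"
    and post: "\<And>\<tau>. agree count_prog \<sigma> \<tau> \<Longrightarrow> nats \<tau> ''cnt'' 0 = card {b. b < L \<and> 0 < l b} \<Longrightarrow>
      (0 < nats \<tau> ''ok'' 0 \<longleftrightarrow> (\<forall>b<L. l b \<le> 1)) \<Longrightarrow> Q \<tau>"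
  shows "wp W count_prog Q \<sigma>"
proof (rule wp_mono)
  show "wp W count_prog (\<lambda>\<tau>. nats \<tau> ''cnt'' 0 = card {b. b < L \<and> 0 < l b} \<and>
      (0 < nats \<tau> ''ok'' 0 \<longleftrightarrow> (\<forall>b<L. l b \<le> 1))) \<sigma>"
    unfolding count_prog_def wp_basic
  proof (rule wp_For[where N = L and Inv = "\<lambda>k \<tau>. nats \<tau> ''cnt'' 0 = card {b. b < k \<and> 0 < l b} \<and>
      (0 < nats \<tau> ''ok'' 0 \<longleftrightarrow> (\<forall>b<k. l b \<le> 1))"], goal_cases)
    case (5 k \<tau>)
    have st: "reals \<tau> ''load'' = l" "nats \<tau> ''k'' 0 = k" using 5 l by (auto simp: agree_def)
    have "{b. b < Suc k \<and> 0 < l b} = (if 0 < l k then insert k {b. b < k \<and> 0 < l b} else {b. b < k \<and> 0 < l b})"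
      by (auto simp: less_Suc_eq)
    then have "card {b. b < Suc k \<and> 0 < l b} = card {b. b < k \<and> 0 < l b} + (if 0 < l k then 1 else 0)" by simp
    with 5 st show ?case by (auto simp: less_Suc_eq)
  qed (use W L in \<open>auto simp: agree_def\<close>)
qed (use post in auto)

definition adopt_prog :: com where
  "adopt_prog = Cond (BAnd (NLess (NNum 0) (nv ''ok'')) (NLess (nv ''cnt'') (nv ''best'')))
     (nset ''best'' (nv ''cnt'') ;; For ''k'' (nv ''L'') (NAssign ''pat'' (nv ''k'') (NCell ''dig'' (nv ''k'')))) Skip"

definition try_prog :: com where
  "try_prog = decode_prog ;; load_prog ;; count_prog ;; adopt_prog"

lemma nw_try [simp]: "nw decode_prog = {''x'', ''k'', ''q'', ''dig''}" "nw load_prog = {''k''}"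
    "nw count_prog = {''ok'', ''cnt'', ''k''}" "nw adopt_prog = {''best'', ''k'', ''pat''}"
  and rw_try [simp]: "rw decode_prog = {}" "rw load_prog = {''load''}" "rw count_prog = {}" "rw adopt_prog = {}"
  by (auto simp: decode_prog_def load_prog_def count_prog_def adopt_prog_def)

definition feasible :: "(nat \<Rightarrow> real) \<Rightarrow> nat \<Rightarrow> (nat \<Rightarrow> nat) \<Rightarrow> bool" where
  "feasible g L f \<longleftrightarrow> (\<forall>k<L. f k < L) \<and> (\<forall>b<L. load g L f b \<le> 1)"

lemma feasible_cong: "(\<And>k. k < L \<Longrightarrow> f k = f' k) \<Longrightarrow> feasible g L f = feasible g L f'"
  unfolding feasible_def using load_cong[of L f f' g] by auto

lemma wp_try:
  assumes L: "nats \<sigma> ''L'' 0 = L" and c: "nats \<sigma> ''c'' 0 = c" and W: "L \<le> W" "c \<le> W" and g: "reals \<sigma> ''g'' = g"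
    and b: "nats \<sigma> ''best'' 0 = best" and L0: "0 < L"
    and post: "\<And>\<tau>. agree try_prog \<sigma> \<tau> \<Longrightarrow>
      (if feasible g L (digit L c) \<and> used g L (digit L c) < best
       then nats \<tau> ''best'' 0 = used g L (digit L c) \<and> (\<forall>k<L. nats \<tau> ''pat'' k = digit L c k)
       else nats \<tau> ''best'' 0 = best \<and> nats \<tau> ''pat'' = nats \<sigma> ''pat'') \<Longrightarrow> Q \<tau>"
  shows "wp W try_prog Q \<sigma>"
proof (rule wp_mono)
  let ?R = "\<lambda>\<tau>. (if feasible g L (digit L c) \<and> used g L (digit L c) < best
       then nats \<tau> ''best'' 0 = used g L (digit L c) \<and> (\<forall>k<L. nats \<tau> ''pat'' k = digit L c k)
       else nats \<tau> ''best'' 0 = best \<and> nats \<tau> ''pat'' = nats \<sigma> ''pat'')"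
  have dL: "digit L c k < L" for k using L0 by (simp add: digit_def)
  show "wp W try_prog ?R \<sigma>"
    unfolding try_prog_def wp_basic
  proof (rule wp_decode[OF L c W])
    fix \<tau>1 assume a1: "agree decode_prog \<sigma> \<tau>1" and d: "\<And>k. k < L \<Longrightarrow> nats \<tau>1 ''dig'' k = digit L c k"
    have L1: "nats \<tau>1 ''L'' 0 = L" and g1: "reals \<tau>1 ''g'' = g" and b1: "nats \<tau>1 ''best'' 0 = best"
      "nats \<tau>1 ''pat'' = nats \<sigma> ''pat''"
      using a1 L g b by (auto simp: agree_def)
    show "wp W load_prog (wp W count_prog (wp W adopt_prog ?R)) \<tau>1"
    proof (rule wp_load[OF L1 refl _ W(1) g1])
      fix \<tau>2 assume a2: "agree load_prog \<tau>1 \<tau>2"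
        and "\<And>b. b < L \<Longrightarrow> reals \<tau>2 ''load'' b = load g L (nats \<tau>1 ''dig'') b"
      then have l: "\<And>b. b < L \<Longrightarrow> reals \<tau>2 ''load'' b = load g L (digit L c) b"
        using load_cong[OF d] by simp
      have L2: "nats \<tau>2 ''L'' 0 = L" and b2: "nats \<tau>2 ''best'' 0 = best" "nats \<tau>2 ''pat'' = nats \<sigma> ''pat''"
        "nats \<tau>2 ''dig'' = nats \<tau>1 ''dig''"
        using a2 L1 b1 by (auto simp: agree_def)
      show "wp W count_prog (wp W adopt_prog ?R) \<tau>2"
      proof (rule wp_count[OF L2 W(1) refl])
        fix \<tau>3 assume a3: "agree count_prog \<tau>2 \<tau>3"
          and "nats \<tau>3 ''cnt'' 0 = card {b. b < L \<and> 0 < reals \<tau>2 ''load'' b}"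
          and "(0 < nats \<tau>3 ''ok'' 0) = (\<forall>b<L. reals \<tau>2 ''load'' b \<le> 1)"
        moreover have "{b. b < L \<and> 0 < reals \<tau>2 ''load'' b} = {b. b < L \<and> 0 < load g L (digit L c) b}"
          using l by auto
        ultimately have r: "nats \<tau>3 ''cnt'' 0 = used g L (digit L c)" "0 < nats \<tau>3 ''ok'' 0 \<longleftrightarrow> feasible g L (digit L c)"
          using l dL by (auto simp: used_def feasible_def)
        have st: "nats \<tau>3 ''L'' 0 = L" "nats \<tau>3 ''best'' 0 = best" "nats \<tau>3 ''pat'' = nats \<sigma> ''pat''"
          "nats \<tau>3 ''dig'' = nats \<tau>1 ''dig''"
          using a3 L2 b2 by (auto simp: agree_def)
        show "wp W adopt_prog ?R \<tau>3"
        proof (cases "feasible g L (digit L c) \<and> used g L (digit L c) < best")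
          case True
          have "wp W (For ''k'' (nv ''L'') (NAssign ''pat'' (nv ''k'') (NCell ''dig'' (nv ''k''))))
            (\<lambda>\<tau>. nats \<tau> ''best'' 0 = used g L (digit L c) \<and> (\<forall>k<L. nats \<tau> ''pat'' k = digit L c k))
            (setN ''best'' 0 (used g L (digit L c)) \<tau>3)"
            by (rule wp_For[where N = L and Inv = "\<lambda>k \<tau>. \<forall>k'<k. nats \<tau> ''pat'' k' = digit L c k'"])
              (use W st d in \<open>auto simp: agree_def less_Suc_eq\<close>)
          then show ?thesis using True r st by (simp add: adopt_prog_def)
        next
          case False
          then show ?thesis using r st by (auto simp: adopt_prog_def)
        qed
      qed
    qed (use d dL in auto)
  qed
qed (use post in auto)

text \<open>The search starts from the pattern with one slot per bin. It is feasible because slots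
  have size at most 1, so \<open>pat\<close> is valid even if no code improves on it. Codes from
  \<open>L ^ L\<close> on only repeat patterns.\<close>

definition search_prog :: com where
  "search_prog = nset ''best'' (nv ''L'') ;; For ''k'' (nv ''L'') (NAssign ''pat'' (nv ''k'') (nv ''k'')) ;;
     For ''c'' (nv ''n'') try_prog"

lemma nw_try_prog [simp]: "nw try_prog = {''x'', ''k'', ''q'', ''dig'', ''ok'', ''cnt'', ''best'', ''pat''}"
  and rw_try_prog [simp]: "rw try_prog = {''load''}"
  by (auto simp: try_prog_def)

lemma wp_search:
  assumes L: "nats \<sigma> ''L'' 0 = L" "0 < n \<Longrightarrow> 0 < L" "L \<le> n" "0 < n \<Longrightarrow> L ^ L \<le> n"
    and n: "nats \<sigma> ''n'' 0 = n" and W: "n + 2 \<le> W"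
    and g: "reals \<sigma> ''g'' = g" "\<And>k. k < L \<Longrightarrow> 0 \<le> g k \<and> g k \<le> 1"
    and post: "\<And>\<tau>. agree search_prog \<sigma> \<tau> \<Longrightarrow> feasible g L (nats \<tau> ''pat'') \<Longrightarrow>
      used g L (nats \<tau> ''pat'') \<le> nats \<tau> ''best'' 0 \<Longrightarrow> nats \<tau> ''best'' 0 \<le> L \<Longrightarrow>
      (\<And>f. feasible g L f \<Longrightarrow> nats \<tau> ''best'' 0 \<le> used g L f) \<Longrightarrow> Q \<tau>"
  shows "wp W search_prog Q \<sigma>"
proof (rule wp_mono)
  \<comment> \<open>The initial value \<open>L\<close> of \<open>best\<close> may exceed the number
    of used bins, as some groups may be empty; hence \<open>used\<close> is only bounded by
    \<open>best\<close>.\<close>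
  define R where "R c pat best \<longleftrightarrow> feasible g L pat \<and> used g L pat \<le> best \<and> best \<le> L \<and>
    (\<forall>c'<c. feasible g L (digit L c') \<longrightarrow> best \<le> used g L (digit L c'))" for c pat best
  show "wp W search_prog (\<lambda>\<tau>. R n (nats \<tau> ''pat'') (nats \<tau> ''best'' 0)) \<sigma>"
    unfolding search_prog_def wp_basic
  proof (rule wp_For[where N = L and Inv = "\<lambda>k \<tau>. nats \<tau> ''best'' 0 = L \<and> (\<forall>k'<k. nats \<tau> ''pat'' k' = k')"], goal_cases)
    case (6 \<tau>)
    then have st: "nats \<tau> ''L'' 0 = L" "nats \<tau> ''n'' 0 = n" "reals \<tau> ''g'' = g"
      using L n g by (auto simp: agree_def)
    have id: "load g L (nats \<tau> ''pat'') b = g b" if "b < L" for b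
    proof -
      have "{k. k < L \<and> nats \<tau> ''pat'' k = b} = {b}" using 6 that by auto
      then show ?thesis by (simp add: load_def)
    qed
    have "card {b. b < L \<and> 0 < load g L (nats \<tau> ''pat'') b} \<le> card {..<L}" by (intro card_mono) auto
    then have R0: "R 0 (nats \<tau> ''pat'') L"
      using 6 id g(2) by (auto simp: R_def feasible_def used_def)
    show ?case
    proof (rule wp_For[where N = n and Inv = "\<lambda>c \<tau>. R c (nats \<tau> ''pat'') (nats \<tau> ''best'' 0)"], goal_cases)
      case (5 c \<upsilon>)
      have st': "nats \<upsilon> ''L'' 0 = L" "nats \<upsilon> ''c'' 0 = c" "reals \<upsilon> ''g'' = g"
        using 5 st by (auto simp: agree_def)
      have W': "L \<le> W" "c \<le> W" using W L(3) \<open>c < n\<close> by auto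
      show ?case
      proof (rule wp_try[OF st'(1,2) W' st'(3) refl], goal_cases)
        case 1
        show ?case using L(2) \<open>c < n\<close> by simp
      next
        case (2 \<phi>)
        have R: "R c (nats \<upsilon> ''pat'') (nats \<upsilon> ''best'' 0)" using 5 by simp
        show ?case
        proof (cases "feasible g L (digit L c) \<and> used g L (digit L c) < nats \<upsilon> ''best'' 0")
          case True
          with 2 have v: "nats \<phi> ''best'' 0 = used g L (digit L c)" and "\<And>k. k < L \<Longrightarrow> nats \<phi> ''pat'' k = digit L c k"
            by auto
          then have "feasible g L (nats \<phi> ''pat'') = feasible g L (digit L c)"
            "used g L (nats \<phi> ''pat'') = used g L (digit L c)"
            using feasible_cong used_cong by blast+
          with R True v show ?thesis by (auto simp: R_def less_Suc_eq)
        next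
          case False
          with 2 R show ?thesis by (auto simp: R_def less_Suc_eq)
        qed
      qed
    qed (use W st R0 6 in \<open>auto simp: agree_def\<close>)
  qed (use W L in \<open>auto simp: agree_def less_Suc_eq\<close>)
  fix \<tau> assume a: "agree search_prog \<sigma> \<tau>" and R: "R n (nats \<tau> ''pat'') (nats \<tau> ''best'' 0)"
  show "Q \<tau>"
  proof (rule post[OF a])
    fix f assume f: "feasible g L f"
    show "nats \<tau> ''best'' 0 \<le> used g L f"
    proof (cases "n = 0")
      case True
      then show ?thesis using R L(3) by (simp add: R_def)
    next
      case False
      obtain c where c: "c < L ^ L" "\<forall>k<L. digit L c k = f k"
        using digits_exist[of L f L] f by (auto simp: feasible_def)
      then have "feasible g L (digit L c)" "used g L (digit L c) = used g L f"
        using feasible_cong[of L "digit L c" f g] used_cong[of L "digit L c" f g] f by auto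
      moreover have "c < n" using c(1) L(4) False by simp
      ultimately show ?thesis using R by (auto simp: R_def)
    qed
  qed (use R in \<open>auto simp: R_def\<close>)
qed

section \<open>Ordering the bins\<close>

definition cnt :: "(nat \<Rightarrow> nat) \<Rightarrow> nat set \<Rightarrow> nat \<Rightarrow> nat" where
  "cnt grp S k = card {p \<in> S. grp p = k}"

text \<open>The new bins are copies of the pattern: copy \<open>j\<close> offers group
  \<open>k\<close> the place \<open>base + j * L + pat k\<close>. The items of a group occupy
  successive copies, and \<open>sb k\<close> is the next free place of group \<open>k\<close>.
  \<open>S\<close> are the positions planned so far. Injectivity says that no place is given away
  twice.\<close>

definition layout :: "nat \<Rightarrow> (nat \<Rightarrow> nat) \<Rightarrow> (nat \<Rightarrow> nat) \<Rightarrow> (nat \<Rightarrow> nat) \<Rightarrow> nat \<Rightarrow> nat set \<Rightarrow>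
    nat \<Rightarrow> (nat \<Rightarrow> nat) \<Rightarrow> (nat \<Rightarrow> nat) \<Rightarrow> (nat \<Rightarrow> nat) \<Rightarrow> (nat \<Rightarrow> nat) \<Rightarrow> bool" where
  "layout L it grp pat base S len pos pit ptg sb \<longleftrightarrow>
     len = card S \<and> bij_betw pos {..<len} S \<and> (\<forall>l<len. pit l = it (pos l)) \<and>
     (\<forall>k<L. sb k = base + cnt grp S k * L + pat k) \<and>
     (\<forall>l<len. \<exists>j<cnt grp S (grp (pos l)). ptg l = base + j * L + pat (grp (pos l))) \<and>
     inj_on (\<lambda>l. (grp (pos l), ptg l)) {..<len}"

lemma cnt_insert: "finite S \<Longrightarrow> p \<notin> S \<Longrightarrow> cnt grp (insert p S) k = cnt grp S k + (if grp p = k then 1 else 0)"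
proof -
  assume a: "finite S" "p \<notin> S"
  have "{q \<in> insert p S. grp q = k} = (if grp p = k then insert p {q \<in> S. grp q = k} else {q \<in> S. grp q = k})"
    by auto
  then show ?thesis using a by (simp add: cnt_def)
qed

lemma layout_step:
  assumes l: "layout L it grp pat base S len pos pit ptg sb" and S: "finite S" "p \<notin> S" and p: "grp p < L"
  shows "layout L it grp pat base (insert p S) (Suc len) (pos(len := p)) (pit(len := it p))
    (ptg(len := sb (grp p))) (sb(grp p := sb (grp p) + L))"
proof -
  have len: "len = card S" and bij: "bij_betw pos {..<len} S" and pit: "\<forall>l<len. pit l = it (pos l)"
    and sb: "\<forall>k<L. sb k = base + cnt grp S k * L + pat k"
    and ptg: "\<And>l. l < len \<Longrightarrow> \<exists>j<cnt grp S (grp (pos l)). ptg l = base + j * L + pat (grp (pos l))"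
    and inj: "inj_on (\<lambda>l. (grp (pos l), ptg l)) {..<len}"
    using l by (auto simp: layout_def)
  have "bij_betw (pos(len := p)) (insert len {..<len}) (insert p S)"
    using bij S(2) by (intro bij_betw_combine[where A = "{len}" and B = "{p}", simplified]
        bij_betw_cong[THEN iffD1, OF _ bij]) auto
  then have 1: "bij_betw (pos(len := p)) {..<Suc len} (insert p S)" by (simp add: lessThan_Suc)
  have 2: "\<exists>j<cnt grp (insert p S) (grp ((pos(len := p)) l)).
      (ptg(len := sb (grp p))) l = base + j * L + pat (grp ((pos(len := p)) l))" if "l < Suc len" for l
  proof (cases "l = len")
    case True
    then show ?thesis using sb p S by (auto simp: cnt_insert)
  next
    case False
    with that have "l < len" by simp
    from ptg[OF this] obtain j where "j < cnt grp S (grp (pos l))" "ptg l = base + j * L + pat (grp (pos l))" by blast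
    then show ?thesis using False S by (auto simp: cnt_insert intro!: exI[of _ j])
  qed
  \<comment> \<open>The new place lies in copy number \<open>cnt grp S (grp p)\<close>, later than
    every copy that the group has used so far.\<close>
  have new: "ptg l \<noteq> sb (grp p)" if "l < len" "grp (pos l) = grp p" for l
  proof -
    from ptg[OF that(1), unfolded that(2)] obtain j where
      j: "j < cnt grp S (grp p)" "ptg l = base + j * L + pat (grp p)" by blast
    have "j * L < cnt grp S (grp p) * L" using j(1) p by simp
    then show ?thesis using j(2) sb p by simp
  qed
  have 3: "inj_on (\<lambda>l. (grp ((pos(len := p)) l), (ptg(len := sb (grp p))) l)) {..<Suc len}"
  proof (rule inj_onI)
    fix l l' assume a: "l \<in> {..<Suc len}" "l' \<in> {..<Suc len}"
      "(grp ((pos(len := p)) l), (ptg(len := sb (grp p))) l) = (grp ((pos(len := p)) l'), (ptg(len := sb (grp p))) l')"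
    consider "l = len" "l' = len" | "l = len" "l' < len" | "l < len" "l' = len" | "l < len" "l' < len"
      using a by force
    then show "l = l'"
    proof cases
      case 2
      then have "grp (pos l') = grp p" "ptg l' = sb (grp p)" using a(3) by auto
      with new[of l'] 2 show ?thesis by blast
    next
      case 3
      then have "grp (pos l) = grp p" "ptg l = sb (grp p)" using a(3) by auto
      with new[of l] 3 show ?thesis by blast
    next
      case 4
      then show ?thesis using a(3) inj by (simp add: inj_on_def)
    qed simp
  qed
  show ?thesis
    unfolding layout_def
    using 1 2 3 len pit sb S by (auto simp: cnt_insert less_Suc_eq)
qed

section \<open>Analysis of the greedy order, on positions in the sorted list\<close>

locale ordering =
  fixes n L m best base :: nat and it B grp pat :: "nat \<Rightarrow> nat" and gs g s :: "nat \<Rightarrow> real" and \<delta> :: real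
  assumes n0: "0 < n" and L0: "0 < L" and \<delta>0: "0 < \<delta>"
    and grp: "\<And>p. p < n \<Longrightarrow> grp p < L"
    and gs: "\<And>k. k < L \<Longrightarrow> gs k = card {p. p < n \<and> grp p = k}"
    and gs_le: "\<And>k. k < L \<Longrightarrow> gs k \<le> m"
    and g_ge: "\<And>p. p < n \<Longrightarrow> s (it p) \<le> g (grp p)"
    and g0: "\<And>k. k < L \<Longrightarrow> 0 \<le> g k"
    and s_ge: "\<And>p. p < n \<Longrightarrow> \<delta> \<le> s (it p)"
    and inj_it: "inj_on it {..<n}"
    and packing: "is_packing s (it ` {..<n}) B"
    and feas: "feasible g L pat"
    and used_le: "used g L pat \<le> best" and best_le: "best \<le> L"
begin

definition bn :: "nat \<Rightarrow> nat" where "bn p = B (it p)"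
definition bins :: "nat set" where "bins = bn ` {..<n}"
definition N :: nat where "N = card bins"
definition R :: real where "R = sqrt (2 * n) / \<delta>"
definition c :: "nat \<Rightarrow> nat \<Rightarrow> real" where "c b k = card {p. p < n \<and> bn p = b \<and> grp p = k}"
definition inbins :: "nat set \<Rightarrow> nat set" where "inbins M = {p. p < n \<and> bn p \<in> M}"
text \<open>\<open>real m * best\<close> accounts for \<open>m\<close> copies of the pattern. On the
  way there, the 1 is for the old bin being emptied, and \<open>L * R\<close> is for
  \<open>R\<close> copies opened too early, with at most \<open>L\<close> bins each.\<close>

definition bound :: real where "bound = max (real N) (real m * best) + (1 + L * R)"

lemma fin_bins: "finite bins" by (simp add: bins_def)

lemma N0: "0 < N" using n0 fin_bins by (auto simp: N_def bins_def card_gt_0_iff)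

lemma N_le: "N \<le> n" using card_image_le[of "{..<n}" bn] by (simp add: N_def bins_def)

lemma inbins_bins: "inbins bins = {..<n}" by (auto simp: inbins_def bins_def)

lemma R0: "0 \<le> R" using \<delta>0 by (simp add: R_def)

lemma cnt_inbins: "finite M \<Longrightarrow> real (cnt grp (inbins M) k) = (\<Sum>b\<in>M. c b k)"
proof -
  assume M: "finite M"
  have "cnt grp (inbins M) k = card (\<Union>b\<in>M. {p. p < n \<and> bn p = b \<and> grp p = k})"
    unfolding cnt_def inbins_def by (rule arg_cong[where f = card]) auto
  also have "\<dots> = (\<Sum>b\<in>M. card {p. p < n \<and> bn p = b \<and> grp p = k})"
    using M by (intro card_UN_disjoint) auto
  finally show ?thesis by (simp add: c_def)
qed

lemma gs_sum: "k < L \<Longrightarrow> gs k = (\<Sum>b\<in>bins. c b k)"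
  using cnt_inbins[OF fin_bins, of k] by (simp add: inbins_bins gs cnt_def)

lemma c_sum: "b \<in> bins \<Longrightarrow> (\<Sum>k<L. c b k) \<le> 1 / \<delta>"
proof -
  assume b: "b \<in> bins"
  have "(\<Sum>k<L. card {p. p < n \<and> bn p = b \<and> grp p = k}) = card (\<Union>k<L. {p. p < n \<and> bn p = b \<and> grp p = k})"
    by (intro card_UN_disjoint[symmetric]) auto
  also have "\<dots> \<le> card {p. p < n \<and> bn p = b}" by (intro card_mono) auto
  also have "\<dots> = card (it ` {p. p < n \<and> bn p = b})"
    using inj_it by (intro card_image[symmetric]) (auto intro: inj_on_subset)
  also have "it ` {p. p < n \<and> bn p = b} = {i \<in> it ` {..<n}. B i = b}" by (auto simp: bn_def)
  finally have "(\<Sum>k<L. c b k) \<le> card {i \<in> it ` {..<n}. B i = b}"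
    unfolding c_def by (simp flip: of_nat_sum)
  also have "\<dots> \<le> 1 / \<delta>" using packing_bin_card[OF packing, of \<delta> b] s_ge \<delta>0 by auto
  finally show ?thesis .
qed

text \<open>The program never builds the count vector of a bin: adding up the deviations of the
  groups of its items yields the inner product directly.\<close>

lemma score_eq: "(\<Sum>p\<in>{p. p < n \<and> bn p = b}. D (grp p)) = (\<Sum>k<L. c b k * D k)"
proof -
  have "(\<Sum>k<L. c b k * D k) = (\<Sum>k<L. \<Sum>p\<in>{p \<in> {p. p < n \<and> bn p = b}. grp p = k}. D (grp p))"
    by (intro sum.cong) (auto simp: c_def)
  also have "\<dots> = (\<Sum>p\<in>{p. p < n \<and> bn p = b}. D (grp p))"
    by (rule sum.group) (auto simp: grp)
  finally show ?thesis by simp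
qed

text \<open>A bin holds at most \<open>1 / \<delta>\<close> items and at most \<open>N <= n\<close>
  bins are taken, so \<open>balance_step\<close> keeps the deviation of every group within
  \<open>R\<close>. The third conclusion is the use made of it: about
  \<open>Suc x * (real m / N)\<close> copies of the pattern suffice for the items of the first
  \<open>Suc x\<close> bins.\<close>

lemma select_step:
  assumes M: "M \<subseteq> bins" "card M = x" and b: "b \<in> bins - M"
    and min: "\<And>b'. b' \<in> bins - M \<Longrightarrow> (\<Sum>k<L. c b k * D k) \<le> (\<Sum>k<L. c b' k * D k)"
    and D: "\<And>k. k < L \<Longrightarrow> D k = cnt grp (inbins M) k - x * (gs k / N)"
    and sq: "(\<Sum>k<L. (D k)\<^sup>2) \<le> x * (2 * (1 / \<delta>)\<^sup>2)"
    and D': "\<And>k. k < L \<Longrightarrow> D' k = D k + c b k - gs k / N"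
  shows "\<And>k. k < L \<Longrightarrow> D' k = cnt grp (inbins (insert b M)) k - Suc x * (gs k / N)"
    "(\<Sum>k<L. (D' k)\<^sup>2) \<le> Suc x * (2 * (1 / \<delta>)\<^sup>2)"
    "\<And>k. k < L \<Longrightarrow> cnt grp (inbins (insert b M)) k \<le> Suc x * (real m / N) + R"
    "Suc x \<le> N"
proof -
  have fM: "finite M" using M fin_bins finite_subset by blast
  have "(\<Sum>k<L. (D k + c b k - gs k / card bins)\<^sup>2) \<le> (\<Sum>k<L. (D k)\<^sup>2) + 2 * (1 / \<delta>)\<^sup>2"
    using M c_sum cnt_inbins[OF fM] D
    by (intro balance_step[where c = c and D = D and G = gs and L = L, OF fin_bins M(1) b min]) (auto simp: gs_sum c_def N_def)
  then have *: "(\<Sum>k<L. (D' k)\<^sup>2) \<le> (\<Sum>k<L. (D k)\<^sup>2) + 2 * (1 / \<delta>)\<^sup>2"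
    using D' by (simp add: N_def)
  then show sq': "(\<Sum>k<L. (D' k)\<^sup>2) \<le> Suc x * (2 * (1 / \<delta>)\<^sup>2)"
    using sq by (simp add: algebra_simps)
  show D'': "D' k = cnt grp (inbins (insert b M)) k - Suc x * (gs k / N)" if "k < L" for k
    using cnt_inbins[of "insert b M" k] cnt_inbins[OF fM, of k] fM b D[OF that] D'[OF that]
    by (simp add: algebra_simps add_divide_distrib)
  have "card (insert b M) \<le> card bins" using M b fin_bins by (intro card_mono) auto
  then show xN: "Suc x \<le> N" using M b fM by (simp add: N_def)
  show "cnt grp (inbins (insert b M)) k \<le> Suc x * (real m / N) + R" if "k < L" for k
  proof -
    have "(D' k)\<^sup>2 \<le> (\<Sum>k<L. (D' k)\<^sup>2)" using that by (intro member_le_sum) auto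
    also have "\<dots> \<le> n * (2 * (1 / \<delta>)\<^sup>2)"
      using xN N_le by (intro order.trans[OF sq' mult_right_mono]) auto
    also have "\<dots> = R\<^sup>2" by (simp add: R_def power_divide)
    finally have "\<bar>D' k\<bar> \<le> R" using R0 by (simp add: abs_le_square_iff[symmetric])
    moreover have "Suc x * (gs k / N) \<le> Suc x * (real m / N)"
      using gs_le[OF that] by (intro mult_left_mono divide_right_mono) auto
    ultimately show ?thesis using D''[OF that] by linarith
  qed
qed

text \<open>If no group has more than \<open>X\<close> items, only the first \<open>X\<close> copies
  of the pattern are entered, and in each of them only bins of positive load, since an item never
  exceeds its slot and has positive size. Counts being integers, \<open>X\<close> may be rounded
  down.\<close>

lemma targets_card:
  fixes X :: real
  assumes lay: "layout L it grp pat base S len pos pit ptg sb" and S: "S \<subseteq> {..<n}"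
    and X: "\<And>k. k < L \<Longrightarrow> cnt grp S k \<le> X" "0 \<le> X"
  shows "card (ptg ` {..<len}) \<le> X * best"
proof -
  define J where "J = nat \<lfloor>X\<rfloor>"
  have J: "cnt grp S k \<le> J" if "k < L" for k using X(1)[OF that] unfolding J_def by (simp add: le_nat_floor)
  let ?U = "{b. b < L \<and> 0 < load g L pat b}"
  have "ptg ` {..<len} \<subseteq> (\<lambda>(j, b). base + j * L + b) ` ({..<J} \<times> ?U)"
  proof (rule image_subsetI)
    fix l assume "l \<in> {..<len}"
    then have l: "pos l < n" using lay S by (auto simp: layout_def bij_betw_def)
    from lay \<open>l \<in> {..<len}\<close> obtain j where j: "j < cnt grp S (grp (pos l))"
      "ptg l = base + j * L + pat (grp (pos l))" by (auto simp: layout_def)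
    have k: "grp (pos l) < L" using grp l by simp
    have "0 < g (grp (pos l))" using g_ge[OF l] s_ge[OF l] \<delta>0 by simp
    also have "\<dots> \<le> load g L pat (pat (grp (pos l)))"
      unfolding load_def using k g0 by (intro member_le_sum) auto
    finally have "pat (grp (pos l)) \<in> ?U" using feas k by (simp add: feasible_def)
    moreover have "j < J" using j J[OF k] by simp
    ultimately show "ptg l \<in> (\<lambda>(j, b). base + j * L + b) ` ({..<J} \<times> ?U)"
      using j by (intro image_eqI[of _ _ "(j, pat (grp (pos l)))"]) auto
  qed
  then have "card (ptg ` {..<len}) \<le> card ({..<J} \<times> ?U)" by (rule surj_card_le[rotated]) simp
  also have "\<dots> = J * used g L pat" by (simp add: used_def card_cartesian_product)
  also have "\<dots> \<le> J * best" using used_le by simp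
  finally have "real (card (ptg ` {..<len})) \<le> real J * best" by (simp flip: of_nat_mult)
  also have "\<dots> \<le> X * best" using X(2) by (intro mult_right_mono) (auto simp: J_def)
  finally show ?thesis .
qed

text \<open>While bin \<open>b\<close> is being emptied, \<open>x\<close> old bins are gone and
  places have been assigned to the items of \<open>Suc x\<close> bins. With
  \<open>a = Suc x / N\<close>, new and old bins number about
  \<open>a * (real m * best) + (1 - a) * N\<close>, a convex combination and thus at most the
  maximum. To this come \<open>b\<close> itself and the deviation.\<close>

lemma prefix_bound:
  assumes M: "M \<subseteq> bins" "card M = x" "Suc x \<le> N" and b: "b \<in> bins - M"
    and lay: "layout L it grp pat base (inbins (insert b M)) len pos pit ptg sb"
    and cn: "\<And>k. k < L \<Longrightarrow> cnt grp (inbins (insert b M)) k \<le> Suc x * (real m / N) + R"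
    and l: "l \<le> len" "inbins M \<subseteq> pos ` {..<l}"
  shows "card (ptg ` {..<l}) + card (bn ` ({..<n} - pos ` {..<l})) \<le> bound"
proof -
  have fM: "finite M" using M fin_bins finite_subset by blast
  have "card (bn ` ({..<n} - pos ` {..<l})) \<le> card (bins - M)"
    using l fin_bins by (intro card_mono) (auto simp: inbins_def bins_def)
  also have "\<dots> = N - x" using M fM by (simp add: card_Diff_subset N_def)
  finally have 1: "real (card (bn ` ({..<n} - pos ` {..<l}))) \<le> real N - x" using M(3) by simp
  have "card (ptg ` {..<l}) \<le> card (ptg ` {..<len})" using l by (intro card_mono) auto
  also have "\<dots> \<le> (Suc x * (real m / N) + R) * best"
    using R0 by (intro targets_card[OF lay _ cn]) (auto simp: inbins_def)
  also have "\<dots> \<le> Suc x / N * (real m * best) + L * R"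
    using mult_right_mono[of "real best" "real L" R] best_le R0 by (simp add: algebra_simps)
  finally have 2: "card (ptg ` {..<l}) \<le> Suc x / N * (real m * best) + L * R" by simp
  define a where "a = Suc x / N"
  define Z where "Z = max (real N) (real m * best)"
  have a: "a * N = Suc x" "0 \<le> a" "a \<le> 1" using N0 M(3) by (auto simp: a_def)
  have "a * (real m * best) \<le> a * Z" using a by (intro mult_left_mono) (auto simp: Z_def)
  moreover have "(1 - a) * N \<le> (1 - a) * Z" using a by (intro mult_left_mono) (auto simp: Z_def)
  ultimately have "a * (real m * best) + (real N - Suc x) \<le> Z" using a(1) by (simp add: algebra_simps)
  then show ?thesis using 1 2 by (simp add: bound_def a_def Z_def)
qed

definition order_inv :: "nat \<Rightarrow> nat set \<Rightarrow> nat \<Rightarrow> (nat \<Rightarrow> nat) \<Rightarrow> (nat \<Rightarrow> nat) \<Rightarrow> (nat \<Rightarrow> nat) \<Rightarrow> (nat \<Rightarrow> nat) \<Rightarrow>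
    (nat \<Rightarrow> real) \<Rightarrow> bool" where
  "order_inv x M len pos pit ptg sb D \<longleftrightarrow> M \<subseteq> bins \<and> card M = x \<and>
     layout L it grp pat base (inbins M) len pos pit ptg sb \<and>
     (\<forall>k<L. D k = cnt grp (inbins M) k - x * (gs k / N)) \<and>
     (\<Sum>k<L. (D k)\<^sup>2) \<le> x * (2 * (1 / \<delta>)\<^sup>2) \<and>
     (\<forall>l\<le>len. card (ptg ` {..<l}) + card (bn ` ({..<n} - pos ` {..<l})) \<le> bound)"

lemma order_inv_start:
  assumes "\<And>k. k < L \<Longrightarrow> sb k = base + pat k" "\<And>k. k < L \<Longrightarrow> D k = 0"
  shows "order_inv 0 {} 0 pos pit ptg sb D"
proof -
  have "card (bn ` {..<n}) \<le> bound" 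
    using mult_nonneg_nonneg[of "real L" R] R0 unfolding bound_def N_def bins_def by linarith
  then show ?thesis using assms by (simp add: order_inv_def layout_def inbins_def cnt_def bij_betw_def)
qed

text \<open>Prefixes of the earlier moves are unchanged, and a longer prefix empties all bins of
  \<open>M\<close>, so \<open>prefix_bound\<close> applies to it.\<close>

lemma order_inv_step:
  assumes inv: "order_inv x M len pos pit ptg sb D" and b: "b \<in> bins - M"
    and min: "\<And>b'. b' \<in> bins - M \<Longrightarrow> (\<Sum>k<L. c b k * D k) \<le> (\<Sum>k<L. c b' k * D k)"
    and lay: "layout L it grp pat base (inbins (insert b M)) len' pos' pit' ptg' sb'"
    and old: "\<And>l. l < len \<Longrightarrow> pos' l = pos l \<and> ptg' l = ptg l"
    and D': "\<And>k. k < L \<Longrightarrow> D' k = D k + c b k - gs k / N"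
  shows "order_inv (Suc x) (insert b M) len' pos' pit' ptg' sb' D'"
proof -
  have M: "M \<subseteq> bins" "card M = x" and D: "\<And>k. k < L \<Longrightarrow> D k = cnt grp (inbins M) k - x * (gs k / N)"
    and sq: "(\<Sum>k<L. (D k)\<^sup>2) \<le> x * (2 * (1 / \<delta>)\<^sup>2)"
    and lay0: "layout L it grp pat base (inbins M) len pos pit ptg sb"
    and bd: "\<And>l. l \<le> len \<Longrightarrow> card (ptg ` {..<l}) + card (bn ` ({..<n} - pos ` {..<l})) \<le> bound"
    using inv by (auto simp: order_inv_def)
  note st = select_step[OF M b min D sq D']
  have fM: "finite M" using M fin_bins finite_subset by blast
  have "card (ptg' ` {..<l}) + card (bn ` ({..<n} - pos' ` {..<l})) \<le> bound" if l: "l \<le> len'" for l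
  proof (cases "l \<le> len")
    case True
    then have "ptg' ` {..<l} = ptg ` {..<l}" "pos' ` {..<l} = pos ` {..<l}"
      using old by (auto intro!: image_cong)
    then show ?thesis using bd[OF True] by simp
  next
    case False
    have "inbins M = pos ` {..<len}" using lay0 by (auto simp: layout_def bij_betw_def)
    also have "\<dots> = pos' ` {..<len}" using old by (auto intro!: image_cong)
    also have "\<dots> \<subseteq> pos' ` {..<l}" using False by (intro image_mono) auto
    finally show ?thesis using prefix_bound[OF M st(4) b lay st(3) l] by blast
  qed
  then show ?thesis
    using M b fM lay st(1,2) unfolding order_inv_def by auto
qed

text \<open>After \<open>N\<close> rounds all bins have been taken. A target is one bin of one copy
  of the pattern and receives at most one item per group, no larger than the slot of the group, so
  its load is at most the load of that bin in the pattern.\<close>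

lemma order_inv_plan:
  fixes v :: real
  assumes inv: "order_inv N M len pos pit ptg sb D"
    and sz: "\<And>p. p < n \<Longrightarrow> s (it p) \<le> 1" and base: "\<And>p. p < n \<Longrightarrow> B (it p) < base"
    and sl: "real m * best \<le> OPT s (it ` {..<n}) + v" "slack \<delta> n v (1 + L * R)" and m: "m \<le> n"
  shows "len = n \<and> plan s \<delta> (it ` {..<n}) B base (base + n * L) len pit ptg (real m * best) (1 + L * R)"
proof -
  have "M = bins" using inv fin_bins by (intro card_subset_eq) (auto simp: order_inv_def N_def)
  then have lay: "layout L it grp pat base {..<n} len pos pit ptg sb"
    and bd: "\<And>l. l \<le> len \<Longrightarrow> card (ptg ` {..<l}) + card (bn ` ({..<n} - pos ` {..<l})) \<le> bound"
    using inv by (auto simp: order_inv_def inbins_bins)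
  then have len: "len = n" and pos: "bij_betw pos {..<n} {..<n}" and pit: "\<And>l. l < n \<Longrightarrow> pit l = it (pos l)"
    and ptg: "\<And>l. l < n \<Longrightarrow> \<exists>j<cnt grp {..<n} (grp (pos l)). ptg l = base + j * L + pat (grp (pos l))"
    and inj: "inj_on (\<lambda>l. (grp (pos l), ptg l)) {..<n}"
    by (auto simp: layout_def)
  have posn: "pos l < n" if "l < n" for l using pos that by (auto simp: bij_betw_def)
  have "bij_betw (it \<circ> pos) {..<n} (it ` {..<n})"
    using pos inj_it by (intro bij_betw_trans) (auto simp: bij_betw_def)
  then have bij: "bij_betw pit {..<n} (it ` {..<n})"
    using pit by (subst bij_betw_cong[of _ pit "it \<circ> pos"]) auto
  have cm: "cnt grp {..<n} k \<le> m" if "k < L" for k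
    using gs[OF that] gs_le[OF that] by (simp add: cnt_def)
  \<comment> \<open>No group has more than \<open>m\<close> items, so at most \<open>m <= n\<close>
    copies are entered and \<open>n * L\<close> names suffice.\<close>
  have rng: "base \<le> ptg l \<and> ptg l < base + n * L" if l: "l < n" for l
  proof -
    from ptg[OF l] obtain j where j: "j < cnt grp {..<n} (grp (pos l))" "ptg l = base + j * L + pat (grp (pos l))" by blast
    have k: "grp (pos l) < L" using grp posn l by simp
    have "pat (grp (pos l)) < L" using feas k by (simp add: feasible_def)
    moreover have "Suc j * L \<le> n * L" using j(1) cm[OF k] m by (intro mult_right_mono) auto
    ultimately show ?thesis using j(2) by simp
  qed
  have feas': "(\<Sum>l\<in>{l. l < n \<and> ptg l = b}. s (pit l)) \<le> 1" for b
  proof -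
    let ?T = "{l. l < n \<and> ptg l = b}"
    \<comment> \<open>\<open>r\<close> is the bin of the pattern that \<open>b\<close> is a copy
      of.\<close>
    define r where "r = (b - base) mod L"
    have r: "r < L" using L0 by (simp add: r_def)
    have T: "grp (pos l) < L \<and> pat (grp (pos l)) = r" if "l \<in> ?T" for l
    proof -
      from that ptg[of l] obtain j where "b = base + j * L + pat (grp (pos l))" by auto
      moreover have "grp (pos l) < L" using that grp posn by simp
      moreover from this have "pat (grp (pos l)) < L" using feas by (simp add: feasible_def)
      ultimately show ?thesis by (simp add: r_def)
    qed
    have inj': "inj_on (\<lambda>l. grp (pos l)) ?T"
      using inj by (auto simp: inj_on_def)
    have "(\<Sum>l\<in>?T. s (pit l)) \<le> (\<Sum>l\<in>?T. g (grp (pos l)))"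
      using g_ge posn pit by (intro sum_mono) auto
    also have "\<dots> = (\<Sum>k\<in>(\<lambda>l. grp (pos l)) ` ?T. g k)" using inj' by (simp add: sum.reindex)
    also have "\<dots> \<le> load g L pat r"
      unfolding load_def using T g0 by (intro sum_mono2) auto
    also have "\<dots> \<le> 1" using feas r by (simp add: feasible_def)
    finally show ?thesis .
  qed
  have rest: "B ` pit ` {l..<n} = bn ` ({..<n} - pos ` {..<l})" if "l \<le> n" for l
  proof -
    have "{..<n} - pos ` {..<l} = pos ` ({..<n} - {..<l})"
      using pos that by (subst inj_on_image_set_diff[of pos "{..<n}"]) (auto simp: bij_betw_def)
    also have "{..<n} - {..<l} = {l..<n}" by auto
    finally have eq: "{..<n} - pos ` {..<l} = pos ` {l..<n}" .
    show ?thesis unfolding eq image_image bn_def using pit by (intro image_cong) auto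
  qed
  have nb: "num_bins (it ` {..<n}) B = N" by (simp add: num_bins_def N_def bins_def bn_def image_image)
  have "card (ptg ` {..<n}) \<le> real m * best"
    using targets_card[OF lay, of "real m"] cm len by simp
  then show ?thesis
    unfolding plan_def using len bij packing base rng feas' bd rest s_ge sz sl
    by (auto simp: nb bound_def)
qed

end

section \<open>Programs for the greedy order\<close>

abbreviation binof where "binof e \<equiv> NCell ''bin'' (NCell ''it'' e)"

text \<open>Advancing \<open>nb\<close> reserves the names of all targets, so items inserted later
  get bins beyond them.\<close>

definition slots_prog :: com where
  "slots_prog = For ''k'' (nv ''L'') (NAssign ''sb'' (nv ''k'') (NAdd (nv ''nb'') (NCell ''pat'' (nv ''k'')))) ;;
     For ''p'' (nv ''n'') (nset ''nb'' (NAdd (nv ''nb'') (nv ''L'')))"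

lemma wp_slots:
  assumes st: "nats \<sigma> ''L'' 0 = L" "nats \<sigma> ''n'' 0 = n" "nats \<sigma> ''nb'' 0 = base" "nats \<sigma> ''pat'' = pat"
    and W: "L \<le> W" "n \<le> W"
    and post: "\<And>\<tau>. agree slots_prog \<sigma> \<tau> \<Longrightarrow> (\<And>k. k < L \<Longrightarrow> nats \<tau> ''sb'' k = base + pat k) \<Longrightarrow>
      nats \<tau> ''nb'' 0 = base + n * L \<Longrightarrow> Q \<tau>"
  shows "wp W slots_prog Q \<sigma>"
proof (rule wp_mono)
  show "wp W slots_prog (\<lambda>\<tau>. (\<forall>k<L. nats \<tau> ''sb'' k = base + pat k) \<and> nats \<tau> ''nb'' 0 = base + n * L) \<sigma>"
    unfolding slots_prog_def wp_basic
  proof (rule wp_For[where N = L and Inv = "\<lambda>k \<tau>. \<forall>k'<k. nats \<tau> ''sb'' k' = base + pat k'"], goal_cases)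
    case (6 \<tau>)
    then have st': "nats \<tau> ''L'' 0 = L" "nats \<tau> ''n'' 0 = n" "nats \<tau> ''nb'' 0 = base"
      using st by (auto simp: agree_def)
    show ?case
      by (rule wp_For[where N = n and Inv = "\<lambda>p \<upsilon>. nats \<upsilon> ''nb'' 0 = base + p * L"])
        (use W st' 6 in \<open>auto simp: agree_def\<close>)
  qed (use W st in \<open>auto simp: agree_def less_Suc_eq\<close>)
qed (use post in auto)

text \<open>Bin names grow without bound over time, so marks are reset by a pass over the items and
  not over the names.\<close>

definition unmark_prog :: com where
  "unmark_prog = For ''p'' (nv ''n'') (NAssign ''mark'' (binof (nv ''p'')) (NNum 0))"

lemma wp_unmark:
  assumes st: "nats \<sigma> ''n'' 0 = n" "nats \<sigma> ''bin'' = B" "nats \<sigma> ''it'' = it" and W: "n \<le> W"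
    and post: "\<And>\<tau>. agree unmark_prog \<sigma> \<tau> \<Longrightarrow> (\<And>p. p < n \<Longrightarrow> nats \<tau> ''mark'' (B (it p)) = 0) \<Longrightarrow> Q \<tau>"
  shows "wp W unmark_prog Q \<sigma>"
proof (rule wp_mono)
  show "wp W unmark_prog (\<lambda>\<tau>. \<forall>p<n. nats \<tau> ''mark'' (B (it p)) = 0) \<sigma>"
    unfolding unmark_prog_def
    by (rule wp_For[where N = n and Inv = "\<lambda>p \<tau>. \<forall>q<p. nats \<tau> ''mark'' (B (it q)) = 0"])
      (use W st in \<open>auto simp: agree_def less_Suc_eq\<close>)
qed (use post in auto)

text \<open>The bins are counted twice, as \<open>NN\<close> to bound a loop and as
  \<open>NR\<close> to divide by, because the machine cannot convert one into the other.\<close>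

definition count_bins_prog :: com where
  "count_bins_prog = nset ''NN'' (NNum 0) ;; rset ''NR'' (RNum 0) ;;
     For ''p'' (nv ''n'')
      (Cond (NLess (NCell ''mark'' (binof (nv ''p''))) (NNum 1))
        (NAssign ''mark'' (binof (nv ''p'')) (NNum 1) ;; ninc ''NN'' ;; rset ''NR'' (RAdd (rv ''NR'') (RNum 1)))
        Skip)"

lemma wp_count_bins:
  assumes st: "nats \<sigma> ''n'' 0 = n" "nats \<sigma> ''bin'' = B" "nats \<sigma> ''it'' = it"
    and mk: "\<And>p. p < n \<Longrightarrow> nats \<sigma> ''mark'' (B (it p)) = 0" and W: "n \<le> W"
    and post: "\<And>\<tau>. agree count_bins_prog \<sigma> \<tau> \<Longrightarrow> nats \<tau> ''NN'' 0 = card ((\<lambda>p. B (it p)) ` {..<n}) \<Longrightarrow>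
      reals \<tau> ''NR'' 0 = real (card ((\<lambda>p. B (it p)) ` {..<n})) \<Longrightarrow> Q \<tau>"
  shows "wp W count_bins_prog Q \<sigma>"
proof (rule wp_mono)
  define S where "S p = (\<lambda>p. B (it p)) ` {..<p}" for p
  have S: "S 0 = {}" "\<And>p. S (Suc p) = insert (B (it p)) (S p)" "\<And>p. finite (S p)"
    by (auto simp: S_def lessThan_Suc)
  show "wp W count_bins_prog (\<lambda>\<tau>. nats \<tau> ''NN'' 0 = card (S n) \<and> reals \<tau> ''NR'' 0 = real (card (S n))) \<sigma>"
    unfolding count_bins_prog_def wp_basic
  proof (rule wp_For[where N = n and Inv = "\<lambda>p \<tau>. nats \<tau> ''NN'' 0 = card (S p) \<and>
        reals \<tau> ''NR'' 0 = real (card (S p)) \<and>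
        (\<forall>q<n. nats \<tau> ''mark'' (B (it q)) = (if B (it q) \<in> S p then 1 else 0))"], goal_cases)
    case (5 p \<tau>)
    have st': "nats \<tau> ''bin'' = B" "nats \<tau> ''it'' = it" "nats \<tau> ''p'' 0 = p"
      using 5 st by (auto simp: agree_def)
    show ?case
    proof (cases "B (it p) \<in> S p")
      case True
      then show ?thesis using 5 st' S by (auto simp: insert_absorb)
    next
      case False
      then show ?thesis using 5 st' S by auto
    qed
  qed (use W st mk S in \<open>auto simp: agree_def\<close>)
qed (use post in auto)

definition score_prog :: com where
  "score_prog = For ''p'' (nv ''n'') (RAssign ''score'' (binof (nv ''p'')) (RNum 0)) ;;
     For ''p'' (nv ''n'') (RAssign ''score'' (binof (nv ''p''))
       (RAdd (RCell ''score'' (binof (nv ''p''))) (RCell ''D'' (NCell ''grp'' (nv ''p'')))))"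

lemma wp_score:
  assumes st: "nats \<sigma> ''n'' 0 = n" "nats \<sigma> ''bin'' = B" "nats \<sigma> ''it'' = it" "nats \<sigma> ''grp'' = grp" "reals \<sigma> ''D'' = D"
    and W: "n \<le> W"
    and post: "\<And>\<tau>. agree score_prog \<sigma> \<tau> \<Longrightarrow> (\<And>p. p < n \<Longrightarrow>
      reals \<tau> ''score'' (B (it p)) = (\<Sum>q\<in>{q. q < n \<and> B (it q) = B (it p)}. D (grp q))) \<Longrightarrow> Q \<tau>"
  shows "wp W score_prog Q \<sigma>"
proof (rule wp_mono)
  define S where "S q b = (\<Sum>q\<in>{q'. q' < q \<and> B (it q') = b}. D (grp q))" for q b
  have S: "S 0 b = 0" "S (Suc q) b = S q b + (if B (it q) = b then D (grp q) else 0)" for q b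
  proof -
    have "{q'. q' < Suc q \<and> B (it q') = b} =
        (if B (it q) = b then insert q {q'. q' < q \<and> B (it q') = b} else {q'. q' < q \<and> B (it q') = b})"
      by (auto simp: less_Suc_eq)
    then show "S (Suc q) b = S q b + (if B (it q) = b then D (grp q) else 0)" by (simp add: S_def)
  qed (simp add: S_def)
  show "wp W score_prog (\<lambda>\<tau>. \<forall>p<n. reals \<tau> ''score'' (B (it p)) = S n (B (it p))) \<sigma>"
    unfolding score_prog_def wp_basic
  proof (rule wp_For[where N = n and Inv = "\<lambda>p \<tau>. \<forall>q<p. reals \<tau> ''score'' (B (it q)) = 0"], goal_cases)
    case (6 \<tau>)
    then have st': "nats \<tau> ''n'' 0 = n" "nats \<tau> ''bin'' = B" "nats \<tau> ''it'' = it" "nats \<tau> ''grp'' = grp" "reals \<tau> ''D'' = D"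
      using st by (auto simp: agree_def)
    show ?case
      by (rule wp_For[where N = n and Inv = "\<lambda>q \<tau>. \<forall>p<n. reals \<tau> ''score'' (B (it p)) = S q (B (it p))"])
        (use W st' 6 S in \<open>auto simp: agree_def\<close>)
  qed (use W st in \<open>auto simp: agree_def less_Suc_eq\<close>)
  show "Q \<tau>" if "agree score_prog \<sigma> \<tau>" "\<forall>p<n. reals \<tau> ''score'' (B (it p)) = S n (B (it p))" for \<tau>
    using that by (intro post) (auto simp: S_def)
qed

text \<open>\<open>sel\<close> is the position of some item in the best bin so far; the value
  \<open>n\<close> says that no unmarked bin has been met yet.\<close>

definition select_prog :: com where
  "select_prog = nset ''sel'' (nv ''n'') ;;
     For ''p'' (nv ''n'')
      (Cond (NLess (NCell ''mark'' (binof (nv ''p''))) (NNum 1))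
        (Cond (NLess (nv ''sel'') (nv ''n''))
          (Cond (RLess (RCell ''score'' (binof (nv ''p''))) (RCell ''score'' (binof (nv ''sel''))))
            (nset ''sel'' (nv ''p'')) Skip)
          (nset ''sel'' (nv ''p'')))
        Skip)"

lemma wp_select:
  assumes st: "nats \<sigma> ''n'' 0 = n" "nats \<sigma> ''bin'' = B" "nats \<sigma> ''it'' = it" "nats \<sigma> ''mark'' = mark"
      "reals \<sigma> ''score'' = score"
    and ex: "\<exists>p<n. mark (B (it p)) = 0" and W: "n \<le> W"
    and post: "\<And>\<tau> sel. agree select_prog \<sigma> \<tau> \<Longrightarrow> nats \<tau> ''sel'' 0 = sel \<Longrightarrow> sel < n \<Longrightarrow> mark (B (it sel)) = 0 \<Longrightarrow>
      (\<And>p. p < n \<Longrightarrow> mark (B (it p)) = 0 \<Longrightarrow> score (B (it sel)) \<le> score (B (it p))) \<Longrightarrow> Q \<tau>"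
  shows "wp W select_prog Q \<sigma>"
proof (rule wp_mono)
  define R where "R q sel \<longleftrightarrow> (sel = n \<and> (\<forall>p<q. mark (B (it p)) \<noteq> 0)) \<or>
    (sel < n \<and> mark (B (it sel)) = 0 \<and> (\<forall>p<q. mark (B (it p)) = 0 \<longrightarrow> score (B (it sel)) \<le> score (B (it p))))" for q sel
  show "wp W select_prog (\<lambda>\<tau>. R n (nats \<tau> ''sel'' 0)) \<sigma>"
    unfolding select_prog_def wp_basic
  proof (rule wp_For[where N = n and Inv = "\<lambda>q \<tau>. R q (nats \<tau> ''sel'' 0)"], goal_cases)
    case (5 p \<tau>)
    have "nats \<tau> ''n'' 0 = n" "nats \<tau> ''bin'' = B" "nats \<tau> ''it'' = it" "nats \<tau> ''mark'' = mark"
      "reals \<tau> ''score'' = score" "nats \<tau> ''p'' 0 = p"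
      using 5 st by (auto simp: agree_def)
    with 5 show ?case by (auto simp: R_def less_Suc_eq)
  qed (use W st in \<open>auto simp: agree_def R_def\<close>)
  show "Q \<tau>" if "agree select_prog \<sigma> \<tau>" "R n (nats \<tau> ''sel'' 0)" for \<tau>
    using that ex by (intro post[OF that(1) refl]) (auto simp: R_def)
qed

text \<open>The array \<open>pos\<close> is never read; it records the plan in terms of positions for the proof.\<close>

definition take_prog :: com where
  "take_prog = nset ''bs'' (binof (nv ''sel'')) ;; NAssign ''mark'' (nv ''bs'') (NNum 1) ;;
     For ''p'' (nv ''n'')
      (Cond (neq (binof (nv ''p'')) (nv ''bs'')) Skip
        (NAssign ''pos'' (nv ''len'') (nv ''p'') ;;
         NAssign ''pit'' (nv ''len'') (NCell ''it'' (nv ''p'')) ;;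
         NAssign ''ptg'' (nv ''len'') (NCell ''sb'' (NCell ''grp'' (nv ''p''))) ;;
         NAssign ''sb'' (NCell ''grp'' (nv ''p'')) (NAdd (NCell ''sb'' (NCell ''grp'' (nv ''p''))) (nv ''L'')) ;;
         RAssign ''D'' (NCell ''grp'' (nv ''p'')) (RAdd (RCell ''D'' (NCell ''grp'' (nv ''p''))) (RNum 1)) ;;
         ninc ''len''))"

lemma wp_take:
  assumes st: "nats \<sigma> ''n'' 0 = n" "nats \<sigma> ''bin'' = B" "nats \<sigma> ''it'' = it" "nats \<sigma> ''mark'' = mark"
      "nats \<sigma> ''sel'' 0 = sel" "nats \<sigma> ''grp'' = grp" "nats \<sigma> ''L'' 0 = L"
    and lay: "layout L it grp pat base S (nats \<sigma> ''len'' 0) (nats \<sigma> ''pos'') (nats \<sigma> ''pit'') (nats \<sigma> ''ptg'') (nats \<sigma> ''sb'')"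
    and S: "finite S" "\<And>p. p \<in> S \<Longrightarrow> B (it p) \<noteq> B (it sel)" and grpL: "\<And>p. p < n \<Longrightarrow> grp p < L" and W: "n \<le> W"
    and post: "\<And>\<tau>. agree take_prog \<sigma> \<tau> \<Longrightarrow> nats \<tau> ''mark'' = mark(B (it sel) := 1) \<Longrightarrow>
      layout L it grp pat base (S \<union> {p. p < n \<and> B (it p) = B (it sel)})
        (nats \<tau> ''len'' 0) (nats \<tau> ''pos'') (nats \<tau> ''pit'') (nats \<tau> ''ptg'') (nats \<tau> ''sb'') \<Longrightarrow>
      (\<And>k. k < L \<Longrightarrow> reals \<tau> ''D'' k = reals \<sigma> ''D'' k + card {p. p < n \<and> B (it p) = B (it sel) \<and> grp p = k}) \<Longrightarrow>
      (\<And>l. l < nats \<sigma> ''len'' 0 \<Longrightarrow> nats \<tau> ''pos'' l = nats \<sigma> ''pos'' l \<and> nats \<tau> ''ptg'' l = nats \<sigma> ''ptg'' l) \<Longrightarrow> Q \<tau>"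
  shows "wp W take_prog Q \<sigma>"
proof (rule wp_mono)
  define len0 pos0 ptg0 D0 bs where d: "len0 = nats \<sigma> ''len'' 0" "pos0 = nats \<sigma> ''pos''" "ptg0 = nats \<sigma> ''ptg''"
    "D0 = reals \<sigma> ''D''" "bs = B (it sel)"
  define A where "A q = S \<union> {p. p < q \<and> B (it p) = bs}" for q
  define c where "c q k = card {p. p < q \<and> B (it p) = bs \<and> grp p = k}" for q k
  define R where "R q len pos pit ptg sb D \<longleftrightarrow> layout L it grp pat base (A q) len pos pit ptg sb \<and>
    (\<forall>k<L. D k = D0 k + real (c q k)) \<and> len0 \<le> len \<and> (\<forall>l<len0. pos l = pos0 l \<and> ptg l = ptg0 l)"
    for q len pos pit ptg sb D
  have A: "A 0 = S" "A (Suc q) = (if B (it q) = bs then insert q (A q) else A q)" "finite (A q)" for q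
    using S(1) by (auto simp: A_def less_Suc_eq)
  have notA: "q \<notin> A q" if "B (it q) = bs" for q using S(2) that by (auto simp: A_def d)
  have c: "c 0 k = 0" "c (Suc q) k = c q k + (if B (it q) = bs \<and> grp q = k then 1 else 0)" for q k
  proof -
    have "{p. p < Suc q \<and> B (it p) = bs \<and> grp p = k} = (if B (it q) = bs \<and> grp q = k
        then insert q {p. p < q \<and> B (it p) = bs \<and> grp p = k} else {p. p < q \<and> B (it p) = bs \<and> grp p = k})"
      by (auto simp: less_Suc_eq)
    then show "c (Suc q) k = c q k + (if B (it q) = bs \<and> grp q = k then 1 else 0)" by (simp add: c_def)
  qed (simp add: c_def)
  show "wp W take_prog (\<lambda>\<tau>. nats \<tau> ''mark'' = mark(bs := 1) \<and> R n (nats \<tau> ''len'' 0) (nats \<tau> ''pos'')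
      (nats \<tau> ''pit'') (nats \<tau> ''ptg'') (nats \<tau> ''sb'') (reals \<tau> ''D'')) \<sigma>"
    unfolding take_prog_def wp_basic
  proof (rule wp_For[where N = n and Inv = "\<lambda>q \<tau>. nats \<tau> ''mark'' = mark(bs := 1) \<and> R q (nats \<tau> ''len'' 0)
      (nats \<tau> ''pos'') (nats \<tau> ''pit'') (nats \<tau> ''ptg'') (nats \<tau> ''sb'') (reals \<tau> ''D'')"], goal_cases)
    case (5 q \<tau>)
    have st': "nats \<tau> ''bin'' = B" "nats \<tau> ''it'' = it" "nats \<tau> ''grp'' = grp" "nats \<tau> ''L'' 0 = L"
      "nats \<tau> ''p'' 0 = q" "nats \<tau> ''bs'' 0 = bs"
      using 5 st by (auto simp: agree_def d)
    define len pos pit ptg sb D where e: "len = nats \<tau> ''len'' 0" "pos = nats \<tau> ''pos''" "pit = nats \<tau> ''pit''"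
      "ptg = nats \<tau> ''ptg''" "sb = nats \<tau> ''sb''" "D = reals \<tau> ''D''"
    have R: "R q len pos pit ptg sb D" and mk: "nats \<tau> ''mark'' = mark(bs := 1)" using 5 by (auto simp: e)
    show ?case
    proof (cases "B (it q) = bs")
      case False
      then have "R (Suc q) len pos pit ptg sb D" using R by (auto simp: R_def A c)
      then show ?thesis using False st' mk by (auto simp: e)
    next
      case True
      have "layout L it grp pat base (insert q (A q)) (Suc len) (pos(len := q)) (pit(len := it q))
          (ptg(len := sb (grp q))) (sb(grp q := sb (grp q) + L))"
        using R A(3) notA[OF True] grpL[OF \<open>q < n\<close>] by (intro layout_step) (auto simp: R_def)
      then have "R (Suc q) (Suc len) (pos(len := q)) (pit(len := it q)) (ptg(len := sb (grp q)))
          (sb(grp q := sb (grp q) + L)) (D(grp q := D (grp q) + 1))"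
        using R True by (auto simp: R_def A c)
      then show ?thesis using True st' mk by (simp add: e)
    qed
  qed (use W st lay in \<open>auto simp: agree_def R_def A c d\<close>)
  show "Q \<tau>" if "agree take_prog \<sigma> \<tau>" "nats \<tau> ''mark'' = mark(bs := 1) \<and> R n (nats \<tau> ''len'' 0) (nats \<tau> ''pos'')
      (nats \<tau> ''pit'') (nats \<tau> ''ptg'') (nats \<tau> ''sb'') (reals \<tau> ''D'')" for \<tau>
    using that by (intro post) (auto simp: R_def A_def c_def d)
qed

definition discount_prog :: com where
  "discount_prog = For ''k'' (nv ''L'') (RAssign ''D'' (nv ''k'')
     (RSub (RCell ''D'' (nv ''k'')) (RDiv (RCell ''gs'' (nv ''k'')) (rv ''NR''))))"

lemma wp_discount:
  assumes st: "nats \<sigma> ''L'' 0 = L" "reals \<sigma> ''NR'' 0 = N" "reals \<sigma> ''gs'' = gs" "reals \<sigma> ''D'' = D" and W: "L \<le> W"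
    and post: "\<And>\<tau>. agree discount_prog \<sigma> \<tau> \<Longrightarrow> (\<And>k. k < L \<Longrightarrow> reals \<tau> ''D'' k = D k - gs k / N) \<Longrightarrow> Q \<tau>"
  shows "wp W discount_prog Q \<sigma>"
proof (rule wp_mono)
  show "wp W discount_prog (\<lambda>\<tau>. \<forall>k<L. reals \<tau> ''D'' k = D k - gs k / N) \<sigma>"
    unfolding discount_prog_def
    by (rule wp_For[where N = L and Inv = "\<lambda>a \<tau>. \<forall>k<L. reals \<tau> ''D'' k = (if k < a then D k - gs k / N else D k)"])
      (use W st in \<open>auto simp: agree_def less_Suc_eq\<close>)
qed (use post in auto)

definition round_prog :: com where
  "round_prog = score_prog ;; select_prog ;; take_prog ;; discount_prog"

text \<open>Counting leaves the marks set, hence the second \<open>unmark_prog\<close>; from then on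
  a mark means that the bin has been taken.\<close>

definition order_prog :: com where
  "order_prog = slots_prog ;; unmark_prog ;; count_bins_prog ;; unmark_prog ;;
     nset ''len'' (NNum 0) ;; nset ''ptr'' (NNum 0) ;; For ''x'' (nv ''NN'') round_prog"

lemma nw_order [simp]: "nw slots_prog = {''k'', ''sb'', ''p'', ''nb''}" "nw unmark_prog = {''p'', ''mark''}"
    "nw count_bins_prog = {''NN'', ''p'', ''mark''}" "nw score_prog = {''p''}" "nw select_prog = {''sel'', ''p''}"
    "nw take_prog = {''bs'', ''mark'', ''p'', ''pos'', ''pit'', ''ptg'', ''sb'', ''len''}" "nw discount_prog = {''k''}"
  and rw_order [simp]: "rw slots_prog = {}" "rw unmark_prog = {}" "rw count_bins_prog = {''NR''}"
    "rw score_prog = {''score''}" "rw select_prog = {}" "rw take_prog = {''D''}" "rw discount_prog = {''D''}"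
  by (auto simp: slots_prog_def unmark_prog_def count_bins_prog_def score_prog_def select_prog_def take_prog_def
      discount_prog_def)

lemma nw_round [simp]: "nw round_prog = {''p'', ''sel'', ''bs'', ''mark'', ''pos'', ''pit'', ''ptg'', ''sb'', ''len'', ''k''}"
  and rw_round [simp]: "rw round_prog = {''score'', ''D''}"
  by (auto simp: round_prog_def)

context ordering
begin

lemma wp_round:
  assumes st: "nats \<sigma> ''n'' 0 = n" "nats \<sigma> ''bin'' = B" "nats \<sigma> ''it'' = it" "nats \<sigma> ''grp'' = grp"
      "nats \<sigma> ''L'' 0 = L" "reals \<sigma> ''gs'' = gs" "reals \<sigma> ''NR'' 0 = N"
    and inv: "order_inv x {b \<in> bins. nats \<sigma> ''mark'' b \<noteq> 0} (nats \<sigma> ''len'' 0) (nats \<sigma> ''pos'')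
        (nats \<sigma> ''pit'') (nats \<sigma> ''ptg'') (nats \<sigma> ''sb'') (reals \<sigma> ''D'')"
    and x: "x < N" and W: "n \<le> W" "L \<le> W"
    and post: "\<And>\<tau>. agree round_prog \<sigma> \<tau> \<Longrightarrow>
      order_inv (Suc x) {b \<in> bins. nats \<tau> ''mark'' b \<noteq> 0} (nats \<tau> ''len'' 0) (nats \<tau> ''pos'')
        (nats \<tau> ''pit'') (nats \<tau> ''ptg'') (nats \<tau> ''sb'') (reals \<tau> ''D'') \<Longrightarrow> Q \<tau>"
  shows "wp W round_prog Q \<sigma>"
proof (rule wp_mono)
  define mark D where md: "mark = nats \<sigma> ''mark''" "D = reals \<sigma> ''D''"
  define M where "M = {b \<in> bins. mark b \<noteq> 0}"
  have M: "M \<subseteq> bins" "card M = x" using inv by (auto simp: order_inv_def M_def md)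
  have "M \<noteq> bins" using M x by (auto simp: N_def)
  then have ex: "\<exists>p<n. mark (B (it p)) = 0" using M by (auto simp: M_def bins_def bn_def)
  let ?R = "\<lambda>\<tau>. order_inv (Suc x) {b \<in> bins. nats \<tau> ''mark'' b \<noteq> 0} (nats \<tau> ''len'' 0) (nats \<tau> ''pos'')
        (nats \<tau> ''pit'') (nats \<tau> ''ptg'') (nats \<tau> ''sb'') (reals \<tau> ''D'')"
  show "wp W round_prog ?R \<sigma>"
    unfolding round_prog_def wp_basic
  proof (rule wp_score[OF st(1-4) md(2)[symmetric] W(1)], goal_cases)
    case (1 \<tau>1)
    note agr1 = 1(1) and score = 1(2)
    have s1: "nats \<tau>1 ''n'' 0 = n" "nats \<tau>1 ''bin'' = B" "nats \<tau>1 ''it'' = it" "nats \<tau>1 ''mark'' = mark"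
      using 1(1) st by (auto simp: agree_def md)
    show ?case
    proof (rule wp_select[OF s1 refl ex W(1)], goal_cases)
      case (1 \<tau>2 sel)
      have s2: "nats \<tau>2 ''n'' 0 = n" "nats \<tau>2 ''bin'' = B" "nats \<tau>2 ''it'' = it" "nats \<tau>2 ''mark'' = mark"
        "nats \<tau>2 ''sel'' 0 = sel" "nats \<tau>2 ''grp'' = grp" "nats \<tau>2 ''L'' 0 = L"
        and f2: "reals \<tau>2 ''gs'' = gs" "reals \<tau>2 ''NR'' 0 = N" "reals \<tau>2 ''D'' = D"
          "nats \<tau>2 ''len'' = nats \<sigma> ''len''" "nats \<tau>2 ''pos'' = nats \<sigma> ''pos''" "nats \<tau>2 ''pit'' = nats \<sigma> ''pit''"
          "nats \<tau>2 ''ptg'' = nats \<sigma> ''ptg''" "nats \<tau>2 ''sb'' = nats \<sigma> ''sb''"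
        using 1(1,2) agr1 st by (auto simp: agree_def md)
      define b where "b = B (it sel)"
      have b: "b \<in> bins - M" using 1 by (auto simp: b_def bins_def bn_def M_def)
      have sc: "reals \<tau>1 ''score'' (B (it p)) = (\<Sum>k<L. c (B (it p)) k * D k)" if "p < n" for p
        using score[OF that] score_eq[where b = "B (it p)" and D = D]
        by (simp add: bn_def)
      have min: "(\<Sum>k<L. c b k * D k) \<le> (\<Sum>k<L. c b' k * D k)" if "b' \<in> bins - M" for b'
      proof -
        from that obtain p where "p < n" "b' = B (it p)" "mark (B (it p)) = 0" by (auto simp: bins_def bn_def M_def)
        with 1(5)[of p] sc[of p] sc[of sel] 1(3) show ?thesis by (simp add: b_def)
      qed
      have S: "finite (inbins M)" "\<And>p. p \<in> inbins M \<Longrightarrow> B (it p) \<noteq> B (it sel)"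
        using b by (auto simp: inbins_def b_def bn_def)
      have lay: "layout L it grp pat base (inbins M) (nats \<tau>2 ''len'' 0) (nats \<tau>2 ''pos'') (nats \<tau>2 ''pit'')
          (nats \<tau>2 ''ptg'') (nats \<tau>2 ''sb'')"
        using inv by (simp add: f2 order_inv_def M_def md)
      show ?case
      proof (rule wp_take[OF s2 lay S grp W(1)], goal_cases)
        case (3 \<tau>3)
        have s3: "nats \<tau>3 ''L'' 0 = L" "reals \<tau>3 ''NR'' 0 = N" "reals \<tau>3 ''gs'' = gs"
          using 3(1) s2 f2 by (auto simp: agree_def)
        have ins: "inbins M \<union> {p. p < n \<and> B (it p) = B (it sel)} = inbins (insert b M)"
          by (auto simp: inbins_def b_def bn_def)
        have mark3: "{b' \<in> bins. nats \<tau>3 ''mark'' b' \<noteq> 0} = insert b M"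
          using b by (auto simp: 3(2) M_def b_def)
        show ?case
        proof (rule wp_discount[OF s3 refl W(2)], goal_cases)
          case (1 \<tau>4)
          have eq: "nats \<tau>4 ''mark'' = nats \<tau>3 ''mark''" "nats \<tau>4 ''len'' = nats \<tau>3 ''len''"
            "nats \<tau>4 ''pos'' = nats \<tau>3 ''pos''" "nats \<tau>4 ''pit'' = nats \<tau>3 ''pit''"
            "nats \<tau>4 ''ptg'' = nats \<tau>3 ''ptg''" "nats \<tau>4 ''sb'' = nats \<tau>3 ''sb''"
            using 1(1) by (auto simp: agree_def)
          show ?case
            unfolding eq mark3
          proof (rule order_inv_step[OF _ b min])
            show "order_inv x M (nats \<sigma> ''len'' 0) (nats \<sigma> ''pos'') (nats \<sigma> ''pit'') (nats \<sigma> ''ptg'') (nats \<sigma> ''sb'') D"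
              using inv by (simp add: M_def md)
            show "layout L it grp pat base (inbins (insert b M)) (nats \<tau>3 ''len'' 0) (nats \<tau>3 ''pos'')
                (nats \<tau>3 ''pit'') (nats \<tau>3 ''ptg'') (nats \<tau>3 ''sb'')"
              using 3(3) by (simp add: ins)
          next
            fix k assume "k < L"
            then show "reals \<tau>4 ''D'' k = D k + c b k - gs k / N"
              using 1(2) 3(4) by (simp add: f2 c_def b_def bn_def)
          qed (use 3(5) in \<open>simp_all add: f2\<close>)
        qed
      qed auto
    qed
  qed
qed (use post in auto)

lemma wp_order:
  assumes st: "nats \<sigma> ''n'' 0 = n" "nats \<sigma> ''bin'' = B" "nats \<sigma> ''it'' = it" "nats \<sigma> ''grp'' = grp"
      "nats \<sigma> ''L'' 0 = L" "nats \<sigma> ''pat'' = pat" "nats \<sigma> ''nb'' 0 = base" "reals \<sigma> ''gs'' = gs"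
    and D: "\<And>k. k < L \<Longrightarrow> reals \<sigma> ''D'' k = 0" and W: "n \<le> W" "L \<le> W"
    and post: "\<And>\<tau> M. agree order_prog \<sigma> \<tau> \<Longrightarrow> nats \<tau> ''ptr'' 0 = 0 \<Longrightarrow> nats \<tau> ''nb'' 0 = base + n * L \<Longrightarrow>
      order_inv N M (nats \<tau> ''len'' 0) (nats \<tau> ''pos'')
        (nats \<tau> ''pit'') (nats \<tau> ''ptg'') (nats \<tau> ''sb'') (reals \<tau> ''D'') \<Longrightarrow> Q \<tau>"
  shows "wp W order_prog Q \<sigma>"
proof (rule wp_mono)
  let ?I = "\<lambda>x \<tau>. nats \<tau> ''ptr'' 0 = 0 \<and> nats \<tau> ''nb'' 0 = base + n * L \<and>
      order_inv x {b \<in> bins. nats \<tau> ''mark'' b \<noteq> 0} (nats \<tau> ''len'' 0) (nats \<tau> ''pos'')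
        (nats \<tau> ''pit'') (nats \<tau> ''ptg'') (nats \<tau> ''sb'') (reals \<tau> ''D'')"
  have Nc: "card ((\<lambda>p. B (it p)) ` {..<n}) = N" by (simp add: N_def bins_def bn_def)
  show "wp W order_prog (?I N) \<sigma>"
    unfolding order_prog_def wp_basic
  proof (rule wp_slots[OF st(5,1,7,6) W(2,1)], goal_cases)
    case (1 \<tau>1)
    have s1: "nats \<tau>1 ''n'' 0 = n" "nats \<tau>1 ''bin'' = B" "nats \<tau>1 ''it'' = it"
      and f1: "nats \<tau>1 ''grp'' = grp" "nats \<tau>1 ''L'' 0 = L" "reals \<tau>1 ''gs'' = gs" "reals \<tau>1 ''D'' = reals \<sigma> ''D''"
      using 1(1) st by (auto simp: agree_def)
    note sb = 1(2,3)
    show ?case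
    proof (rule wp_unmark[OF s1 W(1)], goal_cases)
      case (1 \<tau>2)
      have s2: "nats \<tau>2 ''n'' 0 = n" "nats \<tau>2 ''bin'' = B" "nats \<tau>2 ''it'' = it"
        and f2: "nats \<tau>2 ''grp'' = grp" "nats \<tau>2 ''L'' 0 = L" "reals \<tau>2 ''gs'' = gs" "reals \<tau>2 ''D'' = reals \<sigma> ''D''"
          "nats \<tau>2 ''sb'' = nats \<tau>1 ''sb''" "nats \<tau>2 ''nb'' = nats \<tau>1 ''nb''"
        using 1(1) s1 f1 by (auto simp: agree_def)
      show ?case
      proof (rule wp_count_bins[OF s2 1(2) W(1)], goal_cases)
        case (2 \<tau>3)
        have s3: "nats \<tau>3 ''n'' 0 = n" "nats \<tau>3 ''bin'' = B" "nats \<tau>3 ''it'' = it"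
          and f3: "nats \<tau>3 ''grp'' = grp" "nats \<tau>3 ''L'' 0 = L" "reals \<tau>3 ''gs'' = gs" "reals \<tau>3 ''D'' = reals \<sigma> ''D''"
            "nats \<tau>3 ''sb'' = nats \<tau>1 ''sb''" "nats \<tau>3 ''nb'' = nats \<tau>1 ''nb''" "nats \<tau>3 ''NN'' 0 = N" "reals \<tau>3 ''NR'' 0 = N"
          using 2 s2 f2 Nc by (auto simp: agree_def)
        show ?case
        proof (rule wp_unmark[OF s3 W(1)], goal_cases)
          case (1 \<tau>4)
          have f4: "nats \<tau>4 ''n'' 0 = n" "nats \<tau>4 ''bin'' = B" "nats \<tau>4 ''it'' = it" "nats \<tau>4 ''grp'' = grp"
            "nats \<tau>4 ''L'' 0 = L" "reals \<tau>4 ''gs'' = gs" "reals \<tau>4 ''D'' = reals \<sigma> ''D''"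
            "nats \<tau>4 ''sb'' = nats \<tau>1 ''sb''" "nats \<tau>4 ''nb'' = nats \<tau>1 ''nb''" "nats \<tau>4 ''NN'' 0 = N" "reals \<tau>4 ''NR'' 0 = N"
            using 1(1) s3 f3 by (auto simp: agree_def)
          have none: "{b \<in> bins. nats \<tau>4 ''mark'' b \<noteq> 0} = {}" using 1(2) by (auto simp: bins_def bn_def)
          have "order_inv 0 {b \<in> bins. nats \<tau>4 ''mark'' b \<noteq> 0} 0 (nats \<tau>4 ''pos'') (nats \<tau>4 ''pit'')
              (nats \<tau>4 ''ptg'') (nats \<tau>1 ''sb'') (reals \<sigma> ''D'')"
            unfolding none by (rule order_inv_start) (use sb D in auto)
          then have start: "?I 0 (setN ''ptr'' 0 0 (setN ''len'' 0 0 \<tau>4))"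
            using sb by (simp add: f4)
          show ?case
          proof (rule wp_For[where N = N and Inv = "\<lambda>x \<tau>. ?I x \<tau>"], goal_cases)
            case (5 x \<upsilon>)
            have s5: "nats \<upsilon> ''n'' 0 = n" "nats \<upsilon> ''bin'' = B" "nats \<upsilon> ''it'' = it" "nats \<upsilon> ''grp'' = grp"
              "nats \<upsilon> ''L'' 0 = L" "reals \<upsilon> ''gs'' = gs" "reals \<upsilon> ''NR'' 0 = N"
              using 5(4) f4 by (auto simp: agree_def)
            show ?case
              by (rule wp_round[OF s5 _ 5(1) W]) (use 5 in \<open>auto simp: agree_def\<close>)
          qed (use start f4 W N_le in \<open>auto simp: agree_def\<close>)
        qed
      qed
    qed
  qed
qed (use post in auto)

end

lemma nw_order_prog [simp]: "nw order_prog = {''k'', ''sb'', ''p'', ''nb'', ''mark'', ''NN'', ''sel'', ''bs'',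
    ''pos'', ''pit'', ''ptg'', ''len'', ''ptr'', ''x''}"
  and rw_order_prog [simp]: "rw order_prog = {''NR'', ''score'', ''D''}"
  by (auto simp: order_prog_def)

section \<open>The complete plan and its quality\<close>

definition build_prog :: com where
  "build_prog = level_prog ;; sort_prog ;; group_size_prog ;; clear_prog ;; group_prog ;; search_prog ;; order_prog"

definition plan_prog :: com where
  "plan_prog = Cond (NLess (NNum 0) (nv ''n'')) build_prog (nset ''len'' (NNum 0) ;; nset ''ptr'' (NNum 0))"

lemma nw_build_parts [simp]: "nw level_prog = {''L'', ''pw'', ''a'', ''ac'', ''b''}" "nw sort_prog = {''a'', ''b'', ''x'', ''it''}"
    "nw group_size_prog = {''m'', ''x''}" "nw clear_prog = {''k''}" "nw group_prog = {''k'', ''j'', ''p'', ''grp''}"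
    "nw search_prog = {''best'', ''k'', ''c'', ''pat'', ''x'', ''q'', ''dig'', ''ok'', ''cnt''}"
  and rw_build_parts [simp]: "rw level_prog = {}" "rw sort_prog = {}" "rw group_size_prog = {}"
    "rw clear_prog = {''g'', ''gs'', ''D''}" "rw group_prog = {''g'', ''gs''}" "rw search_prog = {''load''}"
  by (auto simp: level_prog_def sort_prog_def group_size_prog_def clear_prog_def group_prog_def search_prog_def)

lemma nw_plan [simp]: "''bin'' \<notin> nw plan_prog" "''n'' \<notin> nw plan_prog"
  and rw_plan [simp]: "''sz'' \<notin> rw plan_prog" "''eps'' \<notin> rw plan_prog"
  by (auto simp: plan_prog_def build_prog_def)

text \<open>A bin of positive load contains a slot of positive size.\<close>

lemma used_le_image:
  assumes "\<And>k. k < L \<Longrightarrow> 0 \<le> g k"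
  shows "used g L f \<le> card (f ` {k. k < L \<and> 0 < g k})"
  unfolding used_def
proof (intro card_mono subsetI)
  fix b assume "b \<in> {b. b < L \<and> 0 < load g L f b}"
  then have "load g L f b \<noteq> 0" by auto
  then obtain k where "k < L" "f k = b" "g k \<noteq> 0" unfolding load_def by (metis (mono_tags, lifting) mem_Collect_eq sum.neutral)
  then show "b \<in> f ` {k. k < L \<and> 0 < g k}" using assms[of k] by force
qed simp

text \<open>The pattern derived from an optimal packing is among those searched, so
  \<open>best\<close> is at most \<open>OPT s I / m\<close> plus lower order terms. Multiplying by
  \<open>m\<close>, which is at most \<open>n / L + 1\<close> because of rounding up, gives the
  claim. \<open>K\<close> occurs in the analysis only, so the bound holds for every \<open>K\<close>
  at once.\<close>

lemma pattern_bound: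
  fixes n L m best K :: nat
  assumes it: "bij_betw it {..<n} I" and sz: "\<And>i. i \<in> I \<Longrightarrow> \<delta> \<le> s i \<and> s i \<le> 1" and \<delta>: "0 < \<delta>"
    and sorted: "\<And>p q. p \<le> q \<Longrightarrow> q < n \<Longrightarrow> s (it q) \<le> s (it p)"
    and m: "0 < m" "n \<le> m * L" "(m - 1) * L < n" and L: "0 < L"
    and g: "\<And>k. k < L \<Longrightarrow> g k = (if k * m < n then s (it (k * m)) else 0)"
    and best: "\<And>f. feasible g L f \<Longrightarrow> best \<le> used g L f" and K: "1 \<le> K"
  shows "real m * best - OPT s I \<le> (n / L + 1) * (2 + L / K + K * sqrt (2 * (L + 1)) / \<delta>)"
proof -
  have itI: "it p \<in> I" if "p < n" for p using it that by (auto simp: bij_betw_def)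
  obtain B where B: "is_packing s I B" "num_bins I B = OPT s I"
    using OPT_packing sz by metis
  have "is_packing (\<lambda>p. s (it p)) {..<n} (B \<circ> it)"
    unfolding is_packing_def
  proof
    fix b
    have "(\<Sum>p\<in>{p \<in> {..<n}. (B \<circ> it) p = b}. s (it p)) = (\<Sum>i\<in>{i \<in> I. B i = b}. s i)"
      using it by (intro sum.reindex_bij_betw) (auto simp: bij_betw_def inj_on_def)
    then show "(\<Sum>p\<in>{p \<in> {..<n}. (B \<circ> it) p = b}. s (it p)) \<le> 1" using B(1) by (simp add: is_packing_def)
  qed
  note packing = this
  have nb: "num_bins {..<n} (B \<circ> it) = OPT s I"
    using it B(2) by (auto simp: num_bins_def image_image bij_betw_def)
  have szp: "\<And>p. p < n \<Longrightarrow> \<delta> \<le> s (it p) \<and> s (it p) \<le> 1" using sz itI by blast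
  have "\<exists>f. (\<forall>k<L. f k < L) \<and> (\<forall>b. (\<Sum>k\<in>{k. k < L \<and> f k = b}. g k) \<le> 1) \<and>
      real (card (f ` {k. k < L \<and> 0 < g k})) \<le>
        num_bins {..<n} (B \<circ> it) / m + 2 + L / K + K * sqrt (2 * (L + 1)) / \<delta>"
    by (rule quantile_pattern_exists[where a = "\<lambda>p. s (it p)" and B = "B \<circ> it" and n = n and m = m
          and L = L and K = K and g = g and \<delta> = \<delta>, OF sorted szp \<delta> packing m(1,2) _ g])
      (use K in \<open>assumption | linarith | blast\<close>)+
  then obtain f where f: "\<And>k. k < L \<Longrightarrow> f k < L" "\<And>b. (\<Sum>k\<in>{k. k < L \<and> f k = b}. g k) \<le> 1"
    "real (card (f ` {k. k < L \<and> 0 < g k})) \<le> OPT s I / m + 2 + L / K + K * sqrt (2 * (L + 1)) / \<delta>"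
    unfolding nb by blast
  define Z where "Z = 2 + L / K + K * sqrt (2 * (L + 1)) / \<delta>"
  have Z: "0 \<le> Z" using \<delta> by (simp add: Z_def)
  have "feasible g L f" using f(1,2) by (simp add: feasible_def load_def)
  then have "best \<le> used g L f" by (rule best)
  also have "\<dots> \<le> card (f ` {k. k < L \<and> 0 < g k})"
  proof (rule used_le_image)
    show "0 \<le> g k" if "k < L" for k using g[OF that] szp[of "k * m"] \<delta> by auto
  qed
  finally have "best \<le> card (f ` {k. k < L \<and> 0 < g k})" .
  then have "real best \<le> OPT s I / m + Z" using f(3) by (simp add: Z_def)
  then have "real m * best \<le> real m * (OPT s I / m + Z)" by (intro mult_left_mono) auto
  then have "real m * best - OPT s I \<le> real m * Z" using m(1) by (simp add: distrib_left)
  also have "\<dots> \<le> (n / L + 1) * Z"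
  proof (intro mult_right_mono Z)
    have "real ((m - 1) * L) \<le> n" by (rule of_nat_mono[OF less_imp_le[OF m(3)]])
    then have "(real m - 1) * L \<le> n" using m(1) by (simp add: of_nat_diff)
    then show "real m \<le> n / L + 1" using L by (simp add: field_simps)
  qed
  finally show ?thesis by (simp add: Z_def)
qed

lemma wp_plan:
  assumes n: "nats \<sigma> ''n'' 0 = n" and it: "bij_betw (nats \<sigma> ''it'') {..<n} I"
    and sz: "\<And>i. i \<in> I \<Longrightarrow> reals \<sigma> ''sz'' i = s i" "\<And>i. i \<in> I \<Longrightarrow> \<delta> \<le> s i \<and> s i \<le> 1" and \<delta>: "0 < \<delta>"
    and B: "nats \<sigma> ''bin'' = B" "is_packing s I B" "\<And>i. i \<in> I \<Longrightarrow> B i < nats \<sigma> ''nb'' 0"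
    and W: "n + 2 \<le> W"
    and post: "\<And>\<tau> base hi V e. agree plan_prog \<sigma> \<tau> \<Longrightarrow> bij_betw (nats \<tau> ''it'') {..<n} I \<Longrightarrow> nats \<tau> ''ptr'' 0 = 0 \<Longrightarrow>
      nats \<tau> ''len'' 0 = n \<Longrightarrow> hi \<le> nats \<tau> ''nb'' 0 \<Longrightarrow>
      plan s \<delta> I B base hi n (nats \<tau> ''pit'') (nats \<tau> ''ptg'') V e \<Longrightarrow> Q \<tau>"
  shows "wp W plan_prog Q \<sigma>"
proof (rule wp_mono)
  define nb where "nb = nats \<sigma> ''nb'' 0"
  let ?R = "\<lambda>\<tau>. bij_betw (nats \<tau> ''it'') {..<n} I \<and> nats \<tau> ''ptr'' 0 = 0 \<and> nats \<tau> ''len'' 0 = n \<and>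
      (\<exists>base hi V e. hi \<le> nats \<tau> ''nb'' 0 \<and> plan s \<delta> I B base hi n (nats \<tau> ''pit'') (nats \<tau> ''ptg'') V e)"
  show "wp W plan_prog ?R \<sigma>"
  proof (cases "n = 0")
    case True
    then have I: "I = {}" using it by (auto simp: bij_betw_def)
    have "OPT s {} = 0" using OPT_le[of s "{}" id] by (simp add: is_packing_def num_bins_def)
    then have "plan s \<delta> I B nb nb n pit ptg 0 0" for pit ptg
      using True by (auto simp: I plan_def is_packing_def num_bins_def slack_def bij_betw_def)
    then have "\<exists>base hi V e. hi \<le> nb \<and> plan s \<delta> I B base hi n pit ptg V e" for pit ptg
      by blast
    then show ?thesis using True n it by (simp add: plan_prog_def nb_def)
  next
    case False
    then have n0: "0 < n" by simp
    have "wp W build_prog ?R \<sigma>"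
      unfolding build_prog_def wp_basic
    proof (rule wp_level[OF n W], goal_cases)
      case (1 \<tau>1 L)
      have L: "0 < L" "L ^ L \<le> n" "n < (L + 1) ^ (L + 1)" using 1(4) n0 by auto
      have Ln: "L \<le> n" using le_self_power[of L] L(2) by linarith
      have WL: "L \<le> W" "n \<le> W" using Ln W by auto
      have s1: "nats \<tau>1 ''n'' 0 = n" "bij_betw (nats \<tau>1 ''it'') {..<n} I" "nats \<tau>1 ''L'' 0 = L"
        "reals \<tau>1 ''sz'' = reals \<sigma> ''sz''" "nats \<tau>1 ''bin'' = B" "nats \<tau>1 ''nb'' 0 = nb"
        using 1(1,2) n it B(1) by (auto simp: agree_def nb_def)
      show ?case
      proof (rule wp_sort[OF s1(1) W s1(2) s1(4)], goal_cases)
        case (1 \<tau>2)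
        define it2 where "it2 = nats \<tau>2 ''it''"
        have it2: "bij_betw it2 {..<n} I" using 1(2) by (simp add: it2_def)
        have itI: "it2 p \<in> I" if "p < n" for p using it2 that by (auto simp: bij_betw_def)
        have sorted: "s (it2 q) \<le> s (it2 p)" if "p \<le> q" "q < n" for p q
          using 1(3)[OF that] sz(1)[OF itI[of p]] sz(1)[OF itI[of q]] that by (simp add: it2_def)
        have s2: "nats \<tau>2 ''n'' 0 = n" "nats \<tau>2 ''L'' 0 = L"
          "reals \<tau>2 ''sz'' = reals \<sigma> ''sz''" "nats \<tau>2 ''bin'' = B" "nats \<tau>2 ''nb'' 0 = nb"
          using 1(1) s1 by (auto simp: agree_def)
        show ?case
        proof (rule wp_group_size[OF s2(1,2) L(1) W], goal_cases)
          case (1 \<tau>3 m)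
          have m: "n \<le> m * L" "0 < m" "(m - 1) * L < n" using 1(3,4) n0 by auto
          have s3: "nats \<tau>3 ''n'' 0 = n" "nats \<tau>3 ''L'' 0 = L" "nats \<tau>3 ''it'' = it2" "nats \<tau>3 ''m'' 0 = m"
            "reals \<tau>3 ''sz'' = reals \<sigma> ''sz''" "nats \<tau>3 ''bin'' = B" "nats \<tau>3 ''nb'' 0 = nb"
            using 1(1,2) s2 by (auto simp: agree_def it2_def)
          show ?case
          proof (rule wp_clear[OF s3(2) WL(1)], goal_cases)
            case (1 \<tau>4)
            have s4: "nats \<tau>4 ''n'' 0 = n" "nats \<tau>4 ''L'' 0 = L" "nats \<tau>4 ''it'' = it2" "nats \<tau>4 ''m'' 0 = m"
              "reals \<tau>4 ''sz'' = reals \<sigma> ''sz''" "nats \<tau>4 ''bin'' = B" "nats \<tau>4 ''nb'' 0 = nb"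
              using 1(1) s3 by (auto simp: agree_def)
            have clear: "\<And>k. k < L \<Longrightarrow> reals \<tau>4 ''g'' k = 0" "\<And>k. k < L \<Longrightarrow> reals \<tau>4 ''gs'' k = 0"
              "\<And>k. k < L \<Longrightarrow> reals \<tau>4 ''D'' k = 0" using 1(2) by auto
            show ?case
            proof (rule wp_group[where L = L, OF s4(1,4) m(2) WL(2) clear(1,2) s4(3,5)], goal_cases)
              case (3 \<tau>5)
              define grp g gs where d: "grp = nats \<tau>5 ''grp''" "g = reals \<tau>5 ''g''" "gs = reals \<tau>5 ''gs''"
              have s5: "nats \<tau>5 ''n'' 0 = n" "nats \<tau>5 ''L'' 0 = L" "nats \<tau>5 ''it'' = it2"
                "nats \<tau>5 ''bin'' = B" "nats \<tau>5 ''nb'' 0 = nb" "reals \<tau>5 ''D'' = reals \<tau>4 ''D''"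
                using 3(1) s4 by (auto simp: agree_def)
              have grp: "grp p = p div m" if "p < n" for p using 3(2) that by (simp add: d)
              have g: "g k = (if k * m < n then s (it2 (k * m)) else 0)" if "k < L" for k
                using 3(3) that sz(1) itI by (simp add: d)
              have gs: "gs k = card {p. p < n \<and> p div m = k}" if "k < L" for k
                using 3(4) that by (simp add: d)
              have g01: "0 \<le> g k \<and> g k \<le> 1" if "k < L" for k
                using g[OF that] sz(2)[OF itI, of "k * m"] \<delta> by auto
              have LL: "0 < L" "L \<le> n" "L ^ L \<le> n" using L Ln by auto
              show ?case
              proof (rule wp_search[OF s5(2) LL s5(1) W d(2)[symmetric] g01], goal_cases)
                case (2 \<tau>6)
                define pat best where p: "pat = nats \<tau>6 ''pat''" "best = nats \<tau>6 ''best'' 0"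
                have s6: "nats \<tau>6 ''n'' 0 = n" "nats \<tau>6 ''bin'' = B" "nats \<tau>6 ''it'' = it2" "nats \<tau>6 ''grp'' = grp"
                  "nats \<tau>6 ''L'' 0 = L" "nats \<tau>6 ''pat'' = pat" "nats \<tau>6 ''nb'' 0 = nb" "reals \<tau>6 ''gs'' = gs"
                  and D6: "\<And>k. k < L \<Longrightarrow> reals \<tau>6 ''D'' k = 0"
                  using 2(1) s5 clear(3) by (auto simp: agree_def d p)
                have best: "best \<le> used g L f" if "feasible g L f" for f using 2(5) that by (simp add: p)
                have itim: "it2 ` {..<n} = I" using it2 by (simp add: bij_betw_def)
                interpret ordering n L m best nb it2 B grp pat gs g s \<delta>
                proof
                  show "grp p < L" if "p < n" for p
                    using that m by (simp add: grp div_less_iff_less_mult mult.commute)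
                  show "gs k = card {p. p < n \<and> grp p = k}" if "k < L" for k
                  proof -
                    have "{p. p < n \<and> grp p = k} = {p. p < n \<and> p div m = k}" using grp by auto
                    then show ?thesis using gs[OF that] by simp
                  qed
                  show "gs k \<le> m" if "k < L" for k
                  proof -
                    have "{p. p < n \<and> p div m = k} \<subseteq> {k * m..<k * m + m}"
                      using m(2) by (auto simp: mult.commute) (metis add.commute div_mult_mod_eq mod_less_divisor mult.commute nat_add_left_cancel_less)
                    from card_mono[OF _ this] show ?thesis using gs[OF that] by simp
                  qed
                  show "s (it2 p) \<le> g (grp p)" if "p < n" for p
                  proof -
                    have le: "p div m * m \<le> p" by simp
                    moreover have "p div m * m < n" by (rule le_less_trans[OF le that])
                    moreover have "p div m < L" using that m by (simp add: div_less_iff_less_mult mult.commute)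
                    ultimately show ?thesis using g sorted[of "p div m * m" p] that grp by simp
                  qed
                  show "is_packing s (it2 ` {..<n}) B" using B(2) itim by simp
                qed (use n0 LL \<delta> g01 sz(2) itI it2 2 in \<open>auto simp: p bij_betw_def\<close>)
                show ?case
                proof (rule wp_order[OF s6 D6 WL(2,1)], goal_cases)
                  case (2 \<tau>7 M)
                  \<comment> \<open>The excess of \<open>m\<close> copies of the pattern over
                    \<open>OPT\<close>, which \<open>pattern_bound\<close> estimates for every
                    \<open>K\<close>.\<close>
                  define v where "v = real m * best - OPT s I"
                  have "v \<le> (n / L + 1) * (2 + L / K + K * sqrt (2 * (L + 1)) / \<delta>)" if "1 \<le> K" for K :: nat
                    unfolding v_def using it2 sz(2) \<delta> sorted m(2,1,3) L(1) g best that by (rule pattern_bound)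
                  then have sl: "slack \<delta> n v (1 + L * R)"
                    unfolding slack_def using L by (intro disjI2 exI[of _ L]) (auto simp: R_def)
                  have mn: "m \<le> n" using m L(1) by (cases m) (auto intro: order.strict_trans1[OF _ m(3)] simp: Suc_le_eq)
                  have "nats \<tau>7 ''len'' 0 = n \<and> plan s \<delta> (it2 ` {..<n}) B nb (nb + n * L) (nats \<tau>7 ''len'' 0)
                      (nats \<tau>7 ''pit'') (nats \<tau>7 ''ptg'') (real m * best) (1 + L * R)"
                    using 2(4)
                  proof (rule order_inv_plan[where v = v])
                    show "real m * best \<le> OPT s (it2 ` {..<n}) + v" by (simp add: v_def itim)
                  qed (use sz(2) itI B(3) sl mn in \<open>auto simp: nb_def\<close>)
                  moreover have "nats \<tau>7 ''it'' = it2" using 2(1) s6 by (auto simp: agree_def)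
                  ultimately show ?case using 2(2,3) it2 itim by auto
                qed
              qed
            qed
          qed
        qed
      qed
    qed
    then show ?thesis using n0 n by (simp add: plan_prog_def)
  qed
qed (use post in auto)

section \<open>Serving a request\<close>

definition insert_prog :: com where
  "insert_prog = RAssign ''sz'' (nv ''item'') (rv ''size'') ;; NAssign ''it'' (nv ''n'') (nv ''item'') ;;
     ninc ''n'' ;; NAssign ''bin'' (nv ''item'') (nv ''nb'') ;; ninc ''nb''"

definition delete_prog :: com where
  "delete_prog = nset ''p'' (NNum 0) ;;
     While (neq (NCell ''it'' (nv ''p'')) (nv ''item'')) (ninc ''p'') ;;
     nset ''n'' (NSub (nv ''n'') (NNum 1)) ;; NAssign ''it'' (nv ''p'') (NCell ''it'' (nv ''n''))"

definition request_prog :: com where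
  "request_prog = Cond (NLess (NNum 0) (nv ''insert'')) insert_prog delete_prog"

text \<open>The last item fills the gap. If \<open>p = n\<close>, the assignment falls outside the
  new range.\<close>

lemma bij_betw_remove_last:
  assumes it: "bij_betw it {..<Suc n} I" and p: "p < Suc n"
  shows "bij_betw (it(p := it n)) {..<n} (I - {it p})"
proof -
  have inj: "inj_on it {..<Suc n}" and im: "it ` {..<Suc n} = I" using it by (auto simp: bij_betw_def)
  have eq: "it q = it q' \<longleftrightarrow> q = q'" if "q < Suc n" "q' < Suc n" for q q'
    using inj that by (auto dest: inj_onD)
  have "inj_on (it(p := it n)) {..<n}"
    using p by (auto simp: inj_on_def eq)
  moreover have "(it(p := it n)) ` {..<n} = I - {it p}"
  proof
    show "(it(p := it n)) ` {..<n} \<subseteq> I - {it p}"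
    proof (rule image_subsetI)
      fix q assume "q \<in> {..<n}"
      then show "(it(p := it n)) q \<in> I - {it p}"
        using im eq[of q p] eq[of n p] p by (cases "q = p") (auto simp flip: im)
    qed
    show "I - {it p} \<subseteq> (it(p := it n)) ` {..<n}"
    proof
      fix i assume i: "i \<in> I - {it p}"
      then obtain q where q: "q < Suc n" "i = it q" by (auto simp flip: im)
      then have "q \<noteq> p" using i by auto
      show "i \<in> (it(p := it n)) ` {..<n}"
      proof (cases "q = n")
        case True
        then have "p < n" using p \<open>q \<noteq> p\<close> by simp
        then show ?thesis using q True by (intro image_eqI[of _ _ p]) auto
      next
        case False
        then show ?thesis using q \<open>q \<noteq> p\<close> by (intro image_eqI[of _ _ q]) auto
      qed
    qed
  qed
  ultimately show ?thesis by (simp add: bij_betw_def)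
qed

lemma wp_request:
  assumes \<sigma>: "nats \<sigma> ''n'' 0 = card I" "bij_betw (nats \<sigma> ''it'') {..<card I} I" "finite I"
      "\<And>i. i \<in> I \<Longrightarrow> reals \<sigma> ''sz'' i = s i" "nats \<sigma> ''bin'' = B" "nats \<sigma> ''nb'' 0 = nb"
    and req: "nats \<sigma> ''item'' 0 = i" "nats \<sigma> ''insert'' 0 = (case a of Insert \<Rightarrow> 1 | Delete \<Rightarrow> 0)"
      "reals \<sigma> ''size'' 0 = s i"
    and adm: "admissible I (i, a)" and J: "J = apply_request I (i, a)" and W: "card J + 1 \<le> W"
    and post: "\<And>\<tau>. agree request_prog \<sigma> \<tau> \<Longrightarrow> nats \<tau> ''n'' 0 = card J \<Longrightarrow>
      bij_betw (nats \<tau> ''it'') {..<card J} J \<Longrightarrow> (\<And>i. i \<in> J \<Longrightarrow> reals \<tau> ''sz'' i = s i) \<Longrightarrow>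
      nats \<tau> ''bin'' = (case a of Insert \<Rightarrow> B(i := nb) | Delete \<Rightarrow> B) \<Longrightarrow>
      nats \<tau> ''nb'' 0 = (case a of Insert \<Rightarrow> Suc nb | Delete \<Rightarrow> nb) \<Longrightarrow> Q \<tau>"
  shows "wp W request_prog Q \<sigma>"
proof (rule wp_mono)
  let ?R = "\<lambda>\<tau>. nats \<tau> ''n'' 0 = card J \<and> bij_betw (nats \<tau> ''it'') {..<card J} J \<and>
      (\<forall>i\<in>J. reals \<tau> ''sz'' i = s i) \<and> nats \<tau> ''bin'' = (case a of Insert \<Rightarrow> B(i := nb) | Delete \<Rightarrow> B) \<and>
      nats \<tau> ''nb'' 0 = (case a of Insert \<Rightarrow> Suc nb | Delete \<Rightarrow> nb)"
  show "wp W request_prog ?R \<sigma>"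
  proof (cases a)
    case Insert
    then have J': "J = insert i I" "i \<notin> I" using J adm by auto
    have "bij_betw ((nats \<sigma> ''it'')(card I := i)) {..<Suc (card I)} (insert i I)"
      using \<sigma>(2) J'(2) by (auto simp: bij_betw_def inj_on_def lessThan_Suc image_iff)
    then show ?thesis using \<sigma> req J' Insert by (auto simp: request_prog_def insert_prog_def)
  next
    case Delete
    then have J': "J = I - {i}" "i \<in> I" using J adm by auto
    then obtain n where n: "card I = Suc n" "card J = n" using \<sigma>(3) by (metis card_Suc_Diff1)
    define it where "it = nats \<sigma> ''it''"
    from \<sigma>(2) J'(2) obtain p0 where p0: "p0 < Suc n" "it p0 = i" by (auto simp: bij_betw_def n it_def)
    have "wp W delete_prog ?R \<sigma>"
      unfolding delete_prog_def wp_basic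
    proof (rule wp_While[where N = p0 and Inv = "\<lambda>k \<tau>. nats \<tau> ''p'' 0 + k = p0"], goal_cases)
      case (4 \<tau>)
      then have "nats \<tau> ''it'' = it" "nats \<tau> ''item'' 0 = i" using req by (auto simp: agree_def it_def)
      then show ?case using 4 p0 by simp
    next
      case (5 k \<tau>)
      then have s: "nats \<tau> ''it'' = it" "nats \<tau> ''item'' 0 = i" "nats \<tau> ''n'' 0 = Suc n" "nats \<tau> ''bin'' = B"
        "nats \<tau> ''nb'' 0 = nb" "reals \<tau> ''sz'' = reals \<sigma> ''sz''"
        using req \<sigma> n by (auto simp: agree_def it_def)
      define p where "p = nats \<tau> ''p'' 0"
      have p: "p < Suc n" "it p = i" using 5 s p0 by (auto simp: p_def)
      have "bij_betw (it(p := it n)) {..<n} J"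
        using bij_betw_remove_last[of it n I p] \<sigma>(2) p by (simp add: n it_def J')
      moreover have "card (I - {i}) = n" using n(2) J'(1) by simp
      ultimately show ?case using \<sigma>(4) by (simp add: s Delete J'(1) flip: p_def)
    qed (use W n p0 in auto)
    then show ?thesis using req Delete by (simp add: request_prog_def)
  qed
qed (use post in auto)

section \<open>Carrying out the moves\<close>

definition move_prog :: com where
  "move_prog = rset ''acc'' (RNum 0) ;;
     While (RLess (rv ''acc'') (RNum 1))
      (rset ''acc'' (RAdd (rv ''acc'') (RMul (rv ''eps'') (rv ''eps''))) ;;
       Cond (NLess (nv ''ptr'') (nv ''len''))
        (NAssign ''bin'' (NCell ''pit'' (nv ''ptr'')) (NCell ''ptg'' (nv ''ptr'')) ;; ninc ''ptr'') Skip)"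

text \<open>The program cannot round, so it adds \<open>\<epsilon>\<^sup>2\<close> to
  \<open>acc\<close> until 1 is reached; for positive \<epsilon> this takes exactly so many
  rounds.\<close>

definition moves :: "real \<Rightarrow> nat" where
  "moves \<epsilon> = nat \<lceil>1 / \<epsilon>\<^sup>2\<rceil>"

text \<open>Unless the plan is completed, \<open>\<epsilon>\<^sup>2 * ptr\<close> grows by at least
  1, which pays for one request. The set \<open>X\<close> of items whose cell is written bounds the
  migration.\<close>

lemma wp_move:
  assumes \<epsilon>: "reals \<sigma> ''eps'' 0 = \<epsilon>" "0 < \<epsilon>" and W: "moves \<epsilon> \<le> W"
    and st: "nats \<sigma> ''len'' 0 = len" "nats \<sigma> ''pit'' = pit" "nats \<sigma> ''ptg'' = ptg" "nats \<sigma> ''ptr'' 0 = ptr"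
    and pl: "plan s \<delta> I0 B0 base hi len pit ptg V e"
    and pr: "progress I (nats \<sigma> ''bin'') nb I0 B0 hi len pit ptg ptr u F"
    and post: "\<And>\<tau> F' ptr'. agree move_prog \<sigma> \<tau> \<Longrightarrow> nats \<tau> ''ptr'' 0 = ptr' \<Longrightarrow>
      progress I (nats \<tau> ''bin'') nb I0 B0 hi len pit ptg ptr' u F' \<Longrightarrow>
      ptr' = len \<or> 1 \<le> \<epsilon>\<^sup>2 * (real ptr' - real ptr) \<Longrightarrow> ptr \<le> ptr' \<Longrightarrow>
      (\<exists>X. finite X \<and> card X \<le> moves \<epsilon> \<and> (\<forall>i. i \<notin> X \<longrightarrow> nats \<tau> ''bin'' i = nats \<sigma> ''bin'' i)) \<Longrightarrow> Q \<tau>"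
  shows "wp W move_prog Q \<sigma>"
proof (rule wp_mono)
  define B where "B = nats \<sigma> ''bin''"
  define R where "R j ptr' B' \<longleftrightarrow> (\<exists>F'. progress I B' nb I0 B0 hi len pit ptg ptr' u F') \<and>
    (ptr' = len \<or> ptr' = ptr + j) \<and> ptr \<le> ptr' \<and>
    (\<exists>X. finite X \<and> card X \<le> j \<and> (\<forall>i. i \<notin> X \<longrightarrow> B' i = B i))" for j ptr' B'
  have RI: "R j ptr' B'" if "progress I B' nb I0 B0 hi len pit ptg ptr' u F'" "ptr' = len \<or> ptr' = ptr + j"
    "ptr \<le> ptr'" "finite X" "card X \<le> j" "\<And>i. i \<notin> X \<Longrightarrow> B' i = B i" for j ptr' B' F' X
    using that unfolding R_def by blast
  have pe: "0 < \<epsilon>\<^sup>2" using \<epsilon> by simp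
  have q: "1 \<le> \<epsilon>\<^sup>2 * moves \<epsilon>"
  proof -
    have "1 / \<epsilon>\<^sup>2 \<le> moves \<epsilon>" unfolding moves_def by linarith
    then show ?thesis using pe by (simp add: divide_le_eq mult.commute)
  qed
  show "wp W move_prog (\<lambda>\<tau>. \<exists>j. 1 \<le> \<epsilon>\<^sup>2 * real j \<and> j \<le> moves \<epsilon> \<and> R j (nats \<tau> ''ptr'' 0) (nats \<tau> ''bin'')) \<sigma>"
    unfolding move_prog_def wp_basic
  proof (rule wp_While[where N = "moves \<epsilon>" and Inv = "\<lambda>k \<tau>. \<exists>j. j + k = moves \<epsilon> \<and>
      reals \<tau> ''acc'' 0 = \<epsilon>\<^sup>2 * real j \<and> R j (nats \<tau> ''ptr'' 0) (nats \<tau> ''bin'')"], goal_cases)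
    case 1
    have "R 0 ptr B" by (rule RI[where X = "{}"]) (use pr in \<open>simp_all add: B_def\<close>)
    then show ?case by (simp add: st B_def)
  next
    case (3 k \<tau>)
    then have s: "nats \<tau> ''len'' 0 = len" "nats \<tau> ''pit'' = pit" "nats \<tau> ''ptg'' = ptg" "reals \<tau> ''eps'' 0 = \<epsilon>"
      using st \<epsilon> by (auto simp: agree_def)
    define ptr1 B1 where d: "ptr1 = nats \<tau> ''ptr'' 0" "B1 = nats \<tau> ''bin''"
    from 3 obtain j where j: "j + Suc k = moves \<epsilon>" "reals \<tau> ''acc'' 0 = \<epsilon>\<^sup>2 * real j" "R j ptr1 B1"
      by (auto simp: d)
    have acc: "\<epsilon>\<^sup>2 * real j + \<epsilon> * \<epsilon> = \<epsilon>\<^sup>2 * real (Suc j)" by (simp add: algebra_simps power2_eq_square)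
    from j(3) obtain F' X where F': "progress I B1 nb I0 B0 hi len pit ptg ptr1 u F'"
      and X: "finite X" "card X \<le> j" "\<forall>i. i \<notin> X \<longrightarrow> B1 i = B i" by (auto simp: R_def)
    have "R (Suc j) (Suc ptr1) (B1(pit ptr1 := ptg ptr1))" if "ptr1 < len"
    proof -
      have pm: "progress I (B1(pit ptr1 := ptg ptr1)) nb I0 B0 hi len pit ptg (Suc ptr1) u (F' - {pit ptr1})"
        using pl F' that by (rule progress_move)
      have "card (insert (pit ptr1) X) \<le> Suc j" using X by (simp add: card_insert_if)
      then show ?thesis
        by (intro RI[OF pm, where X = "insert (pit ptr1) X"]) (use j(3) that X in \<open>auto simp: R_def\<close>)
    qed
    moreover have "R (Suc j) ptr1 B1" if "\<not> ptr1 < len"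
    proof -
      have "ptr1 = len" using that F' by (simp add: progress_def)
      then show ?thesis by (intro RI[OF F', where X = X]) (use j(3) X in \<open>auto simp: R_def\<close>)
    qed
    moreover have "Suc j + k = moves \<epsilon>" using j(1) by simp
    ultimately show ?case using j acc
      by (auto simp: s simp flip: d intro!: exI[of _ "Suc j"])
  next
    case (4 \<tau>)
    then show ?case using q by auto
  next
    case (5 k \<tau>)
    then obtain j where "j + k = moves \<epsilon>" "reals \<tau> ''acc'' 0 = \<epsilon>\<^sup>2 * real j"
      "R j (nats \<tau> ''ptr'' 0) (nats \<tau> ''bin'')" by blast
    then show ?case using 5(3) by (intro exI[of _ j]) auto
  qed (use W in auto)
  fix \<tau> assume a: "agree move_prog \<sigma> \<tau>"
    "\<exists>j. 1 \<le> \<epsilon>\<^sup>2 * real j \<and> j \<le> moves \<epsilon> \<and> R j (nats \<tau> ''ptr'' 0) (nats \<tau> ''bin'')"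
  then obtain j where j: "1 \<le> \<epsilon>\<^sup>2 * real j" "j \<le> moves \<epsilon>" "R j (nats \<tau> ''ptr'' 0) (nats \<tau> ''bin'')" by blast
  then obtain F' X where "progress I (nats \<tau> ''bin'') nb I0 B0 hi len pit ptg (nats \<tau> ''ptr'' 0) u F'"
    "finite X" "card X \<le> moves \<epsilon>" "\<forall>i. i \<notin> X \<longrightarrow> nats \<tau> ''bin'' i = nats \<sigma> ''bin'' i"
    by (auto simp: R_def B_def)
  then show "Q \<tau>" using j by (intro post[OF a(1) refl]) (auto simp: R_def)
qed

text \<open>A request that finds the plan completed still counts for the old epoch; the packing
  after it is the old packing of the new plan, whose first moves follow at once.\<close>

definition step_prog :: com where
  "step_prog = request_prog ;; Cond (NLess (nv ''ptr'') (nv ''len'')) Skip plan_prog ;; move_prog"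

text \<open>The last clause keeps the moves ahead of the requests: as long as the plan is not
  completed, even the next request fits into \<open>\<epsilon>\<^sup>2 * ptr\<close>, and so into
  \<open>\<epsilon>\<^sup>2 * len\<close>. Hence an epoch lasts for at most
  \<open>\<epsilon>\<^sup>2 * len + 1\<close> requests, including the one that ends it.\<close>

definition state_inv :: "(nat \<Rightarrow> real) \<Rightarrow> real \<Rightarrow> real \<Rightarrow> nat set \<Rightarrow> state \<Rightarrow> bool" where
  "state_inv s \<delta> \<epsilon> I \<sigma> \<longleftrightarrow> reals \<sigma> ''eps'' 0 = \<epsilon> \<and> finite I \<and> nats \<sigma> ''n'' 0 = card I \<and>
     bij_betw (nats \<sigma> ''it'') {..<card I} I \<and> (\<forall>i\<in>I. reals \<sigma> ''sz'' i = s i) \<and>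
     (\<exists>len ptr I0 B0 base hi V e u F. nats \<sigma> ''len'' 0 = len \<and> nats \<sigma> ''ptr'' 0 = ptr \<and>
        plan s \<delta> I0 B0 base hi len (nats \<sigma> ''pit'') (nats \<sigma> ''ptg'') V e \<and>
        inherited \<delta> \<epsilon> len (real (num_bins I0 B0) - real (OPT s I0)) \<and>
        progress I (nats \<sigma> ''bin'') (nats \<sigma> ''nb'' 0) I0 B0 hi len (nats \<sigma> ''pit'') (nats \<sigma> ''ptg'') ptr u F \<and>
        real u \<le> \<epsilon>\<^sup>2 * real len \<and> (ptr = len \<or> real u + 1 \<le> \<epsilon>\<^sup>2 * real ptr))"

lemma state_invI:
  assumes "reals \<sigma> ''eps'' 0 = \<epsilon>" "finite I" "nats \<sigma> ''n'' 0 = card I"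
    "bij_betw (nats \<sigma> ''it'') {..<card I} I" "\<And>i. i \<in> I \<Longrightarrow> reals \<sigma> ''sz'' i = s i"
    "nats \<sigma> ''len'' 0 = len" "nats \<sigma> ''ptr'' 0 = ptr" "nats \<sigma> ''pit'' = pit" "nats \<sigma> ''ptg'' = ptg"
    "plan s \<delta> I0 B0 base hi len pit ptg V e"
    "inherited \<delta> \<epsilon> len (real (num_bins I0 B0) - real (OPT s I0))"
    "progress I (nats \<sigma> ''bin'') (nats \<sigma> ''nb'' 0) I0 B0 hi len pit ptg ptr u F"
    "real u \<le> \<epsilon>\<^sup>2 * real len" "ptr = len \<or> real u + 1 \<le> \<epsilon>\<^sup>2 * real ptr"
  shows "state_inv s \<delta> \<epsilon> I \<sigma>"
  using assms unfolding state_inv_def by blast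

text \<open>Zeroed memory reads as a completed plan for no items, so the first request starts an
  epoch.\<close>

lemma state_inv_initial: "state_inv s \<delta> \<epsilon> {} (initial_state \<epsilon>)"
proof -
  have "OPT s {} = 0" using OPT_le[of s "{}" id] by (simp add: is_packing_def num_bins_def)
  then have "plan s \<delta> {} id 0 0 0 (\<lambda>_. 0) (\<lambda>_. 0) 0 0" "inherited \<delta> \<epsilon> 0 (real (num_bins {} id) - real (OPT s {}))"
    by (auto simp: plan_def is_packing_def num_bins_def slack_def bij_betw_def inherited_def
        intro!: exI[of _ 0])
  moreover have "progress {} (\<lambda>_. 0) 0 {} id 0 0 (\<lambda>_. 0) (\<lambda>_. 0) 0 0 {}" by (simp add: progress_def)
  ultimately show ?thesis
    by (intro state_invI) (auto simp: initial_state_def upd_cell_def bij_betw_def)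
qed

text \<open>Makes \<open>nb\<close> suitable as the \<open>base\<close> of the next plan.\<close>

lemma progress_less:
  assumes pl: "plan s \<delta> I0 B0 base hi len pit ptg V e"
    and p: "progress I B nb I0 B0 hi len pit ptg ptr u F" and i: "i \<in> I"
  shows "B i < nb"
proof (cases "i \<in> F")
  case True
  then show ?thesis using p by (simp add: progress_def)
next
  case False
  have r: "base \<le> hi" "\<And>l. l < len \<Longrightarrow> ptg l < hi" "ptr \<le> len" "\<And>i. i \<in> I0 \<Longrightarrow> B0 i < base" "I - F \<subseteq> I0" "hi \<le> nb"
    using pl p by (auto simp: plan_def progress_def)
  from pl p show ?thesis
  proof (rule progress_cases)
    show "i \<in> I - F" using i False by simp
  next
    fix l assume "l < ptr" "B i = ptg l"
    then show ?thesis using r(2)[of l] r(3,6) by simp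
  next
    assume "B i = B0 i"
    then show ?thesis using r(1,6) r(4)[of i] r(5) i False by (simp add: subset_iff)
  qed
qed

lemma wp_step:
  assumes inv: "state_inv s \<delta> \<epsilon> I \<sigma>" and adm: "admissible I (i, a)" and J: "J = apply_request I (i, a)"
    and sz: "\<And>j. j \<in> insert i I \<Longrightarrow> \<delta> \<le> s j \<and> s j \<le> 1" and pos: "0 < \<epsilon>" "0 < \<delta>"
    and W: "card J + moves \<epsilon> + 3 \<le> W"
  shows "wp W step_prog (\<lambda>\<tau>. state_inv s \<delta> \<epsilon> J \<tau> \<and> (\<exists>X. finite X \<and> card X \<le> moves \<epsilon> \<and>
    (\<forall>j\<in>I \<inter> J. j \<notin> X \<longrightarrow> nats \<tau> ''bin'' j = nats \<sigma> ''bin'' j))) (load_request s (i, a) \<sigma>)"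
proof -
  let ?\<sigma> = "load_request s (i, a) \<sigma>"
  let ?Q = "\<lambda>\<tau>. state_inv s \<delta> \<epsilon> J \<tau> \<and> (\<exists>X. finite X \<and> card X \<le> moves \<epsilon> \<and>
    (\<forall>j\<in>I \<inter> J. j \<notin> X \<longrightarrow> nats \<tau> ''bin'' j = nats \<sigma> ''bin'' j))"
  from inv obtain len ptr I0 B0 base hi V e u F where
    I: "reals \<sigma> ''eps'' 0 = \<epsilon>" "finite I" "nats \<sigma> ''n'' 0 = card I"
      "bij_betw (nats \<sigma> ''it'') {..<card I} I" "\<forall>i\<in>I. reals \<sigma> ''sz'' i = s i"
    and ep: "nats \<sigma> ''len'' 0 = len" "nats \<sigma> ''ptr'' 0 = ptr"
      "plan s \<delta> I0 B0 base hi len (nats \<sigma> ''pit'') (nats \<sigma> ''ptg'') V e"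
      "inherited \<delta> \<epsilon> len (real (num_bins I0 B0) - real (OPT s I0))"
      "progress I (nats \<sigma> ''bin'') (nats \<sigma> ''nb'' 0) I0 B0 hi len (nats \<sigma> ''pit'') (nats \<sigma> ''ptg'') ptr u F"
      "real u \<le> \<epsilon>\<^sup>2 * real len" "ptr = len \<or> real u + 1 \<le> \<epsilon>\<^sup>2 * real ptr"
    unfolding state_inv_def by blast
  define B nb where d: "B = nats \<sigma> ''bin''" "nb = nats \<sigma> ''nb'' 0"
  have ld: "nats ?\<sigma> x = nats \<sigma> x" if "x \<noteq> ''item''" "x \<noteq> ''insert''" for x
    using that by (simp add: upd_cell_def)
  have ldr: "reals ?\<sigma> x = reals \<sigma> x" if "x \<noteq> ''size''" for x
    using that by (simp add: upd_cell_def)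
  have ldi: "nats ?\<sigma> ''item'' 0 = i" "nats ?\<sigma> ''insert'' 0 = (case a of Insert \<Rightarrow> 1 | Delete \<Rightarrow> 0)"
    "reals ?\<sigma> ''size'' 0 = s i"
    by (simp_all add: upd_cell_def)
  define B' nb' F' where d': "B' = (case a of Insert \<Rightarrow> B(i := nb) | Delete \<Rightarrow> B)"
    "nb' = (case a of Insert \<Rightarrow> Suc nb | Delete \<Rightarrow> nb)" "F' = (case a of Insert \<Rightarrow> insert i F | Delete \<Rightarrow> F - {i})"
  have fin0: "finite I0" using plan_finite[OF ep(3)] by simp
  have prog: "progress J B' nb' I0 B0 hi len (nats \<sigma> ''pit'') (nats \<sigma> ''ptg'') ptr (Suc u) F'"
    using progress_insert[OF ep(5) _ fin0, of i] progress_delete[OF ep(5) _ fin0, of i] adm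
    by (cases a) (auto simp: d d' J)
  have old: "B' j = B j" if "j \<in> I \<inter> J" for j using that adm by (cases a) (auto simp: d' J)
  have szJ: "\<And>j. j \<in> J \<Longrightarrow> \<delta> \<le> s j \<and> s j \<le> 1" using sz by (cases a) (auto simp: J)
  have sz0: "\<And>j. j \<in> J \<Longrightarrow> 0 \<le> s j \<and> s j \<le> 1" using szJ pos by (meson less_imp_le order.trans)
  have finJ: "finite J" using prog by (simp add: progress_def)
  show ?thesis
    unfolding step_prog_def wp_basic
  proof (rule wp_request[where I = I and s = s and B = B and nb = nb and a = a and i = i and J = J], goal_cases)
    case (13 \<tau>)
    have s1: "nats \<tau> ''n'' 0 = card J" "bij_betw (nats \<tau> ''it'') {..<card J} J" "\<And>i. i \<in> J \<Longrightarrow> reals \<tau> ''sz'' i = s i"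
      "nats \<tau> ''bin'' = B'" "nats \<tau> ''nb'' 0 = nb'"
      using 13 by (simp_all add: d')
    have f1: "nats \<tau> ''len'' 0 = len" "nats \<tau> ''ptr'' 0 = ptr" "nats \<tau> ''pit'' = nats \<sigma> ''pit''"
      "nats \<tau> ''ptg'' = nats \<sigma> ''ptg''" "reals \<tau> ''eps'' 0 = \<epsilon>"
      using 13(1) ep(1,2) I(1) by (auto simp: agree_def request_prog_def insert_prog_def delete_prog_def ld ldr simp del: load_request.simps)
    have Wm: "moves \<epsilon> \<le> W" using W by simp
    show ?case
    proof (cases "ptr < len")
      case True
      have u: "real (Suc u) \<le> \<epsilon>\<^sup>2 * real ptr" using ep(7) True by simp
      also have "\<dots> \<le> \<epsilon>\<^sup>2 * real len" using True by (intro mult_left_mono) auto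
      finally have u': "real (Suc u) \<le> \<epsilon>\<^sup>2 * real len" .
      have pr1: "progress J (nats \<tau> ''bin'') nb' I0 B0 hi len (nats \<sigma> ''pit'') (nats \<sigma> ''ptg'') ptr (Suc u) F'"
        using prog by (simp add: s1)
      have "wp W move_prog ?Q \<tau>"
      proof (rule wp_move[OF f1(5) pos(1) Wm f1(1,3,4,2) ep(3) pr1], goal_cases)
        case (1 \<tau>2 F2 ptr2)
        have f2: "nats \<tau>2 ''n'' 0 = card J" "bij_betw (nats \<tau>2 ''it'') {..<card J} J" "\<And>i. i \<in> J \<Longrightarrow> reals \<tau>2 ''sz'' i = s i"
          "nats \<tau>2 ''nb'' 0 = nb'" "nats \<tau>2 ''len'' 0 = len" "nats \<tau>2 ''pit'' = nats \<sigma> ''pit''"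
          "nats \<tau>2 ''ptg'' = nats \<sigma> ''ptg''" "reals \<tau>2 ''eps'' 0 = \<epsilon>"
          using 1(1) s1 f1 by (auto simp: agree_def move_prog_def)
        have "ptr2 = len \<or> real (Suc u) + 1 \<le> \<epsilon>\<^sup>2 * real ptr2"
          using 1(4) u by (auto simp: algebra_simps)
        then have "state_inv s \<delta> \<epsilon> J \<tau>2"
          using 1(3) by (intro state_invI[OF f2(8) finJ f2(1,2,3,5) 1(2) f2(6,7) ep(3,4) _ u']) (simp_all add: f2(4))
        then show ?case using 1(6) old by (auto simp: s1 d)
      qed
      then show ?thesis using True f1 by simp
    next
      \<comment> \<open>The epoch is over, with the current request as its last one. Its excess is
        handed on through \<open>inherited\<close>, and the count of requests restarts at 0.\<close>
      case False
      have ptr: "ptr = len" using False ep(5) by (simp add: progress_def)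
      have pk: "is_packing s J B'" using progress_packing[OF ep(3) less_imp_le[OF pos(2)] prog sz0] .
      have u: "real (Suc u) \<le> \<epsilon>\<^sup>2 * real len + 1" using ep(6) by simp
      have inh: "inherited \<delta> \<epsilon> (card J) (real (num_bins J B') - real (OPT s J))"
        using epoch_end_bins[OF ep(3) less_imp_le[OF pos(2)] prog[unfolded ptr] u sz0] .
      have lt: "\<And>j. j \<in> J \<Longrightarrow> B' j < nats \<tau> ''nb'' 0" using progress_less[OF ep(3) prog] by (simp add: s1)
      have Wp: "card J + 2 \<le> W" using W by simp
      have "wp W plan_prog (wp W move_prog ?Q) \<tau>"
      proof (rule wp_plan[where s = s and \<delta> = \<delta>, OF s1(1,2,3) szJ pos(2) s1(4) pk lt Wp], goal_cases)
        case (4 \<tau>1 base1 hi1 V1 e1)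
        have g1: "nats \<tau>1 ''n'' 0 = card J" "\<And>i. i \<in> J \<Longrightarrow> reals \<tau>1 ''sz'' i = s i" "reals \<tau>1 ''eps'' 0 = \<epsilon>"
          "nats \<tau>1 ''bin'' = B'"
          using 4(1) s1 f1 by (auto simp: agreeN agreeR)
        have pr1: "progress J (nats \<tau>1 ''bin'') (nats \<tau>1 ''nb'' 0) J B' hi1 (card J) (nats \<tau>1 ''pit'') (nats \<tau>1 ''ptg'') 0 0 {}"
          using progress_start[OF 4(6,5)] by (simp add: g1)
        show ?case
        proof (rule wp_move[OF g1(3) pos(1) Wm 4(4) refl refl 4(3) 4(6) pr1], goal_cases)
          case (1 \<tau>2 F2 ptr2)
          have f2: "nats \<tau>2 ''n'' 0 = card J" "bij_betw (nats \<tau>2 ''it'') {..<card J} J" "\<And>i. i \<in> J \<Longrightarrow> reals \<tau>2 ''sz'' i = s i"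
            "nats \<tau>2 ''nb'' = nats \<tau>1 ''nb''" "nats \<tau>2 ''len'' 0 = card J" "nats \<tau>2 ''pit'' = nats \<tau>1 ''pit''"
            "nats \<tau>2 ''ptg'' = nats \<tau>1 ''ptg''" "reals \<tau>2 ''eps'' 0 = \<epsilon>"
            using 1(1) g1 4(2,4) by (auto simp: agree_def move_prog_def)
          have "ptr2 = card J \<or> real 0 + 1 \<le> \<epsilon>\<^sup>2 * real ptr2" using 1(4) by auto
          moreover have u0: "real 0 \<le> \<epsilon>\<^sup>2 * real (card J)" by simp
          ultimately have "state_inv s \<delta> \<epsilon> J \<tau>2"
            using 1(3) by (intro state_invI[OF f2(8) finJ f2(1,2,3,5) 1(2) f2(6,7) 4(6) inh _ u0]) (simp_all add: f2(4))
          then show ?case using 1(6) old by (auto simp: g1 d)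
        qed
      qed auto
      then show ?thesis using False f1 by simp
    qed
  qed (use I adm J W ldi in \<open>auto simp: ld ldr d simp del: load_request.simps\<close>)
qed

section \<open>The guarantees\<close>

lemma items_0 [simp]: "items xs 0 = {}"
  by (simp add: items_def)

lemma items_Suc: "t < length xs \<Longrightarrow> items xs (Suc t) = apply_request (items xs t) (xs ! t)"
  by (simp add: items_def take_Suc_conv_app_nth)

lemma items_subset: "t \<le> length xs \<Longrightarrow> items xs t \<subseteq> fst ` set xs"
proof (induction t)
  case (Suc t)
  obtain i a where ia: "xs ! t = (i, a)" by force
  then have "i \<in> fst ` set xs" using Suc.prems by (metis Suc_le_lessD fst_conv imageI nth_mem)
  then show ?case using Suc ia by (cases a) (auto simp: items_Suc)
qed simp

lemma inputs_min_sizeD: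
  assumes "(s, xs) \<in> inputs_min_size \<delta>"
  shows "\<And>i. i \<in> fst ` set xs \<Longrightarrow> \<delta> \<le> s i \<and> s i \<le> 1"
    and "\<And>t. t < length xs \<Longrightarrow> admissible (items xs t) (xs ! t)"
proof -
  show "\<delta> \<le> s i \<and> s i \<le> 1" if "i \<in> fst ` set xs" for i
    using assms that by (auto simp: inputs_min_size_def valid_inputs_def)
  show "admissible (items xs t) (xs ! t)" if "t < length xs" for t
  proof -
    have "\<forall>t\<in>{1..length xs}. admissible (items xs (t - 1)) (xs ! (t - 1))"
      using assms by (auto simp: inputs_min_size_def valid_inputs_def)
    from this[THEN bspec, of "Suc t"] that show ?thesis by simp
  qed
qed

definition good_run :: "real \<Rightarrow> real \<Rightarrow> (nat \<Rightarrow> real) \<Rightarrow> request list \<Rightarrow> (nat \<Rightarrow> state) \<Rightarrow> (nat \<Rightarrow> nat) \<Rightarrow> bool" where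
  "good_run \<delta> \<epsilon> s xs \<sigma> T \<longleftrightarrow> \<sigma> 0 = initial_state \<epsilon> \<and>
     (\<forall>t<length xs. exec step_prog (load_request s (xs ! t) (\<sigma> t)) (T (Suc t)) (\<sigma> (Suc t)) \<and>
        T (Suc t) \<le> (card (items xs (Suc t)) + moves \<epsilon> + 3) ^ dep step_prog \<and>
        (\<exists>X. finite X \<and> card X \<le> moves \<epsilon> \<and> (\<forall>i\<in>items xs t \<inter> items xs (Suc t).
           i \<notin> X \<longrightarrow> nats (\<sigma> (Suc t)) ''bin'' i = nats (\<sigma> t) ''bin'' i))) \<and>
     (\<forall>t\<le>length xs. state_inv s \<delta> \<epsilon> (items xs t) (\<sigma> t))"

lemma good_run_exists:
  assumes D: "(s, xs) \<in> inputs_min_size \<delta>" and pos: "0 < \<epsilon>" "0 < \<delta>"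
  shows "\<exists>\<sigma> T. good_run \<delta> \<epsilon> s xs \<sigma> T"
proof -
  \<comment> \<open>Beyond the end of \<open>xs\<close> both conditions are vacuous, so that
    dependent choice can run over all \<open>t\<close>.\<close>
  define P where "P t \<sigma> \<longleftrightarrow> (t = 0 \<longrightarrow> \<sigma> = initial_state \<epsilon>) \<and> (t \<le> length xs \<longrightarrow> state_inv s \<delta> \<epsilon> (items xs t) \<sigma>)"
    for t \<sigma>
  define Q where "Q t \<sigma> \<tau> \<longleftrightarrow> (t < length xs \<longrightarrow> (\<exists>k. exec step_prog (load_request s (xs ! t) \<sigma>) k \<tau> \<and>
      k \<le> (card (items xs (Suc t)) + moves \<epsilon> + 3) ^ dep step_prog \<and>
      (\<exists>X. finite X \<and> card X \<le> moves \<epsilon> \<and> (\<forall>i\<in>items xs t \<inter> items xs (Suc t).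
           i \<notin> X \<longrightarrow> nats \<tau> ''bin'' i = nats \<sigma> ''bin'' i))))" for t \<sigma> \<tau>
  have "\<exists>\<sigma>. \<forall>t. P t (\<sigma> t) \<and> Q t (\<sigma> t) (\<sigma> (Suc t))"
  proof (rule dependent_nat_choice)
    show "\<exists>\<sigma>. P 0 \<sigma>" using state_inv_initial by (auto simp: P_def)
  next
    fix \<sigma> t assume P: "P t \<sigma>"
    show "\<exists>\<tau>. P (Suc t) \<tau> \<and> Q t \<sigma> \<tau>"
    proof (cases "t < length xs")
      case True
      obtain i a where ia: "xs ! t = (i, a)" by force
      have adm: "admissible (items xs t) (i, a)" using inputs_min_sizeD(2)[OF D True] ia by simp
      have J: "items xs (Suc t) = apply_request (items xs t) (i, a)" using items_Suc[OF True] ia by simp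
      have inv: "state_inv s \<delta> \<epsilon> (items xs t) \<sigma>" using P True by (simp add: P_def)
      have "i \<in> fst ` set xs" using True ia by (metis fst_conv imageI nth_mem)
      then have "insert i (items xs t) \<subseteq> fst ` set xs" using items_subset[of t xs] True by simp
      then have sz: "\<And>j. j \<in> insert i (items xs t) \<Longrightarrow> \<delta> \<le> s j \<and> s j \<le> 1"
        using inputs_min_sizeD(1)[OF D] by blast
      from wp_sound[OF _ wp_step[OF inv adm J sz pos order.refl]]
      show ?thesis using True ia unfolding P_def Q_def by fastforce
    next
      case False
      then show ?thesis by (auto simp: P_def Q_def)
    qed
  qed
  then obtain \<sigma> where \<sigma>: "\<And>t. P t (\<sigma> t)" "\<And>t. Q t (\<sigma> t) (\<sigma> (Suc t))" by blast
  \<comment> \<open>The running time is determined by the two states, because execution is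
    deterministic.\<close>
  define T where "T t = (SOME k. exec step_prog (load_request s (xs ! (t - 1)) (\<sigma> (t - 1))) k (\<sigma> t))" for t
  have T: "T (Suc t) = k" if "exec step_prog (load_request s (xs ! t) (\<sigma> t)) k (\<sigma> (Suc t))" for t k
    unfolding T_def using that exec_deterministic by (intro some_equality) auto
  have "good_run \<delta> \<epsilon> s xs \<sigma> T"
    unfolding good_run_def
  proof (intro conjI allI impI)
    fix t assume t: "t < length xs"
    with \<sigma>(2)[of t] obtain k X where k: "exec step_prog (load_request s (xs ! t) (\<sigma> t)) k (\<sigma> (Suc t))"
      "k \<le> (card (items xs (Suc t)) + moves \<epsilon> + 3) ^ dep step_prog"
      and X: "finite X" "card X \<le> moves \<epsilon>" "\<forall>i\<in>items xs t \<inter> items xs (Suc t).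
           i \<notin> X \<longrightarrow> nats (\<sigma> (Suc t)) ''bin'' i = nats (\<sigma> t) ''bin'' i"
      unfolding Q_def by blast
    show "exec step_prog (load_request s (xs ! t) (\<sigma> t)) (T (Suc t)) (\<sigma> (Suc t))"
      "T (Suc t) \<le> (card (items xs (Suc t)) + moves \<epsilon> + 3) ^ dep step_prog"
      using k T[OF k(1)] by simp_all
    show "\<exists>X. finite X \<and> card X \<le> moves \<epsilon> \<and> (\<forall>i\<in>items xs t \<inter> items xs (Suc t).
           i \<notin> X \<longrightarrow> nats (\<sigma> (Suc t)) ''bin'' i = nats (\<sigma> t) ''bin'' i)"
      using X by blast
  qed (use \<sigma>(1) in \<open>auto simp: P_def\<close>)
  then show ?thesis by blast
qed

lemma state_inv_packing:
  assumes "state_inv s \<delta> \<epsilon> I \<sigma>" "\<And>i. i \<in> I \<Longrightarrow> \<delta> \<le> s i \<and> s i \<le> 1" "0 < \<delta>"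
  shows "is_packing s I (nats \<sigma> ''bin'')"
proof -
  have "\<And>i. i \<in> I \<Longrightarrow> 0 \<le> s i \<and> s i \<le> 1" using assms(2,3) by (meson less_imp_le order.trans)
  then show ?thesis using assms(1,3) progress_packing less_imp_le unfolding state_inv_def by metis
qed

lemma state_inv_bins:
  fixes \<epsilon> \<eta> C :: real
  assumes inv: "state_inv s \<delta> \<epsilon> I \<sigma>" and sz: "\<And>i. i \<in> I \<Longrightarrow> \<delta> \<le> s i \<and> s i \<le> 1"
    and \<delta>: "0 < \<delta>" and \<epsilon>: "\<epsilon>\<^sup>2 \<le> 1 / 4"
    and C: "\<And>n v e. slack \<delta> n v e \<Longrightarrow> v \<le> \<eta> * n + C \<and> e \<le> \<eta> * n + C" "0 \<le> \<eta>" "0 \<le> C"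
  shows "num_bins I (nats \<sigma> ''bin'') \<le> OPT s I + (12 * \<epsilon>\<^sup>2 + 8 * \<eta>) * (OPT s I / \<delta>) + (3 + 2 * \<eta> + 3 * C)"
proof -
  have s0: "\<And>i. i \<in> I \<Longrightarrow> 0 \<le> s i \<and> s i \<le> 1" using sz \<delta> by (meson less_imp_le order.trans)
  from inv obtain len ptr I0 B0 base hi V e u F where
    fin: "finite I" and ep: "plan s \<delta> I0 B0 base hi len (nats \<sigma> ''pit'') (nats \<sigma> ''ptg'') V e"
      "inherited \<delta> \<epsilon> len (real (num_bins I0 B0) - real (OPT s I0))"
      "progress I (nats \<sigma> ''bin'') (nats \<sigma> ''nb'' 0) I0 B0 hi len (nats \<sigma> ''pit'') (nats \<sigma> ''ptg'') ptr u F"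
      "real u \<le> \<epsilon>\<^sup>2 * real len"
    unfolding state_inv_def by blast
  have "num_bins I (nats \<sigma> ''bin'') \<le> OPT s I + (12 * \<epsilon>\<^sup>2 + 8 * \<eta>) * card I + (3 + 2 * \<eta> + 3 * C)"
    by (rule epoch_bins[OF ep(1) less_imp_le[OF \<delta>] ep(3,4) \<epsilon> ep(2) s0 C])
  also have "card I \<le> OPT s I / \<delta>" using card_le_OPT[OF fin sz \<delta>] \<delta> by (simp add: pos_le_divide_eq)
  then have "(12 * \<epsilon>\<^sup>2 + 8 * \<eta>) * card I \<le> (12 * \<epsilon>\<^sup>2 + 8 * \<eta>) * (OPT s I / \<delta>)"
    using C(2) by (intro mult_left_mono) auto
  finally show ?thesis by simp
qed

text \<open>The ratio asks for one function \<open>f\<close> of \<open>OPT\<close> that serves all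
  inputs: take the supremum of the errors over the inputs with a given value. The assumption with a
  single \<open>\<zeta>\<close> makes it finite, and with all \<open>\<zeta>\<close> it makes it
  sublinear. Inserting 0 settles values that do not occur and keeps \<open>f\<close>
  nonnegative.\<close>

lemma sublinear_majorant:
  fixes X :: "'a \<Rightarrow> real" and k :: "'a \<Rightarrow> nat"
  assumes "\<And>\<zeta> :: real. 0 < \<zeta> \<Longrightarrow> \<exists>C :: real. \<forall>a\<in>A. X a \<le> \<zeta> * k a + C"
  shows "\<exists>f. f \<in> o(\<lambda>j. real j) \<and> (\<forall>a\<in>A. X a \<le> f (k a))"
proof -
  define f where "f j = Sup (insert 0 (X ` {a \<in> A. k a = j}))" for j
  have bdd: "bdd_above (insert 0 (X ` {a \<in> A. k a = j}))" for j
  proof -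
    obtain C :: real where C: "\<forall>a\<in>A. X a \<le> 1 * k a + C" using assms[of 1] by auto
    then show ?thesis by (intro bdd_aboveI[of _ "max 0 (real j + C)"]) auto
  qed
  have "X a \<le> f (k a)" if "a \<in> A" for a
    unfolding f_def using that by (intro cSup_upper bdd) auto
  moreover have "f \<in> o(\<lambda>j. real j)"
  proof (rule landau_o.smallI)
    fix c :: real assume c: "0 < c"
    then obtain C :: real where C: "\<forall>a\<in>A. X a \<le> c / 2 * k a + C" using assms[of "c / 2"] by auto
    have f0: "0 \<le> f j" for j unfolding f_def by (intro cSup_upper bdd) auto
    have fle: "f j \<le> c / 2 * j + \<bar>C\<bar>" for j
      unfolding f_def using C c by (intro cSup_least) (auto intro: order.trans)
    show "\<forall>\<^sub>F j in at_top. norm (f j) \<le> c * norm (real j)"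
      using eventually_ge_at_top[of "nat \<lceil>2 * \<bar>C\<bar> / c\<rceil>"]
    proof eventually_elim
      case (elim j)
      then have "2 * \<bar>C\<bar> / c \<le> j" by linarith
      then have "\<bar>C\<bar> \<le> c / 2 * j" using c by (simp add: field_simps)
      then have "f j \<le> c / 2 * j + c / 2 * j" using fle[of j] by linarith
      then show ?case using f0[of j] by simp
    qed
  qed
  ultimately show ?thesis by blast
qed

text \<open>The outer variable stands for \<open>n\<close> and the coefficients are polynomials in
  \<open>1 / \<epsilon>\<close>, so the base of the power is \<open>1 + x + y\<close>. The loop
  bound \<open>n + moves \<epsilon> + 3\<close> is at most \<open>n + y\<^sup>2 + 4\<close> for
  \<open>y = 1 / \<epsilon>\<close>, and 5 times the square of \<open>1 + n + y\<close> dominates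
  this.\<close>

definition time_poly :: "real poly poly" where
  "time_poly = [:[:5 ^ dep step_prog:]:] * [:[:1, 1:], 1:] ^ (2 * dep step_prog)"

lemma poly2_time_poly: "poly2 time_poly x y = 5 ^ dep step_prog * (1 + x + y) ^ (2 * dep step_prog)"
  by (simp add: time_poly_def poly2_def poly_power add_ac)

lemma time_le:
  assumes "0 < \<epsilon>" "\<epsilon> \<le> 1"
  shows "real ((n + moves \<epsilon> + 3) ^ dep step_prog) \<le> poly2 time_poly (real n) (1 / \<epsilon>)"
proof -
  define y where "y = 1 / \<epsilon>"
  have y: "1 \<le> y" using assms by (simp add: y_def)
  have "moves \<epsilon> \<le> y\<^sup>2 + 1" unfolding moves_def y_def by (simp add: power_divide)
  then have "real (n + moves \<epsilon> + 3) \<le> n + y\<^sup>2 + 4" by simp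
  also have "\<dots> \<le> 5 * (1 + n + y)\<^sup>2"
  proof -
    have "0 \<le> n * y" "0 \<le> real n * n" using y by simp_all
    then show ?thesis using y by (simp add: power2_eq_square algebra_simps)
  qed
  finally have "real (n + moves \<epsilon> + 3) ^ dep step_prog \<le> (5 * (1 + n + y)\<^sup>2) ^ dep step_prog"
    by (intro power_mono) auto
  then show ?thesis by (simp add: poly2_time_poly y_def power_mult_distrib power_mult)
qed

theorem theorem5:
  "\<exists>(P :: com) (p :: real poly poly) (g :: real \<Rightarrow> real) (h :: real \<Rightarrow> real).
     g \<in> O[at_right 0](\<lambda>\<epsilon>. \<epsilon>) \<and>
     h \<in> O[at_right 0](\<lambda>\<epsilon>. 1 / \<epsilon> ^ 3 * ln (1 / \<epsilon>)) \<and>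
     (\<forall>\<^sub>F \<epsilon> in at_right 0. \<exists>A T.
        computes P \<epsilon> (inputs_min_size (\<epsilon> / 14)) A T \<and>
        maintains_packing (inputs_min_size (\<epsilon> / 14)) A \<and>
        step_time_at_most (inputs_min_size (\<epsilon> / 14)) T (\<lambda>n. poly2 p (real n) (1 / \<epsilon>)) \<and>
        asymptotic_ratio_at_most (inputs_min_size (\<epsilon> / 14)) A (1 + g \<epsilon>) \<and>
        migration_factor_at_most (inputs_min_size (\<epsilon> / 14)) A (h \<epsilon>))"
proof -
  \<comment> \<open>\<open>168\<close> is \<open>12 * 14\<close>: the linear part of the excess is
    \<open>12 * \<epsilon>\<^sup>2\<close> per item, and there are at most
    \<open>14 * OPT / \<epsilon>\<close> items. In \<open>h\<close> the volume moved, at most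
    \<open>1 / \<epsilon>\<^sup>2 + 1\<close>, is divided by the least item size
    \<open>\<epsilon> / 14\<close>.\<close>
  define g :: "real \<Rightarrow> real" where "g \<epsilon> = 168 * \<epsilon>" for \<epsilon>
  define h :: "real \<Rightarrow> real" where "h \<epsilon> = 14 * (1 / \<epsilon>\<^sup>2 + 1) / \<epsilon>" for \<epsilon>
  have g: "g \<in> O[at_right 0](\<lambda>\<epsilon>. \<epsilon>)"
  proof -
    have "g = (\<lambda>\<epsilon>. 168 * \<epsilon>)" by (rule ext) (simp add: g_def)
    then show ?thesis by simp
  qed
  \<comment> \<open>Below \<open>exp (- 1)\<close> the logarithm of \<open>1 / \<epsilon>\<close> is
    at least 1, so that a bound of order \<open>1 / \<epsilon> ^ 3\<close> suffices for
    \<open>h\<close>. It also yields \<open>\<epsilon> <= 1 / 2\<close>, as the count of bins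
    requires.\<close>
  have small: "\<forall>\<^sub>F \<epsilon> in at_right (0 :: real). 0 < \<epsilon> \<and> \<epsilon> < exp (- 1)"
    unfolding eventually_at_right_field by (intro exI[of _ "exp (- 1)"]) auto
  have h: "h \<in> O[at_right 0](\<lambda>\<epsilon>. 1 / \<epsilon> ^ 3 * ln (1 / \<epsilon>))"
  proof (rule landau_o.bigI[of 28])
    show "\<forall>\<^sub>F \<epsilon> in at_right 0. norm (h \<epsilon>) \<le> 28 * norm (1 / \<epsilon> ^ 3 * ln (1 / \<epsilon>))"
      using small
    proof eventually_elim
      case (elim \<epsilon>)
      then have "ln \<epsilon> \<le> ln (exp (- 1))" by (subst ln_le_cancel_iff) auto
      then have ln: "1 \<le> ln (1 / \<epsilon>)" using elim by (simp add: ln_div)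
      have "\<epsilon> < exp 0" using elim by (meson exp_less_cancel_iff less_trans neg_less_0_iff_less zero_less_one)
      then have "\<epsilon>\<^sup>2 \<le> 1" using elim by (simp add: power_le_one)
      then have "h \<epsilon> \<le> 28 * (1 / \<epsilon> ^ 3)" using elim
        by (simp add: h_def field_simps power2_eq_square power3_eq_cube)
      also have "\<dots> \<le> 28 * (1 / \<epsilon> ^ 3 * ln (1 / \<epsilon>))"
        using ln elim by (intro mult_left_mono) (simp_all add: divide_right_mono)
      finally show ?case using elim ln by (simp add: h_def abs_mult)
    qed
  qed simp
  have "\<forall>\<^sub>F \<epsilon> in at_right 0. \<exists>A T.
        computes step_prog \<epsilon> (inputs_min_size (\<epsilon> / 14)) A T \<and>
        maintains_packing (inputs_min_size (\<epsilon> / 14)) A \<and>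
        step_time_at_most (inputs_min_size (\<epsilon> / 14)) T (\<lambda>n. poly2 time_poly (real n) (1 / \<epsilon>)) \<and>
        asymptotic_ratio_at_most (inputs_min_size (\<epsilon> / 14)) A (1 + g \<epsilon>) \<and>
        migration_factor_at_most (inputs_min_size (\<epsilon> / 14)) A (h \<epsilon>)"
    using small
  proof eventually_elim
    case (elim \<epsilon>)
    define \<delta> where "\<delta> = \<epsilon> / 14"
    define D where "D = inputs_min_size \<delta>"
    have "2 \<le> exp (1 :: real)" using exp_ge_add_one_self[of 1] by simp
    then have "exp (- 1) \<le> (1 / 2 :: real)" by (simp add: exp_minus field_simps)
    then have \<epsilon>: "0 < \<epsilon>" "\<epsilon> \<le> 1 / 2" and \<delta>: "0 < \<delta>" using elim by (auto simp: \<delta>_def)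
    have \<epsilon>2: "\<epsilon>\<^sup>2 \<le> 1 / 4" using power_mono[OF \<epsilon>(2), of 2] \<epsilon>(1) by (simp add: power2_eq_square)
    \<comment> \<open>\<open>A\<close> and \<open>T\<close> have to be functions of the input, so
      one run is fixed for each input.\<close>
    define S where "S s xs = (SOME \<sigma>. \<exists>T. good_run \<delta> \<epsilon> s xs \<sigma> T)" for s xs
    define T where "T s xs = (SOME T. good_run \<delta> \<epsilon> s xs (S s xs) T)" for s xs
    define A where "A s xs t = nats (S s xs t) ''bin''" for s xs t
    have run: "good_run \<delta> \<epsilon> s xs (S s xs) (T s xs)" if "(s, xs) \<in> D" for s xs
    proof -
      have "\<exists>T. good_run \<delta> \<epsilon> s xs (S s xs) T"
        unfolding S_def
        using someI_ex[OF good_run_exists[OF that[unfolded D_def] \<epsilon>(1) \<delta>]] .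
      then show ?thesis unfolding T_def by (rule someI_ex)
    qed
    have inv: "state_inv s \<delta> \<epsilon> (items xs t) (S s xs t)" if "(s, xs) \<in> D" "t \<le> length xs" for s xs t
      using run[OF that(1)] that(2) by (auto simp: good_run_def)
    have sz: "\<delta> \<le> s i \<and> s i \<le> 1" if "(s, xs) \<in> D" "t \<le> length xs" "i \<in> items xs t" for s xs t i
      using inputs_min_sizeD(1)[OF that(1)[unfolded D_def]] items_subset[OF that(2)] that(3) by blast
    have pre: "\<exists>t'. t = Suc t' \<and> t' < length xs" if "t \<in> {1..length xs}" for t and xs :: "request list"
      using that by (intro exI[of _ "t - 1"]) auto
    have "computes step_prog \<epsilon> D A T"
      unfolding computes_def
    proof (intro ballI, clarify)
      fix s xs assume D: "(s, xs) \<in> D"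
      have "exec step_prog (load_request s (xs ! (t - 1)) (S s xs (t - 1))) (T s xs t) (S s xs t)"
        if "t \<in> {1..length xs}" for t
      proof -
        from pre[OF that] obtain t' where "t = Suc t'" "t' < length xs" by blast
        then show ?thesis using run[OF D] by (simp add: good_run_def)
      qed
      moreover have "S s xs 0 = initial_state \<epsilon>" using run[OF D] by (simp add: good_run_def)
      ultimately show "\<exists>\<sigma>. \<sigma> 0 = initial_state \<epsilon> \<and>
          (\<forall>t\<in>{1..length xs}. exec step_prog (load_request s (xs ! (t - 1)) (\<sigma> (t - 1))) (T s xs t) (\<sigma> t)) \<and>
          (\<forall>t\<le>length xs. A s xs t = nats (\<sigma> t) ''bin'')"
        by (intro exI[of _ "S s xs"]) (simp add: A_def)
    qed
    moreover have "maintains_packing D A"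
      unfolding maintains_packing_def A_def
    proof (intro ballI, clarify)
      fix s xs t assume *: "(s, xs) \<in> D" "t \<le> length xs"
      show "is_packing s (items xs t) (nats (S s xs t) ''bin'')"
        by (rule state_inv_packing[OF inv[OF *] sz[OF *] \<delta>])
    qed
    moreover have "step_time_at_most D T (\<lambda>n. poly2 time_poly (real n) (1 / \<epsilon>))"
      unfolding step_time_at_most_def
    proof (intro ballI, clarify)
      fix s xs t assume "(s, xs) \<in> D" "t \<in> {1..length xs}"
      then obtain t' where t: "t = Suc t'" "t' < length xs" using pre by blast
      have "T s xs t \<le> (card (items xs t) + moves \<epsilon> + 3) ^ dep step_prog"
        using run[OF \<open>(s, xs) \<in> D\<close>] t by (simp add: good_run_def)
      then have "real (T s xs t) \<le> real ((card (items xs t) + moves \<epsilon> + 3) ^ dep step_prog)" by (rule of_nat_mono)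
      also have "\<dots> \<le> poly2 time_poly (real (card (items xs t))) (1 / \<epsilon>)"
        using \<epsilon> by (intro time_le) auto
      finally show "real (T s xs t) \<le> poly2 time_poly (real (card (items xs t))) (1 / \<epsilon>)" .
    qed
    moreover have "asymptotic_ratio_at_most D A (1 + g \<epsilon>)"
    proof -
      define E where "E = {(s, xs, t) | s xs t. (s, xs) \<in> D \<and> t \<le> length xs}"
      define opt where "opt = (\<lambda>(s, xs, t). OPT s (items xs t))"
      define X where "X = (\<lambda>(s, xs, t). real (num_bins (items xs t) (A s xs t)) - (1 + g \<epsilon>) * real (OPT s (items xs t)))"
      have "\<exists>f. f \<in> o(\<lambda>j. real j) \<and> (\<forall>a\<in>E. X a \<le> f (opt a))"
      proof (rule sublinear_majorant)
        fix \<zeta> :: real assume "0 < \<zeta>"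
        \<comment> \<open>Chosen such that \<open>8 * \<eta> * (w / \<delta>)\<close> equals
          \<open>\<zeta> * w\<close>, the part that the sublinear function absorbs.\<close>
        define \<eta> where "\<eta> = \<zeta> * \<delta> / 8"
        have \<eta>: "0 < \<eta>" using \<open>0 < \<zeta>\<close> \<delta> by (simp add: \<eta>_def)
        obtain C where C: "0 \<le> C" "\<And>n v e. slack \<delta> n v e \<Longrightarrow> v \<le> \<eta> * n + C \<and> e \<le> \<eta> * n + C"
          using slack_sublinear[OF \<delta> \<eta>] by blast
        have "X a \<le> \<zeta> * opt a + (3 + 2 * \<eta> + 3 * C)" if "a \<in> E" for a
        proof -
          from that obtain s xs t where a: "a = (s, xs, t)" "(s, xs) \<in> D" "t \<le> length xs" by (auto simp: E_def)
          define w where "w = real (OPT s (items xs t))"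
          have "num_bins (items xs t) (A s xs t) \<le> w + (12 * \<epsilon>\<^sup>2 + 8 * \<eta>) * (w / \<delta>) + (3 + 2 * \<eta> + 3 * C)"
            unfolding A_def w_def
            by (rule state_inv_bins[OF inv[OF a(2,3)] sz[OF a(2,3)] \<delta> \<epsilon>2 C(2) less_imp_le[OF \<eta>] C(1)])
          moreover have "(12 * \<epsilon>\<^sup>2 + 8 * \<eta>) * (w / \<delta>) = g \<epsilon> * w + \<zeta> * w"
            using \<epsilon>(1) by (simp add: g_def \<eta>_def \<delta>_def power2_eq_square field_simps)
          ultimately show ?thesis by (simp add: a X_def opt_def algebra_simps flip: w_def)
        qed
        then show "\<exists>C. \<forall>a\<in>E. X a \<le> \<zeta> * opt a + C" by blast
      qed
      then obtain f where f: "f \<in> o(\<lambda>j. real j)" "\<forall>a\<in>E. X a \<le> f (opt a)" by blast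
      have "real (num_bins (items xs t) (A s xs t)) \<le> (1 + g \<epsilon>) * real (OPT s (items xs t)) + f (OPT s (items xs t))"
        if "(s, xs) \<in> D" "t \<le> length xs" for s xs t
        using f(2)[THEN bspec, of "(s, xs, t)"] that by (auto simp: E_def X_def opt_def)
      then show ?thesis unfolding asymptotic_ratio_at_most_def using f(1) by blast
    qed
    moreover have "migration_factor_at_most D A (h \<epsilon>)"
      unfolding migration_factor_at_most_def
    proof (intro ballI, clarify)
      fix s xs t assume D: "(s, xs) \<in> D" "t \<in> {1..length xs}"
      then obtain t' where t: "t = Suc t'" "t' < length xs" using pre by blast
      let ?M = "{i \<in> items xs t' \<inter> items xs t. A s xs t i \<noteq> A s xs t' i}"
      obtain X where X: "finite X" "card X \<le> moves \<epsilon>"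
        "\<forall>i\<in>items xs t' \<inter> items xs t. i \<notin> X \<longrightarrow> A s xs t i = A s xs t' i"
        using run[OF D(1)] t by (auto simp: good_run_def A_def)
      then have "?M \<subseteq> X" by blast
      then have "card ?M \<le> moves \<epsilon>" by (rule order.trans[OF card_mono[OF X(1)] X(2)])
      have "repack A s xs t = (\<Sum>i\<in>?M. s i)" by (simp add: repack_def t)
      also have "\<dots> \<le> (\<Sum>i\<in>?M. 1)" using sz[OF D(1), of t] D(2) by (intro sum_mono) auto
      also have "\<dots> = card ?M" by simp
      also have "\<dots> \<le> moves \<epsilon>" using \<open>card ?M \<le> moves \<epsilon>\<close> by simp
      also have "\<dots> \<le> 1 / \<epsilon>\<^sup>2 + 1" unfolding moves_def by simp
      finally have rp: "repack A s xs t \<le> 1 / \<epsilon>\<^sup>2 + 1" .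
      have "fst (xs ! t') \<in> fst ` set xs" using t by simp
      then have si: "\<delta> \<le> s (fst (xs ! t'))" using inputs_min_sizeD(1)[OF D(1)[unfolded D_def]] by blast
      have "repack A s xs t / s (fst (xs ! t')) \<le> (1 / \<epsilon>\<^sup>2 + 1) / s (fst (xs ! t'))"
        using rp si \<delta> by (intro divide_right_mono) auto
      also have "\<dots> \<le> (1 / \<epsilon>\<^sup>2 + 1) / \<delta>"
        using si \<delta> by (intro divide_left_mono) auto
      also have "\<dots> = h \<epsilon>" by (simp add: h_def \<delta>_def)
      finally show "repack A s xs t / s (fst (xs ! (t - 1))) \<le> h \<epsilon>" by (simp add: t)
    qed
    ultimately show ?case unfolding D_def \<delta>_def by blast
  qed
  with g h show ?thesis by blast
qed

end
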